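(* Let $K$ be an infinite field of characteristic $p=2$, let $d\ge1$, and consider multidegrees $\Delta=(\delta_1,\ldots,\delta_d)$ with $\delta_1\ge\cdots\ge\delta_d\ge1$. 1. For $d\le3$, a basis of $N_{3,d}(\Delta)$ is the set $B_\Delta$, where: $B_1=\{x_1\}$; $B_{1^2}=\{x_1x_2, x_2x_1\}$; $B_2=\{x_1^2\}$; $B_{1^3}=\{x_1x_2x_3, x_1x_3x_2, x_2x_1x_3, x_2x_3x_1, x_3x_1x_2\}$; $B_{21}=\{x_1^2x_2, x_2x_1^2\}$; $B_{21^2}=\{x_1^2x_2x_3, x_1^2x_3x_2, x_2x_1^2x_3, x_2x_3x_1^2, x_3x_2x_1^2\}$; $B_{2^2}=\{x_1^2x_2^2, x_2^2x_1^2\}$; $B_{31}=\{x_1^2x_2x_1\}$; $B_{2^21}=\{x_1^2x_2^2x_3, x_2^2x_1^2x_3, x_3x_1^2x_2^2\}$; $B_{31^2}=\{x_1^2x_2x_3x_1, x_1^2x_3x_2x_1\}$; $B_{32}=\{x_1^2x_2^2x_1\}$; and $B_\Delta=\emptyset$ otherwise. 2. For $d\ge4$, a basis of $N_{3,d}(1^d)$ is the set $B_{1^d}$ defined in the context. 3. A basis of $N_{3,4}(21^3)$ is $B_{21^3}=\{\underline a_i,\underline b_i,\underline c_{23},\underline c_{32}\mid i=2,3,4\}$. For $d\ge5$, a basis of $N_{3,d}(21^{d-1})$ is $B_{21^{d-1}}=\{\underline a_i,\underline b_i,\underline c_{23}\mid i=2,\ldots,d\}$. 4. For $d\ge4$,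 a basis of $N_{3,d}(2^21^{d-2})$ is $B_{2^21^{d-2}}=\{x_1^2x_2^2x_3\cdots x_d,\ x_2^2x_1^2x_3\cdots x_d\}$. 5. For $d\ge4$, a basis of $N_{3,d}(31^{d-1})$ is $B_{31^{d-1}}=\{x_1^2x_2\cdots x_dx_1\}$. 6. The remaining homogeneous components $N_{3,d}(\Delta)$ are equal to zero.
   Context: $N_{3,d}$ is the quotient of the free associative non-unitary $K$-algebra $K\langle x_1,\ldots,x_d\rangle^{\#}$ by the ideal generated by all $a^3$, $a\in K\langle x_1,\ldots,x_d\rangle^{\#}$. It is $\mathbb N^d$-graded by multidegree and $N_{3,d}(\Delta)$ is the component of multidegree $\Delta$. $3^r2^s1^t$ denotes the multidegree $(3,\ldots,3,2,\ldots,2,1,\ldots,1)$ with $r$ threes, $s$ twos, $t$ ones. Words are identified with their images in $N_{3,d}$. The product $x_i\cdots x_j$ means $x_ix_{i+1}\cdots x_j$ if $1\le i\le j$ and the empty word otherwise; $\widetilde{x}_i$ means that the letter $x_i$ is omitted. For a set of words $S$, $S|_{x_i\to x_{i+1}}$ is the set obtained by the indicated substitution, and $vS=\{vu\mid u\in S\}$. Definition of $B_{1^d}$ for $p=2$ (recursive): put $B'_{1}=\{x_1\}$ and, for $d\ge2$, $$B'_{1^d}=x_1\{B_{1^{d-1}}|_{x_i\to x_{i+1},\,i=1,\ldots,d-1}\}\cup\{\underline e_{d,k}\mid k=2,\ldots,d\}\cup\{\underline f_d\}\cup\{\underline h_{d,k}\mid k=3,\ldots,d\},$$ where $B_{1^i}=B'_{1^i}$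 for $i\ge1$, $i\ne4$, and $B_{1^4}=B'_{1^4}\cup\{x_2x_1x_4x_3\}$. Here $\underline e_{d,k}=x_2\cdots x_k\cdot x_1\cdot x_{k+1}\cdots x_d$ ($d\ge2$, $2\le k\le d$); $\underline f_d=x_2\cdots x_{d-2}\cdot x_dx_1x_{d-1}$ (defined only for $d\ge3$); $\underline h_{d,k}=x_k\cdot x_1\cdots\widetilde{x}_k\cdots x_d$ (defined only for $d\ge3$, $3\le k\le d$); undefined words are omitted from the union. For $d\ge4$ and $i,j\in\{2,\ldots,d\}$, $i\neq j$, define words of multidegree $21^{d-1}$: $\underline a_i=x_1^2x_ix_2\cdots\widetilde{x}_i\cdots x_d$; $\underline b_i=x_2\cdots\widetilde{x}_i\cdots x_dx_ix_1^2$; $\underline c_{ij}=x_ix_1^2x_j$ followed by the product, in increasing order of indices, of all letters $x_m$, $2\le m\le d$, $m\ne i,j$. *)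

theory Defs
  imports
    "HOL-Library.Poly_Mapping"
    "HOL-Algebra.QuotRing"
    "Jordan_Normal_Form.VS_Connect"
begin

text \<open>The letter $x_i$ is encoded by the number $i \ge 1$. The wrapper type gives words the
  monoid structure of concatenation, so that finitely supported functions on words carry the
  convolution product of the library, which is the product of the free algebra.\<close>

datatype fword = Word (letters: "nat list")

instantiation fword :: monoid_add
begin

definition "0 = Word []"

definition "u + v = Word (letters u @ letters v)"

instance
  by standard (simp_all add: zero_fword_def plus_fword_def)

end

type_synonym 'k freealg = "fword \<Rightarrow>\<^sub>0 'k"

definition fscale :: "'k::field \<Rightarrow> 'k freealg \<Rightarrow> 'k freealg" where
  "fscale c = Poly_Mapping.map ((*) c)"

definition free_carrier :: "nat \<Rightarrow> 'k::field freealg set" where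
  "free_carrier d =
     {f. \<forall>w \<in> Poly_Mapping.keys f. letters w \<noteq> [] \<and> set (letters w) \<subseteq> {1..d}}"

text \<open>The algebra has no identity element; the field \<open>one\<close> is present only because
  the record type demands it.\<close>

definition free_alg :: "nat \<Rightarrow> ('k::field, 'k freealg) module" where
  "free_alg d = \<lparr>carrier = free_carrier d, mult = (*), one = undefined,
     zero = 0, add = (+), smult = fscale\<rparr>"

text \<open>Ideals of a non-unitary \<open>K\<close>-algebra: closure under scalars does not follow
  from closure under multiplication and has to be required.\<close>

definition alg_ideal :: "nat \<Rightarrow> 'k::field freealg set \<Rightarrow> bool" where
  "alg_ideal d I \<longleftrightarrow>
     I \<subseteq> free_carrier d \<and> 0 \<in> I \<and>
     (\<forall>f \<in> I. \<forall>g \<in> I. f + g \<in> I) \<and>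
     (\<forall>c. \<forall>f \<in> I. fscale c f \<in> I) \<and>
     (\<forall>a \<in> free_carrier d. \<forall>f \<in> I. a * f \<in> I \<and> f * a \<in> I)"

definition cube_ideal :: "nat \<Rightarrow> 'k::field freealg set" where
  "cube_ideal d = alg_ideal d hull ((\<lambda>a. a ^ 3) ` free_carrier d)"

definition N3 :: "nat \<Rightarrow> ('k::field, 'k freealg set) module" where
  "N3 d = \<lparr>carrier = a_rcosets\<^bsub>free_alg d\<^esub> (cube_ideal d),
     mult = rcoset_mult (free_alg d) (cube_ideal d),
     one = undefined,
     zero = cube_ideal d,
     add = set_add (free_alg d),
     smult = (\<lambda>c X. \<Union>f \<in> X. cube_ideal d +>\<^bsub>free_alg d\<^esub> fscale c f)\<rparr>"

definition multidegree :: "nat \<Rightarrow> fword \<Rightarrow> nat list" where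
  "multidegree d w = map (count_list (letters w)) [1..<Suc d]"

definition N3_comp :: "nat \<Rightarrow> nat list \<Rightarrow> ('k::field, 'k freealg set) module" where
  "N3_comp d \<Delta> = (N3 d)\<lparr>carrier :=
     (\<lambda>f. cube_ideal d +>\<^bsub>free_alg d\<^esub> f) `
       {f \<in> free_carrier d. \<forall>w \<in> Poly_Mapping.keys f. multidegree d w = \<Delta>}\<rparr>"

definition word_image :: "nat \<Rightarrow> nat list \<Rightarrow> 'k::field freealg set" where
  "word_image d w = cube_ideal d +>\<^bsub>free_alg d\<^esub> Poly_Mapping.single (Word w) 1"

text \<open>Words are identified with their images in the quotient. Injectivity says that
  distinct listed words give distinct basis elements.\<close>

definition is_comp_basis :: "'k::field itself \<Rightarrow> nat \<Rightarrow> nat list \<Rightarrow> nat list set \<Rightarrow> bool" where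
  "is_comp_basis _ d \<Delta> B \<longleftrightarrow>
     inj_on (word_image d :: nat list \<Rightarrow> 'k freealg set) B \<and>
     vectorspace.basis class_ring (N3_comp d \<Delta>) ((word_image d :: nat list \<Rightarrow> 'k freealg set) ` B)"

definition ordered_multidegree :: "nat \<Rightarrow> nat list \<Rightarrow> bool" where
  "ordered_multidegree d \<Delta> \<longleftrightarrow>
     length \<Delta> = d \<and> sorted_wrt (\<ge>) \<Delta> \<and> (\<forall>\<delta> \<in> set \<Delta>. 1 \<le> \<delta>)"

definition letter_run :: "nat \<Rightarrow> nat \<Rightarrow> nat list" where
  "letter_run i j = [i..<Suc j]"

definition e_word :: "nat \<Rightarrow> nat \<Rightarrow> nat list" where
  "e_word d k = letter_run 2 k @ [1] @ letter_run (k + 1) d"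

definition f_word :: "nat \<Rightarrow> nat list" where
  "f_word d = letter_run 2 (d - 2) @ [d, 1, d - 1]"

definition h_word :: "nat \<Rightarrow> nat \<Rightarrow> nat list" where
  "h_word d k = k # removeAll k (letter_run 1 d)"

text \<open>\<open>map Suc\<close> is the substitution $x_i \to x_{i+1}$; the \<open>f\<close> and \<open>h\<close> words exist
  only from length 3 on. Listed words may coincide (both \<open>f_word 3\<close> and \<open>h_word 3 3\<close> are
  $x_3x_1x_2$), which is harmless in a set.\<close>

fun B_lin :: "nat \<Rightarrow> nat list set" where
  "B_lin 0 = {}"
| "B_lin (Suc 0) = {[1]}"
| "B_lin (Suc (Suc n)) = (let d = Suc (Suc n) in
     (\<lambda>u. 1 # map Suc u) ` B_lin (Suc n)
     \<union> {e_word d k | k. 2 \<le> k \<and> k \<le> d}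
     \<union> (if 3 \<le> d then {f_word d} \<union> {h_word d k | k. 3 \<le> k \<and> k \<le> d} else {})
     \<union> (if d = 4 then {[2, 1, 4, 3]} else {}))"

definition a_word :: "nat \<Rightarrow> nat \<Rightarrow> nat list" where
  "a_word d i = [1, 1, i] @ removeAll i (letter_run 2 d)"

definition b_word :: "nat \<Rightarrow> nat \<Rightarrow> nat list" where
  "b_word d i = removeAll i (letter_run 2 d) @ [i, 1, 1]"

definition c_word :: "nat \<Rightarrow> nat \<Rightarrow> nat \<Rightarrow> nat list" where
  "c_word d i j = [i, 1, 1, j] @ removeAll i (removeAll j (letter_run 2 d))"

definition B_small :: "nat list \<Rightarrow> nat list set" where
  "B_small \<Delta> =
    (if \<Delta> = [1] then {[1]}
     else if \<Delta> = [1, 1] then {[1, 2], [2, 1]}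
     else if \<Delta> = [2] then {[1, 1]}
     else if \<Delta> = [1, 1, 1] then {[1, 2, 3], [1, 3, 2], [2, 1, 3], [2, 3, 1], [3, 1, 2]}
     else if \<Delta> = [2, 1] then {[1, 1, 2], [2, 1, 1]}
     else if \<Delta> = [2, 1, 1] then
       {[1, 1, 2, 3], [1, 1, 3, 2], [2, 1, 1, 3], [2, 3, 1, 1], [3, 2, 1, 1]}
     else if \<Delta> = [2, 2] then {[1, 1, 2, 2], [2, 2, 1, 1]}
     else if \<Delta> = [3, 1] then {[1, 1, 2, 1]}
     else if \<Delta> = [2, 2, 1] then {[1, 1, 2, 2, 3], [2, 2, 1, 1, 3], [3, 1, 1, 2, 2]}
     else if \<Delta> = [3, 1, 1] then {[1, 1, 2, 3, 1], [1, 1, 3, 2, 1]}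
     else if \<Delta> = [3, 2] then {[1, 1, 2, 2, 1]}
     else {})"

text \<open>The library constant \<open>vectorspace.basis\<close> has its intended meaning only for
  vector spaces; this is justified here.\<close>

lemma fscale_conv: "fscale c f = Poly_Mapping.single 0 c * f"
  by (simp add: fscale_def mult_map_scale_conv_mult)

lemma lookup_fscale [simp]: "Poly_Mapping.lookup (fscale c f) w = c * Poly_Mapping.lookup f w"
  by (simp add: fscale_def Poly_Mapping.map.rep_eq when_def)

lemma keys_fscale: "Poly_Mapping.keys (fscale c f) \<subseteq> Poly_Mapping.keys f"
  by (auto simp: in_keys_iff)

lemma fscale_add: "fscale c (f + g) = fscale c f + fscale c g"
  by (simp add: fscale_conv distrib_left)

lemma fscale_add_left: "fscale (b + c) f = fscale b f + fscale c f"
  by (rule poly_mapping_eqI) (simp add: lookup_add distrib_right)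

lemma fscale_fscale: "fscale b (fscale c f) = fscale (b * c) f"
  by (rule poly_mapping_eqI) (simp add: mult.assoc)

lemma fscale_one: "fscale 1 f = f"
  by (rule poly_mapping_eqI) simp

lemma fscale_minus_one: "fscale (- 1) f = - f"
  by (rule poly_mapping_eqI) simp

lemma fscale_zero: "fscale c 0 = 0"
  by (rule poly_mapping_eqI) simp

lemma free_carrier_zero: "0 \<in> free_carrier d"
  by (simp add: free_carrier_def)

lemma free_carrier_add: "f \<in> free_carrier d \<Longrightarrow> g \<in> free_carrier d \<Longrightarrow> f + g \<in> free_carrier d"
  unfolding free_carrier_def using Poly_Mapping.keys_add[of f g] by blast

lemma free_carrier_scale: "f \<in> free_carrier d \<Longrightarrow> fscale c f \<in> free_carrier d"
  unfolding free_carrier_def using keys_fscale[of c f] by blast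

lemma free_carrier_uminus: "f \<in> free_carrier d \<Longrightarrow> - f \<in> free_carrier d"
  using free_carrier_scale[of f d "- 1"] by (simp add: fscale_minus_one)

lemma free_carrier_mult:
  assumes "f \<in> free_carrier d" "g \<in> free_carrier d"
  shows "f * g \<in> free_carrier d"
proof -
  have "letters w \<noteq> [] \<and> set (letters w) \<subseteq> {1..d}" if w: "w \<in> Poly_Mapping.keys (f * g)" for w
  proof -
    obtain u v where "w = u + v" "u \<in> Poly_Mapping.keys f" "v \<in> Poly_Mapping.keys g"
      using w keys_mult[of f g] by blast
    then show ?thesis
      using assms by (force simp: free_carrier_def plus_fword_def)
  qed
  then show ?thesis by (simp add: free_carrier_def)
qed

lemma alg_ideal_free_carrier: "alg_ideal d (free_carrier d)"
  by (simp add: alg_ideal_def free_carrier_zero free_carrier_add free_carrier_scale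
      free_carrier_mult)

lemma alg_ideal_Inter:
  assumes "\<And>I. I \<in> F \<Longrightarrow> alg_ideal d I" "F \<noteq> {}"
  shows "alg_ideal d (\<Inter>F)"
  using assms unfolding alg_ideal_def by blast

lemma alg_ideal_cube_ideal: "alg_ideal d (cube_ideal d :: 'k::field freealg set)"
proof -
  have "a ^ 3 \<in> free_carrier d" if "a \<in> free_carrier d" for a :: "'k freealg"
    using that by (simp add: power3_eq_cube free_carrier_mult)
  then have "(free_carrier d :: 'k freealg set) \<in> {I. alg_ideal d I \<and> (\<lambda>a. a ^ 3) ` free_carrier d \<subseteq> I}"
    using alg_ideal_free_carrier by (simp add: image_subset_iff)
  then show ?thesis
    unfolding cube_ideal_def hull_def by (intro alg_ideal_Inter) blast+
qed

lemma cube_ideal_subset: "cube_ideal d \<subseteq> free_carrier d"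
  and cube_ideal_zero: "0 \<in> cube_ideal d"
  and cube_ideal_add: "f \<in> cube_ideal d \<Longrightarrow> g \<in> cube_ideal d \<Longrightarrow> f + g \<in> cube_ideal d"
  and cube_ideal_scale: "f \<in> cube_ideal d \<Longrightarrow> fscale c f \<in> cube_ideal d"
  using alg_ideal_cube_ideal[of d] unfolding alg_ideal_def by blast+

lemma cube_ideal_uminus: "f \<in> cube_ideal d \<Longrightarrow> - f \<in> cube_ideal d"
  using cube_ideal_scale[of f d "- 1"] by (simp add: fscale_minus_one)

lemma free_alg_simps [simp]:
  "carrier (free_alg d) = free_carrier d" "add (free_alg d) = (+)" "zero (free_alg d) = 0"
  "mult (free_alg d) = (*)" "smult (free_alg d) = fscale"
  by (simp_all add: free_alg_def)

lemma coset_conv: "cube_ideal d +>\<^bsub>free_alg d\<^esub> f = (\<lambda>g. g + f) ` cube_ideal d"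
  by (auto simp: a_r_coset_def r_coset_def free_alg_def)

lemma mem_coset: "g \<in> cube_ideal d +>\<^bsub>free_alg d\<^esub> f \<longleftrightarrow> g - f \<in> cube_ideal d"
  unfolding coset_conv image_iff
  by (metis add_diff_cancel_right' diff_add_cancel)

lemma coset_self: "f \<in> cube_ideal d +>\<^bsub>free_alg d\<^esub> f"
  by (simp add: mem_coset cube_ideal_zero)

lemma coset_eq_iff:
  "cube_ideal d +>\<^bsub>free_alg d\<^esub> f = cube_ideal d +>\<^bsub>free_alg d\<^esub> g \<longleftrightarrow> f - g \<in> cube_ideal d"
proof
  assume "cube_ideal d +>\<^bsub>free_alg d\<^esub> f = cube_ideal d +>\<^bsub>free_alg d\<^esub> g"
  then have "f \<in> cube_ideal d +>\<^bsub>free_alg d\<^esub> g"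
    using coset_self[of f d] by simp
  then show "f - g \<in> cube_ideal d"
    by (simp add: mem_coset)
next
  assume fg: "f - g \<in> cube_ideal d"
  have "h - f \<in> cube_ideal d \<longleftrightarrow> h - g \<in> cube_ideal d" for h
  proof
    assume "h - f \<in> cube_ideal d"
    from cube_ideal_add[OF this fg] show "h - g \<in> cube_ideal d" by simp
  next
    assume "h - g \<in> cube_ideal d"
    from cube_ideal_add[OF this cube_ideal_uminus[OF fg]] show "h - f \<in> cube_ideal d" by simp
  qed
  then show "cube_ideal d +>\<^bsub>free_alg d\<^esub> f = cube_ideal d +>\<^bsub>free_alg d\<^esub> g"
    by (intro Set.set_eqI) (simp add: mem_coset)
qed

lemma coset_add:
  "add (N3 d) (cube_ideal d +>\<^bsub>free_alg d\<^esub> f) (cube_ideal d +>\<^bsub>free_alg d\<^esub> g) =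
     cube_ideal d +>\<^bsub>free_alg d\<^esub> (f + g)"
proof -
  have *: "add (N3 d) (cube_ideal d +>\<^bsub>free_alg d\<^esub> f) (cube_ideal d +>\<^bsub>free_alg d\<^esub> g) =
     {a + b | a b. a - f \<in> cube_ideal d \<and> b - g \<in> cube_ideal d}"
    unfolding mem_coset [symmetric]
    by (simp add: N3_def set_add_def set_mult_def) blast
  show ?thesis unfolding *
  proof (intro Set.set_eqI iffI)
    fix x assume "x \<in> {a + b | a b. a - f \<in> cube_ideal d \<and> b - g \<in> cube_ideal d}"
    then obtain a b where "x = a + b" "a - f \<in> cube_ideal d" "b - g \<in> cube_ideal d" by blast
    then show "x \<in> cube_ideal d +>\<^bsub>free_alg d\<^esub> (f + g)"
      using cube_ideal_add[of "a - f" d "b - g"] by (simp add: mem_coset add_diff_add)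
  next
    fix x assume "x \<in> cube_ideal d +>\<^bsub>free_alg d\<^esub> (f + g)"
    then have "(x - g) - f \<in> cube_ideal d" by (simp add: mem_coset algebra_simps)
    moreover have "g - g \<in> cube_ideal d" by (simp add: cube_ideal_zero)
    moreover have "x = (x - g) + g" by simp
    ultimately show "x \<in> {a + b | a b. a - f \<in> cube_ideal d \<and> b - g \<in> cube_ideal d}"
      by blast
  qed
qed

lemma coset_smult:
  "smult (N3 d) c (cube_ideal d +>\<^bsub>free_alg d\<^esub> f) = cube_ideal d +>\<^bsub>free_alg d\<^esub> fscale c f"
proof -
  have "cube_ideal d +>\<^bsub>free_alg d\<^esub> fscale c g = cube_ideal d +>\<^bsub>free_alg d\<^esub> fscale c f"
    if "g \<in> cube_ideal d +>\<^bsub>free_alg d\<^esub> f" for g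
  proof -
    have "fscale c g - fscale c f = fscale c (g - f)"
      by (rule poly_mapping_eqI) (simp add: lookup_minus algebra_simps)
    then show ?thesis
      using that cube_ideal_scale[of "g - f" d c] by (simp add: coset_eq_iff mem_coset)
  qed
  then have "(\<Union>g \<in> cube_ideal d +>\<^bsub>free_alg d\<^esub> f. cube_ideal d +>\<^bsub>free_alg d\<^esub> fscale c g) =
      cube_ideal d +>\<^bsub>free_alg d\<^esub> fscale c f"
    using coset_self[of f d] by (intro SUP_eq_const) blast+
  then show ?thesis by (simp add: N3_def)
qed

lemma zero_N3: "zero (N3 d) = cube_ideal d +>\<^bsub>free_alg d\<^esub> 0"
  by (simp add: N3_def coset_conv)

lemma carrier_N3: "carrier (N3 d) = (\<lambda>f. cube_ideal d +>\<^bsub>free_alg d\<^esub> f) ` free_carrier d"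
  by (auto simp: N3_def A_RCOSETS_def RCOSETS_def a_r_coset_def)

text \<open>Common argument for the whole quotient and its components: both are images of a
  subspace of the free algebra.\<close>

lemma vectorspace_coset_image:
  fixes S :: "'k::field freealg set"
  assumes zero: "0 \<in> S"
    and add: "\<And>f g. f \<in> S \<Longrightarrow> g \<in> S \<Longrightarrow> f + g \<in> S"
    and scale: "\<And>c f. f \<in> S \<Longrightarrow> fscale c f \<in> S"
  shows "vectorspace class_ring
    ((N3 d)\<lparr>carrier := (\<lambda>f. cube_ideal d +>\<^bsub>free_alg d\<^esub> f) ` S\<rparr>)" (is "vectorspace _ ?V")
proof -
  have field: "field (class_ring :: 'k ring)" by (rule class_field)
  have K: "cring (class_ring :: 'k ring)" by (rule domain.axioms(1)[OF field.axioms(1)[OF field]])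
  let ?c = "\<lambda>f. cube_ideal d +>\<^bsub>free_alg d\<^esub> f"
  have abel: "abelian_group ?V"
  proof (rule abelian_groupI)
    fix x assume "x \<in> carrier ?V"
    then obtain f where f: "f \<in> S" "x = ?c f" by auto
    then have "- f \<in> S" using scale[of f "- 1"] by (simp add: fscale_minus_one)
    then have "?c (- f) \<in> carrier ?V" by simp
    moreover have "?c (- f) \<oplus>\<^bsub>?V\<^esub> x = \<zero>\<^bsub>?V\<^esub>"
      by (simp add: f coset_add zero_N3)
    ultimately show "\<exists>y \<in> carrier ?V. y \<oplus>\<^bsub>?V\<^esub> x = \<zero>\<^bsub>?V\<^esub>" by blast
  next
    fix x y z assume "x \<in> carrier ?V" "y \<in> carrier ?V" "z \<in> carrier ?V"
    then obtain f g h where "x = ?c f" "y = ?c g" "z = ?c h" by auto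
    then show "x \<oplus>\<^bsub>?V\<^esub> y \<oplus>\<^bsub>?V\<^esub> z = x \<oplus>\<^bsub>?V\<^esub> (y \<oplus>\<^bsub>?V\<^esub> z)"
      by (simp add: coset_add add.assoc)
  next
    fix x y assume "x \<in> carrier ?V" "y \<in> carrier ?V"
    then obtain f g where "x = ?c f" "y = ?c g" by auto
    then show "x \<oplus>\<^bsub>?V\<^esub> y = y \<oplus>\<^bsub>?V\<^esub> x"
      by (simp add: coset_add add.commute)
  qed (auto simp: coset_add zero_N3 zero add)
  have mod_ax: "module_axioms class_ring ?V"
  proof
    fix a b :: 'k and x y
    assume "x \<in> carrier ?V"
    then obtain f where f: "f \<in> S" "x = ?c f" by auto
    show "a \<odot>\<^bsub>?V\<^esub> x \<in> carrier ?V"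
      using f scale[of f a] by (simp add: coset_smult)
    show "(a \<oplus>\<^bsub>class_ring\<^esub> b) \<odot>\<^bsub>?V\<^esub> x = a \<odot>\<^bsub>?V\<^esub> x \<oplus>\<^bsub>?V\<^esub> b \<odot>\<^bsub>?V\<^esub> x"
      by (simp add: f coset_smult coset_add fscale_add_left)
    show "(a \<otimes>\<^bsub>class_ring\<^esub> b) \<odot>\<^bsub>?V\<^esub> x = a \<odot>\<^bsub>?V\<^esub> (b \<odot>\<^bsub>?V\<^esub> x)"
      by (simp add: f coset_smult fscale_fscale)
    show "\<one>\<^bsub>class_ring\<^esub> \<odot>\<^bsub>?V\<^esub> x = x"
      by (simp add: f coset_smult fscale_one)
    assume "y \<in> carrier ?V"
    then obtain g where "y = ?c g" by auto
    then show "a \<odot>\<^bsub>?V\<^esub> (x \<oplus>\<^bsub>?V\<^esub> y) = a \<odot>\<^bsub>?V\<^esub> x \<oplus>\<^bsub>?V\<^esub> a \<odot>\<^bsub>?V\<^esub> y"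
      by (simp add: f coset_smult coset_add fscale_add)
  qed
  have "module class_ring ?V"
    by (intro Module.module.intro K abel mod_ax)
  with field show ?thesis by (simp add: vectorspace_def)
qed

lemma vectorspace_N3: "vectorspace class_ring (N3 d :: ('k::field, 'k freealg set) module)"
proof -
  have *: "(N3 d :: ('k, 'k freealg set) module)\<lparr>carrier := (\<lambda>f. cube_ideal d +>\<^bsub>free_alg d\<^esub> f) ` free_carrier d\<rparr> = N3 d"
    by (simp flip: carrier_N3)
  show ?thesis
    by (subst * [symmetric], rule vectorspace_coset_image)
      (simp_all add: free_carrier_zero free_carrier_add free_carrier_scale)
qed

lemma vectorspace_N3_comp: "vectorspace class_ring (N3_comp d \<Delta>)"
  unfolding N3_comp_def
proof (rule vectorspace_coset_image)
  fix f g :: "'a freealg" and c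
  let ?S = "{f \<in> free_carrier d. \<forall>w \<in> Poly_Mapping.keys f. multidegree d w = \<Delta>}"
  show "0 \<in> ?S" by (simp add: free_carrier_zero)
  show "f + g \<in> ?S" if "f \<in> ?S" "g \<in> ?S"
    using that Poly_Mapping.keys_add[of f g] by (auto simp: free_carrier_add)
  show "fscale c f \<in> ?S" if "f \<in> ?S"
    using that keys_fscale[of c f] by (auto simp: free_carrier_scale)
qed

end

theory Submission
  imports Defs
begin

text \<open>A component of the quotient is studied through its dual, the functions on words of the given
  content that vanish on cubes of words and on the two polarisations of the cube
  (\<open>nil_functional\<close>). Over an infinite field these relations generate the ideal of cubes, so a
  set of words is a basis exactly if a functional that vanishes on it is zero and each of its
  words is separated from the others by a functional (\<open>quotient_duality\<close>, \<open>basis_criterion\<close>).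

  Spanning rests on one commutation argument. Suppose that a functional vanishes on the words that
  start with a block \<open>x\<close>. In characteristic two the symmetric relation then makes the letters to
  the right of \<open>x\<close> commute as soon as there are four further letters (\<open>com_with_tail_zero\<close>,
  \<open>dot_perm\<close>), and the value on \<open>a @ x @ b\<close> becomes a sum of a function of the first and a
  function of the last letter of \<open>a\<close>, up to a constant for empty \<open>b\<close> (\<open>endpoint_form\<close>). For
  multilinear words this is used with the first letter as \<open>x\<close>, and the recursively defined basis
  kills exactly the remaining freedom (\<open>span_B_lin\<close>). For words with a square it is used with the
  square as \<open>x\<close>: the value on \<open>p @ y @ y @ q\<close> is a function of the last letter of \<open>p\<close> plus a function
  of the first letter of \<open>q\<close> (\<open>neighbour_form\<close>). Further repeated letters force relations between
  these functions, until nothing is left.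

  Independence rests on counting adjacent letters modulo two. Each word is closed up to a cycle by a
  border letter \<open>0\<close>; for arbitrary weights on ordered pairs of letters the total weight of the pairs
  along the cycle satisfies the symmetric relation, and it satisfies the relations with a square
  whenever words from which two equal blocks have been deleted have weight zero (\<open>nil_edge\<close>).
  These weights separate the listed words apart from a few of small degree, for which three further
  functionals are given and verified by enumeration.\<close>

section \<open>Cube relations on words in characteristic two\<close>

text \<open>Bubble sort: invariance under swapping neighbours is invariance under all permutations.\<close>

lemma adjacent_swaps:
  assumes swap: "\<And>u b c w. mset (u @ b # c # w) = N \<Longrightarrow> g (u @ b # c # w) = g (u @ c # b # w)"
    and N: "mset w = N" "mset w' = N"
  shows "g w = g w'"
proof -
  have front: "g (u @ y @ x # r) = g (u @ x # y @ r)" if "mset (u @ y @ x # r) = N" for u y x r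
    using that
  proof (induction y arbitrary: r rule: rev_induct)
    case (snoc c y)
    have "g (u @ y @ x # c # r) = g (u @ x # y @ c # r)"
      using snoc.prems by (intro snoc.IH) (simp add: add_mset_commute)
    then show ?case
      using swap[of "u @ y" c x r] snoc.prems by simp
  qed simp
  have "g (u @ w) = g (u @ w')" if "mset (u @ w) = N" "mset w = mset w'" for u w w'
    using that
  proof (induction w arbitrary: u w')
    case (Cons x w)
    then have "x \<in> set w'" by (metis list.set_intros(1) set_mset_mset)
    then obtain y r where w': "w' = y @ x # r" by (metis split_list)
    have "mset w = mset (y @ r)" using Cons.prems(2) w' by simp
    then have "g ((u @ [x]) @ w) = g ((u @ [x]) @ y @ r)"
      using Cons.prems(1) by (intro Cons.IH) simp_all
    also have "\<dots> = g (u @ w')"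
      using front[of u y x r] Cons.prems w' by simp
    finally show ?case by simp
  qed simp
  from this[of "[]" w w'] N show ?thesis by simp
qed

text \<open>The dual picture: a linear functional on the free algebra is a function on words, and it kills
  the ideal of cubes as soon as it kills the cube of a word and both polarisations of the cube,
  in every context \<open>u _ v\<close>. The fully symmetric relation is split off because the sum over
  adjacent letters satisfies it alone.\<close>

locale S3_functional =
  fixes lam :: "nat list \<Rightarrow> 'k::field"
  assumes S3: "\<And>u a b c v. a \<noteq> [] \<Longrightarrow> b \<noteq> [] \<Longrightarrow> c \<noteq> [] \<Longrightarrow>
    lam (u @ a @ b @ c @ v) + lam (u @ a @ c @ b @ v) + lam (u @ b @ a @ c @ v) +
    lam (u @ b @ c @ a @ v) + lam (u @ c @ a @ b @ v) + lam (u @ c @ b @ a @ v) = 0"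

locale nil_functional = S3_functional +
  assumes cube: "\<And>u a v. a \<noteq> [] \<Longrightarrow> lam (u @ a @ a @ a @ v) = 0"
    and quad: "\<And>u a b v. a \<noteq> [] \<Longrightarrow> b \<noteq> [] \<Longrightarrow>
      lam (u @ a @ a @ b @ v) + lam (u @ a @ b @ a @ v) + lam (u @ b @ a @ a @ v) = 0"

locale char2 =
  fixes K :: "'k::field itself"
  assumes two: "(1::'k) + 1 = 0"
begin

lemma add_self: "(x::'k) + x = 0"
  by (metis distrib_left mult.right_neutral mult_zero_right two)

lemma add_self_left: "(x::'k) + (x + y) = y"
  by (simp add: add_self flip: add.assoc)

lemmas xor = add.assoc add.commute add.left_commute add_self add_self_left add_0_left add_0_right
  append_assoc append_Nil append_Nil2 append_Cons

lemma sum_by_eq: "(x::'k) = y \<Longrightarrow> x + y = 0"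
  by (simp add: add_self)

lemma eq_by_sum: "x + y = 0 \<Longrightarrow> (x::'k) = y"
  by (metis add.right_neutral add_self_left)

end

locale S3_char2 = S3_functional lam + char2 "TYPE('k)" for lam :: "nat list \<Rightarrow> 'k::field"

locale nil_char2 = nil_functional lam + S3_char2 lam for lam :: "nat list \<Rightarrow> 'k::field"

lemma add_zeros: "(x::'k::monoid_add) = 0 \<Longrightarrow> y = 0 \<Longrightarrow> x + y = 0"
  by simp

text \<open>The pattern of the linear arguments in characteristic two: add up instances of the relations
  and let associativity, commutativity and \<open>x + x = 0\<close> cancel what occurs twice.\<close>

lemma zero_by: "S = 0 \<Longrightarrow> L = S \<Longrightarrow> L = (0::'k::monoid_add)"
  by simp

text \<open>If \<open>lam\<close> vanishes on every word that starts with \<open>x\<close>, the symmetric relation for \<open>x\<close> and two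
  further blocks turns into an identity between words in which \<open>x\<close> sits in the interior.\<close>

locale fronted = S3_char2 lam for lam :: "nat list \<Rightarrow> 'k::field" +
  fixes x :: "nat list"
  assumes x: "x \<noteq> []" and front: "lam (x @ w) = 0"
begin

text \<open>\<open>dot\<close> treats \<open>x\<close> as a separator between a left and a right part; \<open>com\<close> measures how far the
  right part is from being commutative.\<close>

definition dot :: "nat list \<Rightarrow> nat list \<Rightarrow> 'k" where
  "dot a b = lam (a @ x @ b)"

definition com :: "nat list \<Rightarrow> nat list \<Rightarrow> nat list \<Rightarrow> nat list \<Rightarrow> 'k" where
  "com a b c v = dot a (b @ c @ v) + dot a (c @ b @ v)"

lemma dot_left:
  assumes "a \<noteq> []" "b \<noteq> []"
  shows "dot a (b @ v) + dot b (a @ v) + dot (a @ b) v + dot (b @ a) v = 0"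
  using S3[OF x assms, of "[]" v] by (simp add: dot_def front xor)

lemma dot_inner:
  assumes "u @ p \<noteq> []" "b \<noteq> []" "c \<noteq> []"
  shows "dot (u @ p) (q @ b @ c @ v) + dot (u @ p) (q @ c @ b @ v) + dot (u @ b @ p) (q @ c @ v)
    + dot (u @ c @ p) (q @ b @ v) + dot (u @ b @ c @ p) (q @ v) + dot (u @ c @ b @ p) (q @ v) = 0"
  using S3[of "p @ x @ q" b c u v] assms x by (simp add: dot_def xor)

lemma dot_S3_left:
  assumes "a \<noteq> []" "b \<noteq> []" "c \<noteq> []"
  shows "dot (u @ a @ b @ c @ w) v + dot (u @ a @ c @ b @ w) v + dot (u @ b @ a @ c @ w) v
    + dot (u @ b @ c @ a @ w) v + dot (u @ c @ a @ b @ w) v + dot (u @ c @ b @ a @ w) v = 0"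
  using S3[OF assms, of u "w @ x @ v"] by (simp add: dot_def)

lemma dot_S3_right:
  assumes "a \<noteq> []" "b \<noteq> []" "c \<noteq> []"
  shows "dot w (u @ a @ b @ c @ v) + dot w (u @ a @ c @ b @ v) + dot w (u @ b @ a @ c @ v)
    + dot w (u @ b @ c @ a @ v) + dot w (u @ c @ a @ b @ v) + dot w (u @ c @ b @ a @ v) = 0"
  using S3[OF assms, of "w @ x @ u" "v"] by (simp add: dot_def)

lemma com_swap_right: "com a b c v = com a c b v"
  by (simp add: com_def xor)

text \<open>Moving \<open>x\<close> to the front kills its terms, so the defect of commutativity is symmetric in all
  three blocks.\<close>

lemma com_swap_left:
  assumes "a \<noteq> []" "b \<noteq> []" "c \<noteq> []"
  shows "com a b c v = com b a c v"
proof -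
  have ne: "c @ [] \<noteq> []" "a @ c \<noteq> []" "b @ c \<noteq> []" using assms by auto
  note r1 = dot_inner[OF ne(1) assms(1,2), of "[]" v]
  note r2 = dot_left[OF assms(3,1), of "b @ v"]
  note r3 = dot_left[OF assms(3,2), of "a @ v"]
  note r4 = dot_left[OF ne(2) assms(2), of v]
  note r5 = dot_left[OF ne(3) assms(1), of v]
  note r6 = dot_S3_left[OF assms, of "[]" "[]" v]
  note r = r1[THEN add_zeros, OF r2, THEN add_zeros, OF r3, THEN add_zeros, OF r4,
      THEN add_zeros, OF r5, THEN add_zeros, OF r6]
  have "com a b c v + com b a c v = 0"
    using r by (simp add: com_def xor)
  then show ?thesis by (rule eq_by_sum)
qed

lemma com_split:
  assumes "a \<noteq> []" "b \<noteq> []" "c \<noteq> []" "e \<noteq> []"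
  shows "dot c (a @ b @ e @ v) + dot c (a @ e @ b @ v) = com (a @ b) c e v + com a c e (b @ v)"
  proof -
  have "a @ b \<noteq> []" using assms by auto
  show ?thesis
    by (simp only: com_swap_left[OF \<open>a @ b \<noteq> []\<close> assms(3,4)] com_swap_left[OF assms(1,3,4)])
      (simp only: com_def xor)
qed

lemma com_sum:
  assumes "a \<noteq> []" "b \<noteq> []" "c \<noteq> []" "e \<noteq> []"
  shows "com (a @ b) c e v + com (b @ a) c e v + com (e @ b) c a v + com b c e (a @ v) = 0"
proof -
  have "com (a @ b) c e v + com a c e (b @ v) + (com (b @ a) c e v + com b c e (a @ v))
      + (com (e @ b) c a v + com e c a (b @ v)) = 0"
    unfolding com_split[OF assms, symmetric] com_split[OF assms(2,1,3,4), symmetric]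
      com_split[OF assms(4,2,3,1), symmetric]
    by (rule zero_by[OF dot_S3_right[OF assms(1,2,4), of c "[]" v]]) (simp only: xor)
  moreover have "com e c a (b @ v) = com a c e (b @ v)"
    using assms com_swap_left com_swap_right by metis
  ultimately show ?thesis by (simp only: xor)
qed

text \<open>Together with the symmetries, the sum identity shows that a block on the left can be traded
  for one on the right.\<close>

lemma com_head_irrelevant:
  assumes "a \<noteq> []" "b \<noteq> []" "c \<noteq> []" "e \<noteq> []"
  shows "com (e @ b) c a v = com (c @ b) e a v"
proof -
  note r = com_sum[OF assms, of v, THEN add_zeros, OF com_sum[OF assms(1,2,4,3), of v]]
  show ?thesis
    by (rule eq_by_sum, rule zero_by[OF r]) (simp only: xor com_swap_right[of _ e c])
qed

lemma com_pair_tail: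
  assumes "a \<noteq> []" "b \<noteq> []" "c \<noteq> []" "e \<noteq> []"
  shows "com (b @ a) c e v = com b c e (a @ v)"
proof -
  have "com (e @ b) c a v = com (a @ b) c e v"
    using com_head_irrelevant[OF assms(3,2,1,4), of v] com_swap_right by metis
  with com_sum[OF assms, of v] have "com (b @ a) c e v + com b c e (a @ v) = 0"
    by (simp add: xor)
  then show ?thesis by (rule eq_by_sum)
qed

lemma dot_swap_later:
  assumes "a \<noteq> []" "b \<noteq> []" "c \<noteq> []" "e \<noteq> []"
  shows "dot c (a @ b @ e @ v) = dot c (a @ e @ b @ v)"
  by (rule eq_by_sum) (simp add: com_split assms com_pair_tail[OF assms(2,1,3,4)] add_self)

lemma com_tail_swap:
  assumes "a \<noteq> []" "b \<noteq> []" "c \<noteq> []" "e \<noteq> []"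
  shows "com a c e (b @ v) = com b c e (a @ v)"
proof -
  note r = dot_left[OF assms(1,2), of "c @ e @ v", THEN add_zeros,
      OF dot_left[OF assms(1,2), of "e @ c @ v"]]
  have "com (a @ b) c e v + com (b @ a) c e v = 0"
    by (rule zero_by[OF r])
      (simp only: com_def xor dot_swap_later[OF assms(2,3,1,4)] dot_swap_later[OF assms(1,3,2,4)])
  then show ?thesis
    using com_pair_tail[OF assms(2,1,3,4), of v] com_pair_tail[OF assms(1,2,3,4), of v]
    by (metis eq_by_sum)
qed

text \<open>With a further block on the right, the defect can be computed in two ways that differ by a
  permutation of the blocks; in characteristic two the two evaluations add up to zero.\<close>

lemma com_with_tail_zero:
  assumes "a \<noteq> []" "b \<noteq> []" "c \<noteq> []" "e \<noteq> []"
  shows "com a b c (e @ v) = 0"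
proof -
  have ne: "e @ c \<noteq> []" using assms by simp
  have "com a b (e @ c) v = com (e @ c) a b v"
    using com_swap_left[OF assms(1) ne assms(2)] com_swap_right by metis
  also have "\<dots> = com e a b (c @ v)"
    by (rule com_pair_tail[OF assms(3,4,1,2)])
  also have "\<dots> = com c a b (e @ v)"
    by (rule com_tail_swap[OF assms(4,3,1,2)])
  finally have 1: "com a b (e @ c) v = com c a b (e @ v)" .
  have 2: "com a e c (b @ v) = com b a c (e @ v)"
    using com_tail_swap[OF assms(4,2,1,3), of v] com_swap_left[OF assms(1,4,3)] by metis
  have 3: "com c a b (e @ v) = com b a c (e @ v)"
    using com_swap_left[OF assms(3,2,1), of "e @ v"] com_swap_right by metis
  have "com a b c (e @ v) = com a b (e @ c) v + com a e c (b @ v)"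
    by (simp only: com_def xor dot_swap_later[OF assms(2,3,1,4)]
         dot_swap_later[OF assms(3,2,1,4)])
  then show ?thesis
    by (simp add: 1 2 3 add_self)
qed

lemma com_long_zero:
  assumes "a \<noteq> []" "b \<noteq> []" "c \<noteq> []" "e \<noteq> []"
  shows "com (a @ e) b c v = 0"
  using com_pair_tail[OF assms(4,1,2,3)] com_with_tail_zero[OF assms] by simp

text \<open>The previous vanishing results cover every position of the swapped pair, provided there is at
  least one letter to spare.\<close>

lemma dot_swap:
  assumes "a \<noteq> []" "b \<noteq> []" "c \<noteq> []" and long: "2 \<le> length (a @ u @ v)"
  shows "dot a (u @ b @ c @ v) = dot a (u @ c @ b @ v)"
proof (cases "u = []")
  case False
  then show ?thesis by (rule dot_swap_later[OF _ assms(2,1,3)])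
next
  case u: True
  have "com a b c v = 0"
  proof (cases v)
    case (Cons i v')
    then show ?thesis using com_with_tail_zero[OF assms(1-3), of "[i]" v'] by simp
  next
    case Nil
    with u long obtain i j a' where "a = i # j # a'"
      by (cases a; cases "tl a") auto
    then show ?thesis using com_long_zero[of "[i]" b c "j # a'" v] assms by simp
  qed
  then show ?thesis using u by (simp add: com_def eq_by_sum)
qed

end

lemma submset_tail: "add_mset x A \<subseteq># M \<Longrightarrow> A \<subseteq># M"
  by (rule subset_mset.order_trans[of _ "add_mset x A"]) simp_all

lemma submset_insert: "A \<subseteq># M \<Longrightarrow> x \<in># M - A \<Longrightarrow> add_mset x A \<subseteq># M"
  by (auto simp: subseteq_mset_def in_diff_count Suc_le_eq)

text \<open>What remains of the relations once the right part is known to be commutative: the value depends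
  on the left part \<open>a\<close> alone, as the rest is its complement in \<open>M\<close>. Both axioms say that \<open>f\<close> behaves
  like a sum of contributions of the first and of the last letter.\<close>

locale split_functional = char2 "TYPE('k)" for f :: "nat list \<Rightarrow> 'k::field" +
  fixes M :: "nat multiset"
  assumes rotate: "a \<noteq> [] \<Longrightarrow> b \<noteq> [] \<Longrightarrow> mset (a @ b) \<subseteq># M \<Longrightarrow> f (a @ b) + f (b @ a) = f a + f b"
    and swap: "u @ p \<noteq> [] \<Longrightarrow> b \<noteq> [] \<Longrightarrow> c \<noteq> [] \<Longrightarrow> mset (u @ b @ c @ p) \<subseteq># M \<Longrightarrow>
      f (u @ b @ c @ p) + f (u @ c @ b @ p) = f (u @ b @ p) + f (u @ c @ p)"
begin

lemma triangle:
  assumes "{#i, j, k#} \<subseteq># M"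
  shows "f [i, j] + f [j, k] + f [k, i] = f [i] + f [j] + f [k]"
proof -
  have sub: "{#i, j#} \<subseteq># M" "{#j, k#} \<subseteq># M" "{#k, i#} \<subseteq># M"
    using assms by (auto intro: subset_mset.order_trans[rotated] simp: add_mset_commute)
  have 1: "f [i, j, k] + f [j, k, i] = f [i] + f [j, k]"
    using rotate[of "[i]" "[j, k]"] assms by (simp add: add_mset_commute)
  have 2: "f [j, k, i] + f [k, i, j] = f [j] + f [k, i]"
    using rotate[of "[j]" "[k, i]"] assms by (simp add: add_mset_commute)
  have 3: "f [k, i, j] + f [i, j, k] = f [k] + f [i, j]"
    using rotate[of "[k]" "[i, j]"] assms by (simp add: add_mset_commute)
  have "f [i] + f [j, k] + (f [j] + f [k, i]) + (f [k] + f [i, j]) = 0"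
    unfolding 1[symmetric] 2[symmetric] 3[symmetric] by (simp only: xor)
  from zero_by[OF this] show ?thesis
    by (rule eq_by_sum) (simp only: xor)
qed

context
  fixes z :: nat
  assumes z: "z \<in># M" and big: "3 \<le> size M"
begin

text \<open>Potentials read off from words of length one and two that begin with a base letter \<open>z\<close>; the
  remainder \<open>kappa\<close> satisfies the same relations and has to be shown to vanish.\<close>

definition P :: "nat \<Rightarrow> 'k" where
  "P k = (if k = z then f [z] else f [z, k])"

definition F :: "nat \<Rightarrow> 'k" where
  "F j = f [j] + P j"

definition kappa :: "nat list \<Rightarrow> 'k" where
  "kappa w = f w + F (hd w) + P (last w)"

lemma kappa_single: "kappa [j] = 0"
  by (simp add: kappa_def F_def xor)

lemma kappa_swap:
  assumes "u @ p \<noteq> []" "b \<noteq> []" "c \<noteq> []" "mset (u @ b @ c @ p) \<subseteq># M"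
  shows "kappa (u @ b @ c @ p) + kappa (u @ c @ b @ p) = kappa (u @ b @ p) + kappa (u @ c @ p)"
proof -
  have "kappa (u @ b @ c @ p) + kappa (u @ c @ b @ p) = (f (u @ b @ c @ p) + f (u @ c @ b @ p))
      + (F (hd (u @ b @ c @ p)) + P (last (u @ b @ c @ p)) + F (hd (u @ c @ b @ p)) + P (last (u @ c @ b @ p)))"
    by (simp add: kappa_def add.assoc add.commute add.left_commute)
  also have "\<dots> = kappa (u @ b @ p) + kappa (u @ c @ p)"
    unfolding swap[OF assms] using assms(1-3)
    by (cases "u = []"; cases "p = []") (simp_all add: kappa_def xor)
  finally show ?thesis .
qed

lemma kappa_pair:
  assumes sub: "{#i, j#} \<subseteq># M"
  shows "kappa [i, j] = 0"
proof -
  consider "i = z" "j = z" | "i = z" "j \<noteq> z" | "i \<noteq> z" "j = z" | "i \<noteq> z" "j \<noteq> z"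
    by blast
  then show ?thesis
  proof cases
    case 1
    have "size {#z, z#} < size M" using big by simp
    then have "M - {#z, z#} \<noteq> {#}"
      using sub 1 by (metis Diff_eq_empty_iff_mset leD size_mset_mono)
    then obtain t where "t \<in># M - {#z, z#}" by blast
    then have t: "{#t, z, z#} \<subseteq># M"
      using submset_insert[of "{#z, z#}" M t] sub 1 by simp
    then have "{#z, t#} \<subseteq># M"
      using submset_tail[of z "{#z, t#}"] by (simp add: add_mset_commute)
    then have rot: "f [z, t] + f [t, z] = f [z] + f [t]"
      using rotate[of "[z]" "[t]"] by simp
    have tri: "f [z, z] + f [z, t] + f [t, z] = f [z] + f [z] + f [t]"
      using t by (intro triangle) (simp add: add_mset_commute)
    have "f [z, z] = (f [z, z] + f [z, t] + f [t, z]) + (f [z, t] + f [t, z])"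
      by (simp only: xor)
    also have "\<dots> = f [z]" unfolding tri rot by (simp only: xor)
    finally have "f [z, z] = f [z]" .
    then show ?thesis using 1 by (simp add: kappa_def F_def P_def add_self)
  next
    case 2
    then show ?thesis by (simp add: kappa_def F_def P_def xor)
  next
    case 3
    then have "f [i, z] + f [z, i] = f [i] + f [z]"
      using rotate[of "[i]" "[z]"] sub by simp
    note r = sum_by_eq[OF this]
    have "kappa [i, j] = f [i, z] + (f [i] + f [z, i]) + f [z]"
      using 3 by (simp add: kappa_def F_def P_def)
    also have "\<dots> = 0"
      by (rule zero_by[OF r]) (simp only: xor)
    finally show ?thesis .
  next
    case 4
    have t: "{#z, i, j#} \<subseteq># M"
      using sub z 4 by (auto simp: subseteq_mset_def split: if_splits)
    then have "{#z, j#} \<subseteq># M"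
      using submset_tail[of i "{#z, j#}"] by (simp add: add_mset_commute)
    then have "f [z, j] + f [j, z] = f [z] + f [j]"
      using rotate[of "[z]" "[j]"] by simp
    note r = add_zeros[OF sum_by_eq[OF this] sum_by_eq[OF triangle[OF t]]]
    have "kappa [i, j] = f [i, j] + (f [i] + f [z, i]) + f [z, j]"
      using 4 by (simp add: kappa_def F_def P_def)
    also have "\<dots> = 0"
      by (rule zero_by[OF r]) (simp only: xor)
    finally show ?thesis .
  qed
qed

lemma kappa_perm:
  assumes zero: "\<And>w. Suc (length w) = n \<Longrightarrow> mset w \<subseteq># M \<Longrightarrow> kappa w = 0"
    and n: "3 \<le> n" and w: "length w = n" "mset w \<subseteq># M" "mset w = mset w'"
  shows "kappa w = kappa w'"
proof (rule adjacent_swaps[where N = "mset w"])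
  fix u b c p assume N: "mset (u @ b # c # p) = mset w"
  then have len: "length (u @ b # c # p) = n" using w(1) mset_eq_length by blast
  have "u @ p \<noteq> []" using len n by auto
  moreover have "mset (u @ [b] @ [c] @ p) \<subseteq># M" using N w(2) by simp
  ultimately have sum: "kappa (u @ [b] @ [c] @ p) + kappa (u @ [c] @ [b] @ p) = kappa (u @ [b] @ p) + kappa (u @ [c] @ p)"
    by (intro kappa_swap) simp_all
  have eq: "add_mset c (mset (u @ [b] @ p)) = mset w" "add_mset b (mset (u @ [c] @ p)) = mset w"
    using N by (simp_all add: add_mset_commute)
  have sub: "mset (u @ [b] @ p) \<subseteq># M" "mset (u @ [c] @ p) \<subseteq># M"
    using submset_tail[of c "mset (u @ [b] @ p)" M] submset_tail[of b "mset (u @ [c] @ p)" M] w(2)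
    unfolding eq by blast+
  have "kappa (u @ [b] @ p) = 0" "kappa (u @ [c] @ p) = 0"
    using zero[OF _ sub(1)] zero[OF _ sub(2)] len by auto
  then have "kappa (u @ [b] @ [c] @ p) + kappa (u @ [c] @ [b] @ p) = 0"
    unfolding sum by (simp only: add_0_left)
  then show "kappa (u @ b # c # p) = kappa (u @ c # b # p)"
    unfolding append_Cons append_Nil by (rule eq_by_sum)
qed (simp_all only: w(3))

lemma kappa_triple:
  assumes "p \<noteq> []" "mset (b # c # e # p) \<subseteq># M" "kappa (b # p) = 0"
  shows "kappa (c # e # p) = kappa (b # e # p) + kappa (c # b # p)"
proof -
  have 1: "kappa (b # c # e # p) + kappa (c # e # b # p) = kappa (b # p) + kappa (c # e # p)"
    using kappa_swap[of "[]" p "[b]" "[c, e]"] assms by simp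
  have 2: "kappa (b # c # e # p) + kappa (c # b # e # p) = kappa (b # e # p) + kappa (c # e # p)"
    using kappa_swap[of "[]" "e # p" "[b]" "[c]"] assms by simp
  have 3: "kappa (c # b # e # p) + kappa (c # e # b # p) = kappa (c # b # p) + kappa (c # e # p)"
    using kappa_swap[of "[c]" p "[b]" "[e]"] assms by (simp add: add_mset_commute)
  have r: "(kappa (b # p) + kappa (c # e # p)) + (kappa (b # e # p) + kappa (c # e # p))
      + (kappa (c # b # p) + kappa (c # e # p)) = 0"
    unfolding 1[symmetric] 2[symmetric] 3[symmetric] by (simp only: xor)
  show ?thesis
    by (rule eq_by_sum, rule zero_by[OF r]) (simp only: assms(3) xor)
qed

text \<open>Induction on the length. A word shorter than \<open>M\<close> leaves a spare letter; the relations for the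
  four possible omissions of one of four letters form a linear system over the field with two
  elements whose only solution is zero.\<close>

lemma kappa_short:
  assumes "w \<noteq> []" "mset w \<subseteq># M" "length w < size M"
  shows "kappa w = 0"
  using assms
proof (induction "length w" arbitrary: w rule: less_induct)
  case less
  consider i where "w = [i]" | i j where "w = [i, j]" | i j k r where "w = i # j # k # r"
    using less.prems(1) by (metis list.exhaust)
  then show ?case
  proof cases
    case 1
    then show ?thesis by (simp add: kappa_single)
  next
    case 2
    then show ?thesis using less.prems(2) by (simp add: kappa_pair)
  next
    case (3 x1 x2 x3 r)
    have "M - mset w \<noteq> {#}"
      using less.prems(2,3) by (metis Diff_eq_empty_iff_mset leD size_mset size_mset_mono)
    then obtain x4 where "x4 \<in># M - mset w" by blast
    then have "add_mset x4 (mset w) \<subseteq># M"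
      using less.prems(2) by (intro submset_insert)
    then have sub: "mset (x1 # x2 # x3 # x4 # r) \<subseteq># M"
      using 3 by (simp add: add_mset_commute)
    have zero: "kappa u = 0" if "Suc (length u) = length w" "mset u \<subseteq># M" for u
    proof (rule less.hyps)
      show "u \<noteq> []" using that 3 by auto
    qed (use that less.prems in auto)
    have perm: "kappa u = kappa u'" if "mset u = mset u'" "mset u \<subseteq># M" "length u = length w" for u u'
      using kappa_perm[of "length w" u u'] zero that 3 by simp
    have sub': "mset (y # u) \<subseteq># M \<Longrightarrow> mset u \<subseteq># M" for y u
      using submset_tail by simp
    have triple: "kappa (c # e # p) = kappa (b # e # p) + kappa (c # b # p)"
      if "mset (b # c # e # p) = mset (x1 # x2 # x3 # x4 # r)" "p \<noteq> []" for b c e p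
    proof (rule kappa_triple)
      show M: "mset (b # c # e # p) \<subseteq># M" using that sub by metis
      have "length (b # c # e # p) = length (x1 # x2 # x3 # x4 # r)"
        using that(1) mset_eq_length by blast
      moreover have "mset (b # p) \<subseteq># M"
        using M sub'[of c "e # b # p"] sub'[of e "b # p"] by (simp add: add_mset_commute)
      ultimately show "kappa (b # p) = 0"
        using 3 by (intro zero) simp_all
    qed (use that in simp)
    define A where "A = kappa (x1 # x2 # x3 # r)"
    define B where "B = kappa (x1 # x2 # x4 # r)"
    define C where "C = kappa (x1 # x3 # x4 # r)"
    define D where "D = kappa (x2 # x3 # x4 # r)"
    have subs: "mset (x1 # x2 # x3 # r) \<subseteq># M" "mset (x1 # x2 # x4 # r) \<subseteq># M"
      "mset (x1 # x3 # x4 # r) \<subseteq># M" "mset (x2 # x3 # x4 # r) \<subseteq># M"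
      using sub' [of x4 "x1 # x2 # x3 # r"] sub' [of x3 "x1 # x2 # x4 # r"] sub' [of x2 "x1 # x3 # x4 # r"]
        sub' [of x1 "x2 # x3 # x4 # r"] sub by (simp_all add: add_mset_commute)
    have "kappa (x2 # x3 # x4 # r) = kappa (x1 # x3 # x4 # r) + kappa (x2 # x1 # x4 # r)"
      by (rule triple) simp_all
    also have "kappa (x2 # x1 # x4 # r) = B"
      unfolding B_def using subs(2) 3 by (intro perm) (simp_all add: add_mset_commute)
    finally have 1: "D = C + B" by (simp add: C_def D_def)
    have "kappa (x2 # x4 # x3 # r) = kappa (x1 # x4 # x3 # r) + kappa (x2 # x1 # x3 # r)"
      by (rule triple) simp_all
    also have "kappa (x2 # x4 # x3 # r) = D"
      unfolding D_def using subs(4) 3 by (intro perm) (simp_all add: add_mset_commute)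
    also have "kappa (x1 # x4 # x3 # r) = C"
      unfolding C_def using subs(3) 3 by (intro perm) (simp_all add: add_mset_commute)
    also have "kappa (x2 # x1 # x3 # r) = A"
      unfolding A_def using subs(1) 3 by (intro perm) (simp_all add: add_mset_commute)
    finally have 2: "D = C + A" .
    have "kappa (x3 # x4 # x2 # r) = kappa (x1 # x4 # x2 # r) + kappa (x3 # x1 # x2 # r)"
      by (rule triple) simp_all
    also have "kappa (x3 # x4 # x2 # r) = D"
      unfolding D_def using subs(4) 3 by (intro perm) (simp_all add: add_mset_commute)
    also have "kappa (x1 # x4 # x2 # r) = B"
      unfolding B_def using subs(2) 3 by (intro perm) (simp_all add: add_mset_commute)
    also have "kappa (x3 # x1 # x2 # r) = A"
      unfolding A_def using subs(1) 3 by (intro perm) (simp_all add: add_mset_commute)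
    finally have 3: "D = B + A" .
    have "kappa (x3 # x4 # x1 # r) = kappa (x2 # x4 # x1 # r) + kappa (x3 # x2 # x1 # r)"
      by (rule triple) simp_all
    also have "kappa (x3 # x4 # x1 # r) = C"
      unfolding C_def using subs(3) \<open>w = _\<close> by (intro perm) (simp_all add: add_mset_commute)
    also have "kappa (x2 # x4 # x1 # r) = B"
      unfolding B_def using subs(2) \<open>w = _\<close> by (intro perm) (simp_all add: add_mset_commute)
    also have "kappa (x3 # x2 # x1 # r) = A"
      unfolding A_def using subs(1) \<open>w = _\<close> by (intro perm) (simp_all add: add_mset_commute)
    finally have 4: "C = B + A" .
    have BA: "B = A" using 1 2 by (metis add_left_cancel)
    have C: "C = 0" unfolding 4 BA by (rule add_self)
    have "D = 0" unfolding 3 BA by (rule add_self)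
    then have "A = 0" unfolding 2 C by (simp only: add_0_left)
    then show ?thesis unfolding A_def \<open>w = x1 # x2 # x3 # r\<close> .
  qed
qed

lemma kappa_full:
  assumes "mset w = M" "mset w' = M"
  shows "kappa w = kappa w'"
proof (rule kappa_perm[of "size M"])
  show "kappa u = 0" if "Suc (length u) = size M" "mset u \<subseteq># M" for u
    using that big by (intro kappa_short) auto
qed (use assms big in auto)

end

text \<open>Only the full words escape the induction, because they leave no spare letter; there the remainder
  is a constant \<open>L\<close>.\<close>

theorem endpoint_form:
  assumes "3 \<le> size M"
  obtains F P L where "\<And>w. w \<noteq> [] \<Longrightarrow> mset w \<subseteq># M \<Longrightarrow>
    f w = F (hd w) + P (last w) + (if mset w = M then L else (0::'k))"
proof -
  obtain z where z: "z \<in># M" using assms by (cases M) auto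
  obtain w0 where w0: "mset w0 = M" using ex_mset by blast
  show ?thesis
  proof (rule that[of "F z" "P z" "kappa z w0"])
    fix w assume w: "w \<noteq> []" "mset w \<subseteq># M"
    have "kappa z w = (if mset w = M then kappa z w0 else 0)"
    proof (cases "mset w = M")
      case True
      then show ?thesis using kappa_full[OF z assms True w0] by simp
    next
      case False
      then have "length w < size M"
        using w(2) mset_subset_size[of "mset w" M] by (simp add: subset_mset.less_le)
      then show ?thesis using kappa_short[OF z assms w] False by simp
    qed
    moreover have "f w = F z (hd w) + P z (last w) + kappa z w"
      by (simp only: kappa_def[OF z assms] xor)
    ultimately show "f w = F z (hd w) + P z (last w) + (if mset w = M then kappa z w0 else 0)"
      by simp
  qed
qed

end

context fronted
begin

lemma dot_perm:
  assumes "a \<noteq> []" "4 \<le> length (a @ b)" "mset b = mset b'"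
  shows "dot a b = dot a b'"
proof (rule adjacent_swaps[where N = "mset b"])
  fix u i j w assume "mset (u @ i # j # w) = mset b"
  then have "length (u @ i # j # w) = length b" by (rule mset_eq_length)
  then show "dot a (u @ i # j # w) = dot a (u @ j # i # w)"
    using dot_swap[of a "[i]" "[j]" u w] assms(1,2) by simp
qed (simp_all only: assms(3))

theorem dot_endpoint_form:
  assumes free: "\<And>a b b'. a \<noteq> [] \<Longrightarrow> mset (a @ b) = M \<Longrightarrow> mset b = mset b' \<Longrightarrow> dot a b = dot a b'"
    and M: "3 \<le> size M"
  obtains F P L where "\<And>a b. a \<noteq> [] \<Longrightarrow> mset (a @ b) = M \<Longrightarrow>
    dot a b = F (hd a) + P (last a) + (if b = [] then L else (0::'k))"
proof -
  define f where "f a = dot a (sorted_list_of_multiset (M - mset a))" for a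
  have f: "f a = dot a b" if "a \<noteq> []" "mset (a @ b) = M" for a b
    unfolding f_def using that by (intro free[symmetric]) auto
  have rest: "\<exists>v. mset (a @ v) = M" if "mset a \<subseteq># M" for a
    using that ex_mset[of "M - mset a"] by (metis mset_append subset_mset.add_diff_inverse)
  interpret split_functional f M
  proof
    fix a b :: "nat list" assume ab: "a \<noteq> []" "b \<noteq> []" "mset (a @ b) \<subseteq># M"
    then obtain v where v: "mset ((a @ b) @ v) = M" using rest by blast
    have "f (a @ b) = dot (a @ b) v" "f (b @ a) = dot (b @ a) v"
      "f a = dot a (b @ v)" "f b = dot b (a @ v)"
      using v ab by (auto intro!: f simp: ac_simps)
    note eqs = this
    have "f (a @ b) + f (b @ a) + (f a + f b) = 0"
      unfolding eqs by (rule zero_by[OF dot_left[OF ab(1,2), of v]]) (simp only: xor)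
    then show "f (a @ b) + f (b @ a) = f a + f b" by (rule eq_by_sum)
  next
    fix u p b c :: "nat list"
    assume ne: "u @ p \<noteq> []" "b \<noteq> []" "c \<noteq> []" and sub: "mset (u @ b @ c @ p) \<subseteq># M"
    then obtain v where v: "mset ((u @ b @ c @ p) @ v) = M" using rest by blast
    have "f (u @ b @ c @ p) = dot (u @ b @ c @ p) v" "f (u @ c @ b @ p) = dot (u @ c @ b @ p) v"
      "f (u @ b @ p) = dot (u @ b @ p) (c @ v)" "f (u @ c @ p) = dot (u @ c @ p) (b @ v)"
      using v ne by (auto intro!: f simp: ac_simps)
    note eqs = this
    have same: "dot (u @ p) (b @ c @ v) = dot (u @ p) (c @ b @ v)"
      using v ne by (intro free) (auto simp: ac_simps)
    have "f (u @ b @ c @ p) + f (u @ c @ b @ p) + (f (u @ b @ p) + f (u @ c @ p)) = 0"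
      unfolding eqs
      by (rule zero_by[OF dot_inner[OF ne, of "[]" v]]) (simp only: xor same)
    then show "f (u @ b @ c @ p) + f (u @ c @ b @ p) = f (u @ b @ p) + f (u @ c @ p)"
      by (rule eq_by_sum)
  qed
  obtain F P L where FPL: "\<And>w. w \<noteq> [] \<Longrightarrow> mset w \<subseteq># M \<Longrightarrow>
      f w = F (hd w) + P (last w) + (if mset w = M then L else 0)"
    using endpoint_form[OF M] by blast
  show ?thesis
  proof (rule that[of F P L])
    fix a b assume ab: "a \<noteq> []" "mset (a @ b) = M"
    then have "mset a \<subseteq># M" "mset a = M \<longleftrightarrow> b = []" by auto
    then show "dot a b = F (hd a) + P (last a) + (if b = [] then L else 0)"
      using FPL[of a] ab f[OF ab] by simp
  qed
qed

end

context nil_char2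
begin

text \<open>Seven instances of the cube relations add up to this identity. It says that after a square all
  letters but the first commute.\<close>

lemma square_swap:
  assumes "y \<noteq> []" "b \<noteq> []" "c \<noteq> []" "e \<noteq> []"
  shows "lam (u @ y @ y @ b @ c @ e @ v) = lam (u @ y @ y @ b @ e @ c @ v)"
proof -
  have ne: "y @ b \<noteq> []" "y @ y @ b \<noteq> []" "c @ e \<noteq> []" "e @ c \<noteq> []" using assms by auto
  note r1 = S3[OF ne(2) assms(3,4), of u v]
  note r2 = S3[OF assms(2-4), of "u @ y @ y" v]
  note r3 = S3[OF ne(1) assms(3,4), of "u @ y" v]
  note r4 = quad[OF assms(1,3), of u "b @ e @ v"]
  note r5 = quad[OF assms(1,4), of u "b @ c @ v"]
  note r6 = quad[OF assms(1) ne(3), of u "b @ v"]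
  note r7 = quad[OF assms(1) ne(4), of u "b @ v"]
  note r = r1[THEN add_zeros, OF r2, THEN add_zeros, OF r3, THEN add_zeros, OF r4,
      THEN add_zeros, OF r5, THEN add_zeros, OF r6, THEN add_zeros, OF r7]
  show ?thesis
    by (rule eq_by_sum, rule zero_by[OF r]) (simp only: xor)
qed

lemma square_perm:
  assumes y: "y \<noteq> []" and q: "mset q = mset q'" "hd q = hd q'"
  shows "lam (u @ y @ y @ q) = lam (u @ y @ y @ q')"
proof (cases q)
  case Nil
  then show ?thesis using q by simp
next
  case (Cons i r)
  then obtain r' where q': "q' = i # r'" using q by (cases q') auto
  have "lam (u @ y @ y @ i # r) = lam (u @ y @ y @ i # r')"
  proof (rule adjacent_swaps[where N = "mset r" and g = "\<lambda>r. lam (u @ y @ y @ i # r)"])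
    fix s b c w
    show "lam (u @ y @ y @ i # s @ b # c # w) = lam (u @ y @ y @ i # s @ c # b # w)"
      using square_swap[of y "i # s" "[b]" "[c]" u w] y by simp
  qed (use q Cons q' in simp_all)
  then show ?thesis using Cons q' by simp
qed

end

lemma (in S3_functional) S3_rev: "S3_functional (\<lambda>w. lam (rev w))"
proof
  fix u a b c v :: "nat list" assume "a \<noteq> []" "b \<noteq> []" "c \<noteq> []"
  then show "lam (rev (u @ a @ b @ c @ v)) + lam (rev (u @ a @ c @ b @ v)) + lam (rev (u @ b @ a @ c @ v)) +
    lam (rev (u @ b @ c @ a @ v)) + lam (rev (u @ c @ a @ b @ v)) + lam (rev (u @ c @ b @ a @ v)) = 0"
    using S3[of "rev a" "rev b" "rev c" "rev v" "rev u"] by (simp add: ac_simps)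
qed

lemma (in nil_functional) nil_rev: "nil_functional (\<lambda>w. lam (rev w))"
proof (intro nil_functional.intro nil_functional_axioms.intro S3_rev)
  fix u a b v :: "nat list" assume "a \<noteq> []"
  then show "lam (rev (u @ a @ a @ a @ v)) = 0"
    using cube[of "rev a" "rev v" "rev u"] by simp
  assume "b \<noteq> []"
  then show "lam (rev (u @ a @ a @ b @ v)) + lam (rev (u @ a @ b @ a @ v)) + lam (rev (u @ b @ a @ a @ v)) = 0"
    using quad[of "rev a" "rev b" "rev v" "rev u"] \<open>a \<noteq> []\<close> by (simp add: ac_simps)
qed

lemma (in S3_functional) S3_restrict: "S3_functional (\<lambda>w. if mset w = D then lam w else 0)"
proof
  fix u a b c v :: "nat list" assume "a \<noteq> []" "b \<noteq> []" "c \<noteq> []"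
  from S3[OF this, of u v]
  show "(if mset (u @ a @ b @ c @ v) = D then lam (u @ a @ b @ c @ v) else 0) +
    (if mset (u @ a @ c @ b @ v) = D then lam (u @ a @ c @ b @ v) else 0) +
    (if mset (u @ b @ a @ c @ v) = D then lam (u @ b @ a @ c @ v) else 0) +
    (if mset (u @ b @ c @ a @ v) = D then lam (u @ b @ c @ a @ v) else 0) +
    (if mset (u @ c @ a @ b @ v) = D then lam (u @ c @ a @ b @ v) else 0) +
    (if mset (u @ c @ b @ a @ v) = D then lam (u @ c @ b @ a @ v) else 0) = 0"
    by (cases "mset (u @ a @ b @ c @ v) = D") (simp_all add: ac_simps)
qed

lemma concat_map_eq_Nil: "(\<And>i. h i \<noteq> []) \<Longrightarrow> concat (map h a) = [] \<longleftrightarrow> a = []"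
  by (cases a) auto

text \<open>Replacing letters by nonempty words is an algebra homomorphism and maps cubes to cubes. This
  allows a block such as \<open>y @ y\<close> to be treated as a single letter.\<close>

lemma (in S3_functional) S3_substitute:
  assumes "\<And>i. h i \<noteq> []"
  shows "S3_functional (\<lambda>w. lam (u @ concat (map h w)))"
proof
  fix u' a b c v :: "nat list" assume "a \<noteq> []" "b \<noteq> []" "c \<noteq> []"
  with assms have "concat (map h a) \<noteq> []" "concat (map h b) \<noteq> []" "concat (map h c) \<noteq> []"
    using concat_map_eq_Nil by metis+
  from S3[OF this, of "u @ concat (map h u')" "concat (map h v)"]
  show "lam (u @ concat (map h (u' @ a @ b @ c @ v))) + lam (u @ concat (map h (u' @ a @ c @ b @ v))) +
    lam (u @ concat (map h (u' @ b @ a @ c @ v))) + lam (u @ concat (map h (u' @ b @ c @ a @ v))) +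
    lam (u @ concat (map h (u' @ c @ a @ b @ v))) + lam (u @ concat (map h (u' @ c @ b @ a @ v))) = 0"
    by simp
qed

lemma (in nil_functional) nil_substitute:
  assumes "\<And>i. h i \<noteq> []"
  shows "nil_functional (\<lambda>w. lam (u @ concat (map h w)))"
proof (intro nil_functional.intro nil_functional_axioms.intro S3_substitute assms)
  fix u' a b v :: "nat list" assume "a \<noteq> []"
  then have a: "concat (map h a) \<noteq> []" using assms concat_map_eq_Nil by metis
  from cube[OF a, of "u @ concat (map h u')" "concat (map h v)"]
  show "lam (u @ concat (map h (u' @ a @ a @ a @ v))) = 0" by simp
  assume "b \<noteq> []"
  then have b: "concat (map h b) \<noteq> []" using assms concat_map_eq_Nil by metis
  from quad[OF a b, of "u @ concat (map h u')" "concat (map h v)"]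
  show "lam (u @ concat (map h (u' @ a @ a @ b @ v))) + lam (u @ concat (map h (u' @ a @ b @ a @ v))) +
    lam (u @ concat (map h (u' @ b @ a @ a @ v))) = 0" by simp
qed

lemma S3_add:
  assumes "S3_functional l" "S3_functional l'"
  shows "S3_functional (\<lambda>w. l w + l' w)"
proof
  fix u a b c v :: "nat list" assume ne: "a \<noteq> []" "b \<noteq> []" "c \<noteq> []"
  show "l (u @ a @ b @ c @ v) + l' (u @ a @ b @ c @ v) + (l (u @ a @ c @ b @ v) + l' (u @ a @ c @ b @ v)) +
    (l (u @ b @ a @ c @ v) + l' (u @ b @ a @ c @ v)) + (l (u @ b @ c @ a @ v) + l' (u @ b @ c @ a @ v)) +
    (l (u @ c @ a @ b @ v) + l' (u @ c @ a @ b @ v)) + (l (u @ c @ b @ a @ v) + l' (u @ c @ b @ a @ v)) = 0"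
    by (rule zero_by[OF add_zeros[OF S3_functional.S3[OF assms(1) ne, of u v] S3_functional.S3[OF assms(2) ne, of u v]]])
      (simp only: ac_simps)
qed

lemma nil_add:
  assumes "nil_functional l" "nil_functional l'"
  shows "nil_functional (\<lambda>w. l w + l' w)"
proof (intro nil_functional.intro nil_functional_axioms.intro S3_add)
  show "S3_functional l" "S3_functional l'" using assms by (auto simp: nil_functional_def)
  fix u a b v :: "nat list" assume a: "a \<noteq> []"
  show "l (u @ a @ a @ a @ v) + l' (u @ a @ a @ a @ v) = 0"
    using assms a by (simp add: nil_functional.cube)
  assume b: "b \<noteq> []"
  show "l (u @ a @ a @ b @ v) + l' (u @ a @ a @ b @ v) + (l (u @ a @ b @ a @ v) + l' (u @ a @ b @ a @ v)) +
    (l (u @ b @ a @ a @ v) + l' (u @ b @ a @ a @ v)) = 0"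
    by (rule zero_by[OF add_zeros[OF nil_functional.quad[OF assms(1) a b, of u v] nil_functional.quad[OF assms(2) a b, of u v]]])
      (simp only: ac_simps)
qed

text \<open>Total weight of the adjacent pairs of a word: the source of all functionals used for independence.\<close>

fun esum :: "(nat \<Rightarrow> nat \<Rightarrow> 'k) \<Rightarrow> nat list \<Rightarrow> 'k::field" where
  "esum g [] = 0"
| "esum g [i] = 0"
| "esum g (i # j # w) = g i j + esum g (j # w)"

definition join :: "(nat \<Rightarrow> nat \<Rightarrow> 'k) \<Rightarrow> nat list \<Rightarrow> nat list \<Rightarrow> 'k::field" where
  "join g a b = (if a = [] \<or> b = [] then 0 else g (last a) (hd b))"

lemma esum_append: "esum g (a @ b) = esum g a + join g a b + esum g b"
proof (induction g a rule: esum.induct)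
  case (2 g i)
  then show ?case by (cases b) (auto simp: join_def)
qed (auto simp: join_def)

lemma join_append:
  "b \<noteq> [] \<Longrightarrow> join g a (b @ c) = join g a b"
  "b \<noteq> [] \<Longrightarrow> join g (a @ b) c = join g b c"
  by (auto simp: join_def)

text \<open>Every junction of two blocks, and every inner pair, occurs an even number of times among the
  six arrangements.\<close>

lemma (in char2) S3_esum: "S3_functional (esum g :: nat list \<Rightarrow> 'k)"
  by standard (simp only: esum_append join_append not_False_eq_True append_is_Nil_conv simp_thms xor)

lemma (in char2) esum_quad:
  assumes "a \<noteq> []" "b \<noteq> []"
  shows "esum g (u @ a @ a @ b @ v) + esum g (u @ a @ b @ a @ v) + esum g (u @ b @ a @ a @ v)
    = (esum g (u @ b @ v) :: 'k)"
  using assms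
  by (simp only: esum_append join_append not_False_eq_True append_is_Nil_conv simp_thms xor)

lemma (in char2) esum_cube:
  assumes "a \<noteq> []"
  shows "esum g (u @ a @ a @ a @ v) = (esum g (u @ a @ v) :: 'k)"
  using assms
  by (simp only: esum_append join_append not_False_eq_True append_is_Nil_conv simp_thms xor)

text \<open>The relations involving a square fail only by the weight of the word from which the two equal
  blocks have been deleted, so it suffices that this shorter word has weight zero. The border
  letter \<open>0\<close> at both ends lets the weights see the first and the last letter.\<close>

lemma (in char2) nil_edge:
  assumes "\<And>a w. a \<noteq> [] \<Longrightarrow> w \<noteq> [] \<Longrightarrow> mset (a @ a @ w) = D \<Longrightarrow> esum g (0 # w @ [0]) = (0::'k)"
  shows "nil_functional (\<lambda>w. if mset w = D then esum g (0 # w @ [0]) else 0)"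
proof (intro nil_functional.intro nil_functional_axioms.intro)
  have "S3_functional (\<lambda>w. esum g (0 # w @ [0]))"
  proof
    fix u a b c v :: "nat list" assume "a \<noteq> []" "b \<noteq> []" "c \<noteq> []"
    from S3_functional.S3[OF S3_esum this, of g "0 # u" "v @ [0]"]
    show "esum g (0 # (u @ a @ b @ c @ v) @ [0]) + esum g (0 # (u @ a @ c @ b @ v) @ [0]) +
      esum g (0 # (u @ b @ a @ c @ v) @ [0]) + esum g (0 # (u @ b @ c @ a @ v) @ [0]) +
      esum g (0 # (u @ c @ a @ b @ v) @ [0]) + esum g (0 # (u @ c @ b @ a @ v) @ [0]) = 0"
      by simp
  qed
  then show "S3_functional (\<lambda>w. if mset w = D then esum g (0 # w @ [0]) else 0)"
    by (rule S3_functional.S3_restrict)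
  fix u a b v :: "nat list" assume a: "a \<noteq> []"
  show "(if mset (u @ a @ a @ a @ v) = D then esum g (0 # (u @ a @ a @ a @ v) @ [0]) else 0) = 0"
    using esum_cube[OF a, of g "0 # u" "v @ [0]"] assms[of a "u @ a @ v"] a
    by (auto simp: ac_simps)
  assume b: "b \<noteq> []"
  have "esum g (0 # (u @ a @ a @ b @ v) @ [0]) + esum g (0 # (u @ a @ b @ a @ v) @ [0])
      + esum g (0 # (u @ b @ a @ a @ v) @ [0]) = 0" if "mset (u @ a @ a @ b @ v) = D"
    using esum_quad[OF a b, of g "0 # u" "v @ [0]"] assms[of a "u @ b @ v"] a b that
    by (simp add: ac_simps)
  then show "(if mset (u @ a @ a @ b @ v) = D then esum g (0 # (u @ a @ a @ b @ v) @ [0]) else 0) +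
    (if mset (u @ a @ b @ a @ v) = D then esum g (0 # (u @ a @ b @ a @ v) @ [0]) else 0) +
    (if mset (u @ b @ a @ a @ v) = D then esum g (0 # (u @ b @ a @ a @ v) @ [0]) else 0) = 0"
    by (cases "mset (u @ a @ a @ b @ v) = D") (simp_all add: ac_simps)
qed

lemma esum_zero:
  assumes "\<And>i j. i \<in> set w \<Longrightarrow> j \<in> set w \<Longrightarrow> g i j = 0"
  shows "esum g w = 0"
  using assms by (induction g w rule: esum.induct) auto

context nil_char2
begin

lemma nil_char2_rev: "nil_char2 (\<lambda>w. lam (rev w))"
  by (intro nil_char2.intro nil_rev S3_char2.intro S3_rev char2_axioms)

lemma square_perm_left:
  assumes "y \<noteq> []" "mset p = mset p'" "last p = last p'"
  shows "lam (p @ y @ y @ v) = lam (p' @ y @ y @ v)"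
proof -
  interpret R: nil_char2 "\<lambda>w. lam (rev w)" by (rule nil_char2_rev)
  have "p = [] \<longleftrightarrow> p' = []" using assms(2) by (metis mset_zero_iff)
  then have "hd (rev p) = hd (rev p')" using assms(3) by (cases "p = []") (simp_all add: hd_rev)
  then show ?thesis
    using R.square_perm[of "rev y" "rev p" "rev p'" "rev v"] assms(1,2) by simp
qed

text \<open>Regard \<open>y @ y\<close> as a new letter \<open>0\<close>. After subtracting a functional that accounts for the words
  starting with this letter, the commutator argument applies and gives the endpoint form; by
  commutation on the left of the square the first letter cannot matter either. The border value
  \<open>0\<close> stands for an empty side.\<close>

theorem neighbour_form:
  assumes y: "y \<noteq> []" and M: "0 \<notin># M" "4 \<le> size M"
  obtains R S where "\<And>p q. mset (p @ q) = M \<Longrightarrow>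
    lam (p @ y @ y @ q) = R (last (0 # p)) + S (hd (q @ [0]))"
proof -
  define h where "h i = (if i = 0 then y @ y else [i])" for i :: nat
  have h: "h i \<noteq> []" for i using y by (simp add: h_def)
  have h_id: "concat (map h p) = p" if "0 \<notin> set p" for p
    using that by (induction p) (auto simp: h_def)
  define s where "s i = lam (y @ y @ i # sorted_list_of_multiset (M - {#i#}))" for i
  define g where "g i j = (if i = 0 then s j else 0)" for i j :: nat
  define mu where "mu w = (if mset w = add_mset 0 M then lam (concat (map h w)) + esum g w else 0)" for w
  have g: "esum g (a @ 0 # b) = (if b = [] then 0 else s (hd b))" if "0 \<notin> set a" "0 \<notin> set b" for a b
  proof -
    have "esum g a = 0" "esum g b = 0" "join g a (0 # b) = 0" "join g [0] b = (if b = [] then 0 else s (hd b))"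
      using that by (auto intro!: esum_zero simp: g_def join_def dest: last_in_set)
    then show ?thesis using esum_append[of g a "0 # b"] esum_append[of g "[0]" b] by simp
  qed
  have mu: "mu (a @ [0] @ b) = lam (a @ y @ y @ b) + (if b = [] then 0 else s (hd b))"
    if "mset (a @ b) = M" for a b
  proof -
    have "0 \<notin> set a" "0 \<notin> set b" using that M(1) by auto
    then show ?thesis using that by (simp add: mu_def h_id g) (simp add: h_def)
  qed
  have front: "lam (y @ y @ q) = s (hd q)" if "mset q = M" for q
  proof -
    have "q \<noteq> []" using that M(2) by auto
    then have "hd q \<in># M" using that by auto
    then have "lam ([] @ y @ y @ q) = lam ([] @ y @ y @ hd q # sorted_list_of_multiset (M - {#hd q#}))"
      using that by (intro square_perm y) simp_all
    then show ?thesis by (simp add: s_def)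
  qed
  have "S3_functional mu"
    unfolding mu_def using S3_substitute[OF h, where u = "[]"] S3_esum[of g]
    by (intro S3_functional.S3_restrict S3_add) simp_all
  then interpret mu: fronted mu "[0]"
  proof (intro fronted.intro S3_char2.intro fronted_axioms.intro char2_axioms)
    fix w show "mu ([0] @ w) = 0"
    proof (cases "mset w = M")
      case True
      then have "w \<noteq> []" using M(2) by auto
      then show ?thesis using True mu[of "[]" w] front[of w] by (simp add: add_self)
    qed (simp add: mu_def)
  qed simp_all
  obtain F P L where FPL: "\<And>a b. a \<noteq> [] \<Longrightarrow> mset (a @ b) = M \<Longrightarrow>
      mu.dot a b = F (hd a) + P (last a) + (if b = [] then L else 0)"
  proof (rule mu.dot_endpoint_form)
    show "mu.dot a b = mu.dot a b'" if "a \<noteq> []" "mset (a @ b) = M" "mset b = mset b'" for a b b'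
    proof (rule mu.dot_perm)
      show "4 \<le> length (a @ b)" using that(2) M(2) by (metis size_mset)
    qed (use that in simp_all)
  qed (use M(2) in auto)
  have val: "lam (a @ y @ y @ b) = F (hd a) + P (last a) + (if b = [] then L else s (hd b))"
    if "a \<noteq> []" "mset (a @ b) = M" for a b
  proof -
    have "lam (a @ y @ y @ b) = mu (a @ [0] @ b) + (if b = [] then 0 else s (hd b))"
      unfolding mu[OF that(2)] by (simp only: xor)
    then show ?thesis using FPL[OF that] by (simp add: mu.dot_def)
  qed
  obtain i0 where i0: "i0 \<in># M" using M(2) by (cases M) auto
  have F: "F i = F i0" if i: "i \<in># M" for i
  proof (cases "i = i0")
    case False
    then have "add_mset i {#i0#} \<subseteq># M" using i i0 by (intro submset_insert) (auto simp: in_diff_count)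
    then have sub: "{#i, i0#} \<subseteq># M" by simp
    then obtain N where N: "M = {#i, i0#} + N" by (metis subset_mset.le_iff_add)
    then obtain t N' where "N = add_mset t N'" using M(2) by (cases N) auto
    moreover obtain r where "mset r = N'" using ex_mset by blast
    ultimately have "mset ((i # i0 # r) @ [t]) = M" "mset ((i0 # i # r) @ [t]) = M"
      using N by (simp_all add: add_mset_commute)
    then have "lam ((i # i0 # r @ [t]) @ y @ y @ []) = F i + P t + L"
      "lam ((i0 # i # r @ [t]) @ y @ y @ []) = F i0 + P t + L"
      using val[of "i # i0 # r @ [t]" "[]"] val[of "i0 # i # r @ [t]" "[]"] by simp_all
    moreover have "lam ((i # i0 # r @ [t]) @ y @ y @ []) = lam ((i0 # i # r @ [t]) @ y @ y @ [])"
      using y by (intro square_perm_left) simp_all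
    ultimately show ?thesis by simp
  qed simp
  show ?thesis
  proof (rule that[of "\<lambda>i. if i = 0 then 0 else F i0 + P i" "\<lambda>i. if i = 0 then L else s i"])
    fix p q assume pq: "mset (p @ q) = M"
    have "hd (q @ [0]) = 0 \<longleftrightarrow> q = []" using pq M(1) by (cases q) auto
    moreover have "last p \<noteq> 0" if "p \<noteq> []"
      using pq M(1) last_in_set[OF that] by (metis UnCI set_append set_mset_mset)
    then have "last (0 # p) = 0 \<longleftrightarrow> p = []"
      by auto
    moreover have "lam (p @ y @ y @ q) = s (hd q) \<and> q \<noteq> []" if "p = []"
      using front[of q] pq that M(2) by auto
    moreover have "F (hd p) = F i0" if "p \<noteq> []"
      using pq that by (intro F) auto
    ultimately show "lam (p @ y @ y @ q) = (if last (0 # p) = 0 then 0 else F i0 + P (last (0 # p))) +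
        (if hd (q @ [0]) = 0 then L else s (hd (q @ [0])))"
      using val[of p q] pq by (cases "p = []") simp_all
  qed
qed

end

section \<open>Repeated letters\<close>

context nil_char2
begin

lemma quad_letter:
  assumes "b \<noteq> []"
  shows "lam (u @ y # b @ y # v) = lam (u @ y # y # b @ v) + lam (u @ b @ y # y # v)"
proof -
  have y: "[y] \<noteq> []" by simp
  show ?thesis
    by (rule eq_by_sum, rule zero_by[OF quad[OF y assms, of u v]]) (simp only: xor)
qed

lemma cube_letter: "lam (u @ y # y # y # v) = 0"
  using cube[of "[y]" u v] by simp

lemma split_twice:
  assumes "2 \<le> count (mset w) y"
  obtains p b q where "w = p @ y # b @ y # q"
proof -
  have "0 < count (mset w) y" using assms by linarith
  then have "y \<in> set w" by (simp only: count_greater_zero_iff set_mset_mset)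
  then obtain p r where w: "w = p @ y # r" "y \<notin> set p" by (metis split_list_first)
  have "count (mset p) y = 0" using w(2) by (simp add: count_eq_zero_iff)
  moreover have "count (mset w) y = count (mset p) y + Suc (count (mset r) y)" using w(1) by simp
  ultimately have "0 < count (mset r) y" using assms by linarith
  then have "y \<in> set r" by (simp only: count_greater_zero_iff set_mset_mset)
  then obtain b q where "r = b @ y # q" by (metis split_list)
  then show ?thesis using w that by blast
qed

text \<open>The polarised cube relation moves two equal letters next to each other.\<close>

lemma square_reduction:
  assumes sq: "\<And>p q. add_mset y (add_mset y (mset (p @ q))) = mset w \<Longrightarrow> lam (p @ y # y # q) = 0"
    and "2 \<le> count (mset w) y"
  shows "lam w = 0"
proof -
  obtain p b q where w: "w = p @ y # b @ y # q" using split_twice[OF assms(2)] by blast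
  show ?thesis
  proof (cases "b = []")
    case True
    then show ?thesis using sq[of p q] w by simp
  next
    case False
    then show ?thesis using sq[of p "b @ q"] sq[of "p @ b" q] w by (simp add: quad_letter)
  qed
qed

lemma two_squares: "lam (u @ y # y # c @ y # y # v) = 0"
proof (cases "c = []")
  case False
  then show ?thesis
    using quad_letter[of c "u @ [y]" y "y # v"] cube_letter[of u y "c @ y # v"] cube_letter[of "u @ y # c" y v]
    by simp
qed (simp add: cube_letter)

text \<open>Four equal letters are moved together into two squares, or into a cube.\<close>

lemma four_letters:
  assumes "4 \<le> count (mset w) y"
  shows "lam w = 0"
proof (rule square_reduction)
  show "2 \<le> count (mset w) y" using assms by simp
  fix p q assume eq: "add_mset y (add_mset y (mset (p @ q))) = mset w"
  then have "Suc (Suc (count (mset p) y + count (mset q) y)) = count (mset w) y"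
    by (metis count_add_mset count_union mset_append)
  then consider "2 \<le> count (mset q) y" | "2 \<le> count (mset p) y"
    | "0 < count (mset p) y" "0 < count (mset q) y"
    using assms by linarith
  then show "lam (p @ y # y # q) = 0"
  proof cases
    case 1
    then obtain c e f where q: "q = c @ y # e @ y # f" by (rule split_twice)
    show ?thesis
    proof (cases "e = []")
      case False
      then show ?thesis
        using quad_letter[OF False, of "p @ y # y # c" y f] two_squares[of p y c "e @ f"] two_squares[of p y "c @ e" f] q
        by simp
    qed (use q two_squares in simp)
  next
    case 2
    then obtain c e f where p: "p = c @ y # e @ y # f" by (rule split_twice)
    show ?thesis
    proof (cases "e = []")
      case False
      then show ?thesis
        using quad_letter[OF False, of c y "f @ y # y # q"] two_squares[of c y "e @ f" q] two_squares[of "c @ e" y f q] p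
        by simp
    qed (use p two_squares in simp)
  next
    case 3
    then have "y \<in> set p" "y \<in> set q"
      by (simp_all only: count_greater_zero_iff set_mset_mset)
    then obtain c e f g where p: "p = c @ y # e" and q: "q = f @ y # g" by (metis split_list)
    show ?thesis
    proof (cases "e = []")
      case True
      then show ?thesis using p cube_letter[of c y q] by simp
    next
      case e: False
      show ?thesis
      proof (cases "f = []")
        case True
        then show ?thesis using q cube_letter[of p y g] by simp
      next
        case False
        have "lam (c @ y # y # e @ y # f @ y # g) = 0"
          using quad_letter[OF False, of "c @ y # y # e" y g] two_squares[of c y e "f @ g"] two_squares[of c y "e @ f" g]
          by simp
        then show ?thesis
          using quad_letter[OF e, of c y "y # f @ y # g"] cube_letter[of "c @ e" y "f @ y # g"] p q by simp
      qed
    qed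
  qed
qed

lemma three_reduction:
  assumes sq: "\<And>p c q. c \<noteq> [] \<Longrightarrow> add_mset y (add_mset y (add_mset y (mset (p @ c @ q)))) = mset w \<Longrightarrow>
      lam (p @ y # y # c @ y # q) = 0"
    and w: "3 \<le> count (mset w) y"
  shows "lam w = 0"
proof (rule square_reduction)
  show "2 \<le> count (mset w) y" using w by simp
  fix p q assume eq: "add_mset y (add_mset y (mset (p @ q))) = mset w"
  then have "Suc (Suc (count (mset (p @ q)) y)) = count (mset w) y"
    by (metis count_add_mset)
  then have "0 < count (mset (p @ q)) y" using w by linarith
  then have "y \<in> set (p @ q)" by (simp only: count_greater_zero_iff set_mset_mset)
  then consider "y \<in> set p" | "y \<in> set q" by auto
  then show "lam (p @ y # y # q) = 0"
  proof cases
    case 1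
    then obtain c e where p: "p = c @ y # e" by (metis split_list)
    show ?thesis
    proof (cases "e = []")
      case True
      then show ?thesis using p cube_letter[of c y q] by simp
    next
      case False
      then show ?thesis
        using quad_letter[OF False, of c y "y # q"] cube_letter[of "c @ e" y q] sq[of e c q] p eq
        by (simp add: ac_simps)
    qed
  next
    case 2
    then obtain f g where q: "q = f @ y # g" by (metis split_list)
    show ?thesis
    proof (cases "f = []")
      case True
      then show ?thesis using q cube_letter[of p y g] by simp
    next
      case False
      then show ?thesis using sq[of f p g] q eq by simp
    qed
  qed
qed

end

context nil_char2
begin

lemma letter_neighbour_form:
  assumes "0 \<notin># M" "4 \<le> size M"
  obtains R S where "\<And>p q. mset (p @ q) = M \<Longrightarrow>
    lam (p @ y # y # q) = R (last (0 # p)) + S (hd (q @ [0]))"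
  using neighbour_form[of "[y]" M] assms by auto

text \<open>The third \<open>y\<close> may stand next to the square, where the cube relation gives zero, or anywhere
  else; comparing positions forces the two one-sided functions to be constant off \<open>y\<close>.\<close>

lemma triple_letter_constant:
  assumes N: "0 \<notin># N" "y \<notin># N" "3 \<le> size N" "y \<noteq> 0"
  obtains K where "\<And>p q. mset (p @ q) = add_mset y N \<Longrightarrow>
    lam (p @ y # y # q) = (if last (0 # p) = y \<or> hd (q @ [0]) = y then 0 else K)"
proof -
  obtain R S where RS: "\<And>p q. mset (p @ q) = add_mset y N \<Longrightarrow>
      lam (p @ y # y # q) = R (last (0 # p)) + S (hd (q @ [0]))"
    using letter_neighbour_form[of "add_mset y N" y] N by auto
  have R: "R i = S y" if "i = 0 \<or> i \<in># N" for i
  proof -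
    define p where "p = (if i = 0 then [] else [i])"
    obtain r where "mset r = N - mset p" using ex_mset by blast
    then have "mset (p @ y # r) = add_mset y N" using that N(1) by (auto simp: p_def)
    then have "R (last (0 # p)) + S y = 0"
      using RS[of p "y # r"] cube_letter[of p y r] by simp
    moreover have "last (0 # p) = i" by (simp add: p_def)
    ultimately show ?thesis by (metis eq_by_sum)
  qed
  have S: "S j = R y" if "j = 0 \<or> j \<in># N" for j
  proof -
    define q where "q = (if j = 0 then [] else [j])"
    obtain r where "mset r = N - mset q" using ex_mset by blast
    then have "mset ((r @ [y]) @ q) = add_mset y N" using that N(1) by (auto simp: q_def)
    then have "R y + S (hd (q @ [0])) = 0"
      using RS[of "r @ [y]" q] cube_letter[of r y q] N(4) by simp
    moreover have "hd (q @ [0]) = j" by (simp add: q_def)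
    ultimately show ?thesis by (metis eq_by_sum)
  qed
  show ?thesis
  proof (rule that[of "S y + R y"])
    fix p q assume pq: "mset (p @ q) = add_mset y N"
    consider "last (0 # p) = y" | "hd (q @ [0]) = y" | "last (0 # p) \<noteq> y" "hd (q @ [0]) \<noteq> y" by blast
    then show "lam (p @ y # y # q) = (if last (0 # p) = y \<or> hd (q @ [0]) = y then 0 else S y + R y)"
    proof cases
      case 1
      then obtain p' where "p = p' @ [y]" using N(4) by (cases p rule: rev_cases) auto
      then show ?thesis using cube_letter[of p' y q] by simp
    next
      case 2
      then obtain q' where "q = y # q'" using N(4) by (cases q) auto
      then show ?thesis using cube_letter[of p y q'] by simp
    next
      case 3
      have "set (p @ q) \<subseteq> insert y (set_mset N)"
        using arg_cong[OF pq, of set_mset] by simp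
      then have "last (0 # p) = 0 \<or> last (0 # p) \<in># N" "hd (q @ [0]) = 0 \<or> hd (q @ [0]) \<in># N"
        using 3 by (cases p rule: rev_cases; cases q; auto)+
      then show ?thesis using RS[OF pq] R S 3 by simp
    qed
  qed
qed

theorem span_three_ones:
  assumes N: "0 \<notin># N" "y \<notin># N" "3 \<le> size N" "y \<noteq> 0"
    and v: "mset v = N" "lam (y # y # v @ [y]) = 0"
    and w: "mset w = {#y, y, y#} + N"
  shows "lam w = 0"
proof -
  obtain K where K: "\<And>p q. mset (p @ q) = add_mset y N \<Longrightarrow>
    lam (p @ y # y # q) = (if last (0 # p) = y \<or> hd (q @ [0]) = y then 0 else K)"
    using triple_letter_constant[OF N] by blast
  have "v \<noteq> []" "hd v \<noteq> y" using v N by (cases v; auto)+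
  then have K0: "K = 0" using K[of "[]" "v @ [y]"] v N(4) by simp
  show ?thesis
  proof (rule square_reduction[of y])
    fix p q assume "add_mset y (add_mset y (mset (p @ q))) = mset w"
    then have "mset (p @ q) = add_mset y N" using w by simp
    from K[OF this] show "lam (p @ y # y # q) = 0" unfolding K0 by simp
  qed (simp add: w)
qed

text \<open>A letter \<open>z\<close> that also occurs twice can be moved into a square, and then the constant value of
  the words containing a square of \<open>y\<close> is the sum of two copies of itself.\<close>

theorem span_three_two:
  assumes N: "0 \<notin># N" "y \<notin># N" "y \<noteq> 0" and z: "{#z, z, t#} \<subseteq># N"
    and w: "mset w = {#y, y, y#} + N"
  shows "lam w = 0"
proof -
  obtain r where r: "N = {#z, z, t#} + mset r" using z by (metis subset_mset.le_iff_add ex_mset)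
  have ne: "z \<noteq> y" "t \<noteq> y" using r N(2) by auto
  obtain K where K: "\<And>p q. mset (p @ q) = add_mset y N \<Longrightarrow>
    lam (p @ y # y # q) = (if last (0 # p) = y \<or> hd (q @ [0]) = y then 0 else K)"
    using triple_letter_constant[OF N(1,2) _ N(3)] r by auto
  have "K = lam (y # y # z # t # z # y # r)"
    using K[of "[]" "z # t # z # y # r"] r ne N(3) by (simp add: ac_simps add_mset_commute)
  also have "\<dots> = lam (y # y # z # z # t # y # r) + lam (y # y # t # z # z # y # r)"
    using quad_letter[of "[t]" "[y, y]" z "y # r"] by simp
  also have "\<dots> = K + K"
    using K[of "[]" "z # z # t # y # r"] K[of "[]" "t # z # z # y # r"] r ne N(3)
    by (simp add: ac_simps add_mset_commute)
  finally have K0: "K = 0" by (simp only: add_self)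
  show ?thesis
  proof (rule square_reduction[of y])
    fix p q assume "add_mset y (add_mset y (mset (p @ q))) = mset w"
    then have "mset (p @ q) = add_mset y N" using w by simp
    from K[OF this] show "lam (p @ y # y # q) = 0" unfolding K0 by simp
  qed (simp add: w)
qed

text \<open>The relation for the second repeated letter \<open>z\<close>, applied to its two occurrences on the same and
  on different sides of the square of \<open>y\<close>, identifies all one-sided values.\<close>

lemma double_letter:
  assumes RS: "\<And>p q. mset (p @ q) = M \<Longrightarrow> lam (p @ y # y # q) = R (last (0 # p)) + S (hd (q @ [0]))"
    and M: "0 \<notin># M" "{#z, z, i, j#} \<subseteq># M"
  shows "S i = R 0" "R i = R 0" "S 0 = R 0"
proof -
  obtain r where r: "M = {#z, z, i, j#} + mset r" using M(2) by (metis subset_mset.le_iff_add ex_mset)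
  have S: "S k = R 0" if M': "M = {#z, z, k#} + mset s" for k s
  proof -
    have "lam (y # y # z # k # z # s) = lam (y # y # z # z # k # s) + lam (y # y # k # z # z # s)"
      using quad_letter[of "[k]" "[y, y]" z s] by simp
    then have "R 0 + S z = (R 0 + S z) + (R 0 + S k)"
      using RS[of "[]" "z # k # z # s"] RS[of "[]" "z # z # k # s"] RS[of "[]" "k # z # z # s"] M'
      by (simp add: add_mset_commute)
    then have "R 0 + S k = 0" by simp
    then show ?thesis by (rule eq_by_sum[symmetric])
  qed
  have R: "R k = S 0" if M': "M = {#z, z, k#} + mset s" for k s
  proof -
    have "lam (s @ z # k # z # [y, y]) = lam (s @ z # z # k # [y, y]) + lam (s @ k # z # z # [y, y])"
      using quad_letter[of "[k]" s z "[y, y]"] by simp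
    then have "R z + S 0 = (R k + S 0) + (R z + S 0)"
      using RS[of "s @ [z, k, z]" "[]"] RS[of "s @ [z, z, k]" "[]"] RS[of "s @ [k, z, z]" "[]"] M'
      by (simp add: add_mset_commute)
    then have "R k + S 0 = 0" by (simp add: add.commute)
    then show ?thesis by (rule eq_by_sum)
  qed
  have Si: "S i = R 0" and Ri: "R i = S 0"
    using r by (auto intro!: S[of i "j # r"] R[of i "j # r"] simp: add_mset_commute)
  have Sj: "S j = R 0"
    using r by (auto intro!: S[of j "i # r"] simp: add_mset_commute)
  have "lam ([i] @ z # [y, y] @ z # j # r) = lam ([i] @ z # z # [y, y] @ j # r) + lam ([i] @ [y, y] @ z # z # j # r)"
    by (rule quad_letter) simp
  then have "R z + S z = (R z + S j) + (R i + S z)"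
    using RS[of "[i, z]" "z # j # r"] RS[of "[i, z, z]" "j # r"] RS[of "[i]" "z # z # j # r"] r M(1)
    by (simp add: add_mset_commute)
  then have "(R z + S z) + ((R z + S j) + (R i + S z)) = 0" by (rule sum_by_eq)
  from zero_by[OF this] have "S j + R i = 0" by (simp only: xor)
  then have "S 0 = R 0" unfolding Sj Ri by (rule eq_by_sum[symmetric])
  then show "S i = R 0" "R i = R 0" "S 0 = R 0" using Si Ri by simp_all
qed

text \<open>After the identification of one-sided values, only the two values at \<open>z\<close> are free. The two given
  words fix them, and then each value of the form is twice the same number.\<close>

theorem span_two_twos:
  assumes N: "0 \<notin># N" "z \<notin># N" "z \<noteq> 0" "2 \<le> size N"
    and v: "mset v = N" "lam (y # y # z # z # v) = 0" "lam (z # z # y # y # v) = 0"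
    and w: "mset w = {#y, y, z, z#} + N"
  shows "lam w = 0"
proof -
  define M where "M = {#z, z#} + N"
  have M: "0 \<notin># M" "4 \<le> size M" using N by (auto simp: M_def)
  obtain R S where RS: "\<And>p q. mset (p @ q) = M \<Longrightarrow>
      lam (p @ y # y # q) = R (last (0 # p)) + S (hd (q @ [0]))"
    using letter_neighbour_form[OF M] by blast
  have const: "S i = R 0" "R i = R 0" "S 0 = R 0" if i: "i \<in># N" for i
  proof -
    obtain N' where N': "N = add_mset i N'" using multi_member_split[OF i] by blast
    then obtain j where "j \<in># N'" using N(4) by (cases N') auto
    then have "{#z, z, i, j#} \<subseteq># M" by (auto simp: M_def N' dest!: multi_member_split)
    from double_letter[OF RS M(1) this] show "S i = R 0" "R i = R 0" "S 0 = R 0" by auto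
  qed
  obtain a v' where a: "v = a # v'" "a \<in># N" using v(1) N(4) by (cases v) auto
  have sums: "R 0 + S z = 0" "R z + S a = 0"
    using RS[of "[]" "z # z # v"] RS[of "[z, z]" v] v a by (auto simp: M_def)
  have z: "S z = R 0" "R z = R 0"
    using eq_by_sum[OF sums(1)] eq_by_sum[OF sums(2)] const(1)[OF a(2)] by simp_all
  have all: "S i = R 0" "R i = R 0" if "i = 0 \<or> i \<in># M" for i
    using that const a(2) z by (auto simp: M_def)
  show ?thesis
  proof (rule square_reduction[of y])
    fix p q assume "add_mset y (add_mset y (mset (p @ q))) = mset w"
    then have pq: "mset (p @ q) = M" using w by (simp add: M_def)
    then have "set (p @ q) \<subseteq> set_mset M" by (metis order_refl set_mset_mset)
    then have ends: "last (0 # p) = 0 \<or> last (0 # p) \<in># M" "hd (q @ [0]) = 0 \<or> hd (q @ [0]) \<in># M"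
      by (cases p rule: rev_cases; cases q; auto)+
    show "lam (p @ y # y # q) = 0"
      unfolding RS[OF pq] all(1)[OF ends(2)] all(2)[OF ends(1)] by (rule add_self)
  qed (simp add: w)
qed

text \<open>With three repeated letters every letter can play the part of a letter other than the repeated
  one, so all one-sided values coincide and each value of the form is twice the same number.\<close>

theorem span_three_squares:
  assumes N: "0 \<notin># N" "z \<noteq> 0" "t \<noteq> 0"
    and w: "mset w = {#y, y, z, z, t, t#} + N"
  shows "lam w = 0"
proof -
  define M where "M = {#z, z, t, t#} + N"
  have M: "0 \<notin># M" "4 \<le> size M" using N by (auto simp: M_def)
  obtain R S where RS: "\<And>p q. mset (p @ q) = M \<Longrightarrow>
      lam (p @ y # y # q) = R (last (0 # p)) + S (hd (q @ [0]))"
    using letter_neighbour_form[OF M] by blast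
  have t: "S t = R 0" "R t = R 0" "S 0 = R 0"
    using double_letter[OF RS M(1), of z t t] by (auto simp: M_def)
  have z: "S z = R 0" "R z = R 0"
    using double_letter[OF RS M(1), of t z z] by (auto simp: M_def add_mset_commute)
  have i: "S i = R 0" "R i = R 0" if "i \<in># N" for i
    using double_letter[OF RS M(1), of z i t] that
    by (auto simp: M_def add_mset_commute dest!: multi_member_split)
  have all: "S i = R 0" "R i = R 0" if "i = 0 \<or> i \<in># M" for i
    using that t z i by (auto simp: M_def)
  show ?thesis
  proof (rule square_reduction[of y])
    fix p q assume "add_mset y (add_mset y (mset (p @ q))) = mset w"
    then have pq: "mset (p @ q) = M" using w by (simp add: M_def)
    then have "set (p @ q) \<subseteq> set_mset M" by (metis order_refl set_mset_mset)
    then have ends: "last (0 # p) = 0 \<or> last (0 # p) \<in># M" "hd (q @ [0]) = 0 \<or> hd (q @ [0]) \<in># M"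
      by (cases p rule: rev_cases; cases q; auto)+
    show "lam (p @ y # y # q) = 0"
      unfolding RS[OF pq] all(1)[OF ends(2)] all(2)[OF ends(1)] by (rule add_self)
  qed (simp add: w)
qed

end

context nil_char2
begin

text \<open>In the neighbour form the words with the square in front fix \<open>S\<close> up to the constant \<open>R 0\<close>, those with
  the square at the end fix \<open>R\<close> up to \<open>S 0\<close>, and one word with the square inside links the constants.\<close>

theorem span_one_double:
  assumes N: "0 \<notin># N" "4 \<le> size N"
    and a: "\<And>i. i \<in># N \<Longrightarrow> \<exists>q. mset (i # q) = N \<and> lam (y # y # i # q) = 0"
    and b: "\<And>i. i \<in># N \<Longrightarrow> \<exists>q. mset (i # q) = N \<and> lam (q @ [i, y, y]) = 0"
    and c: "mset (j # k # r) = N" "lam (j # y # y # k # r) = 0"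
    and w: "mset w = {#y, y#} + N"
  shows "lam w = 0"
proof -
  obtain R S where RS: "\<And>p q. mset (p @ q) = N \<Longrightarrow>
      lam (p @ y # y # q) = R (last (0 # p)) + S (hd (q @ [0]))"
    using letter_neighbour_form[OF N] by blast
  have S: "S i = R 0" if i: "i \<in># N" for i
  proof -
    obtain q where q: "mset (i # q) = N" "lam (y # y # i # q) = 0" using a[OF i] by blast
    then have "R 0 + S i = 0" using RS[of "[]" "i # q"] by simp
    then show ?thesis by (rule eq_by_sum[symmetric])
  qed
  have R: "R i = S 0" if i: "i \<in># N" for i
  proof -
    obtain q where q: "mset (i # q) = N" "lam (q @ [i, y, y]) = 0" using b[OF i] by blast
    then have "R i + S 0 = 0" using RS[of "q @ [i]" "[]"] by simp
    then show ?thesis by (rule eq_by_sum)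
  qed
  have jk: "j \<in># N" "k \<in># N" using c(1) by auto
  have "R j + S k = 0" using RS[of "[j]" "k # r"] c by simp
  then have RS0: "S 0 + R 0 = 0" unfolding R[OF jk(1)] S[OF jk(2)] .
  show ?thesis
  proof (rule square_reduction[of y])
    fix p q assume "add_mset y (add_mset y (mset (p @ q))) = mset w"
    then have pq: "mset (p @ q) = N" using w by simp
    then have "p @ q \<noteq> []" using N(2) by auto
    moreover have "set (p @ q) \<subseteq> set_mset N" using pq by (metis order_refl set_mset_mset)
    ultimately consider "p = []" "hd (q @ [0]) \<in># N" | "q = []" "last (0 # p) \<in># N"
      | "last (0 # p) \<in># N" "hd (q @ [0]) \<in># N"
      by (cases p rule: rev_cases; cases q; auto)
    then show "lam (p @ y # y # q) = 0"
    proof cases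
      case 1
      then show ?thesis unfolding RS[OF pq] S[OF 1(2)] by (simp add: add_self)
    next
      case 2
      then show ?thesis unfolding RS[OF pq] R[OF 2(2)] by (simp add: add_self)
    next
      case 3
      show ?thesis unfolding RS[OF pq] R[OF 3(1)] S[OF 3(2)] by (rule RS0)
    qed
  qed (simp add: w)
qed

lemma perms3:
  assumes "mset w = {#a, b, c#}"
  shows "w \<in> {[a, b, c], [a, c, b], [b, a, c], [b, c, a], [c, a, b], [c, b, a]}"
proof -
  have "length w = 3" using assms by (metis size_mset size_add_mset size_empty numeral_3_eq_3)
  then obtain i j k where w: "w = [i, j, k]"
    by (auto simp: length_Suc_conv numeral_3_eq_3)
  with assms show ?thesis
    by (auto simp: add_eq_conv_ex add_mset_eq_single)
qed

theorem span_one_double_small: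
  assumes fixed: "distinct [y, i, j, k]"
    and a: "lam [y, y, i, j, k] = 0" "lam [y, y, j, i, k] = 0" "lam [y, y, k, i, j] = 0"
    and b: "lam [j, k, i, y, y] = 0" "lam [i, k, j, y, y] = 0" "lam [i, j, k, y, y] = 0"
    and c: "lam [i, y, y, j, k] = 0" "lam [j, y, y, i, k] = 0"
    and w: "mset w = {#y, y, i, j, k#}"
  shows "lam w = 0"
proof -
  define D where "D = {#y, y, i, j, k#}"
  define mu where "mu w = (if mset w = D then lam w else 0)" for w
  have front: "mu ([y, y] @ q) = 0" for q
  proof (cases "mset q = {#i, j, k#}")
    case True
    then have "q \<in> {[i, j, k], [i, k, j], [j, i, k], [j, k, i], [k, i, j], [k, j, i]}"
      by (rule perms3)
    then show ?thesis
      using a square_swap[of "[y]" "[i]" "[j]" "[k]" "[]" "[]"] square_swap[of "[y]" "[j]" "[i]" "[k]" "[]" "[]"]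
        square_swap[of "[y]" "[k]" "[i]" "[j]" "[]" "[]"]
      by (auto simp: mu_def)
  qed (simp add: mu_def D_def)
  have rear: "mu (q @ [y, y]) = 0" for q
  proof (cases "mset q = {#i, j, k#}")
    case True
    then have "q \<in> {[i, j, k], [i, k, j], [j, i, k], [j, k, i], [k, i, j], [k, j, i]}"
      by (rule perms3)
    then show ?thesis
      using b square_perm_left[of "[y]" "[i, j, k]" "[j, i, k]" "[]"] square_perm_left[of "[y]" "[i, k, j]" "[k, i, j]" "[]"]
        square_perm_left[of "[y]" "[j, k, i]" "[k, j, i]" "[]"]
      by (auto simp: mu_def add_mset_commute)
  qed (simp add: mu_def D_def)
  have "S3_functional mu" unfolding mu_def by (rule S3_restrict)
  then interpret mu: fronted mu "[y, y]"
    by (intro fronted.intro S3_char2.intro fronted_axioms.intro char2_axioms front) simp_all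
  have rear: "mu.dot q [] = 0" for q using rear[of q] by (simp add: mu.dot_def)
  have rotate: "mu.dot [r, s] [t] = mu.dot [t] [r, s]" for r s t
    by (rule eq_by_sum, rule zero_by[OF mu.dot_left[of "[r, s]" "[t]" "[]"]]) (simp_all add: rear)
  have com: "mu.com [i] [j] [k] [] = mu.com [j] [i] [k] []" "mu.com [i] [j] [k] [] = mu.com [k] [i] [j] []"
    using mu.com_swap_left[of "[i]" "[j]" "[k]" "[]"] mu.com_swap_right[of "[i]" "[j]" "[k]" "[]"]
      mu.com_swap_left[of "[i]" "[k]" "[j]" "[]"] by simp_all
  have 1: "mu.dot [i] [j, k] = 0" "mu.dot [j] [i, k] = 0"
    using c by (simp_all add: mu.dot_def mu_def)
  have "mu.com [k] [i] [j] [] = 0"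
    by (rule zero_by[OF mu.dot_left[of "[i]" "[j]" "[k]"]]) (simp_all add: mu.com_def rotate 1)
  with com have coms: "mu.com [k] [i] [j] [] = 0" "mu.com [j] [i] [k] [] = 0" "mu.com [i] [j] [k] [] = 0"
    by simp_all
  then have 2: "mu.dot [i] [k, j] = 0" "mu.dot [j] [k, i] = 0"
    unfolding mu.com_def using 1 by simp_all
  have 3: "mu.dot [k] [i, j] = 0"
    by (rule zero_by[OF mu.dot_left[of "[i]" "[k]" "[j]"]]) (simp_all add: rotate 1 2)
  then have 4: "mu.dot [k] [j, i] = 0"
    using coms(1) unfolding mu.com_def by simp
  have dot1: "mu.dot [r] q = 0" if "mset (r # q) = {#i, j, k#}" for r q
    using perms3[OF that] 1 2 3 4 by auto
  have all: "mu.dot p q = 0" if pq: "mset (p @ q) = {#i, j, k#}" for p q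
  proof -
    have "length (p @ q) = 3" using pq by (metis size_mset size_add_mset size_empty numeral_3_eq_3)
    then consider "p = []" | "q = []" | r where "p = [r]" | r s t where "p = [r, s]" "q = [t]"
      by (cases p; cases "tl p"; cases "tl (tl p)"; cases q; auto)
    then show ?thesis
    proof cases
      case 1
      then show ?thesis using front[of q] by (simp add: mu.dot_def)
    next
      case 2
      then show ?thesis using rear by simp
    next
      case 3
      then show ?thesis using dot1 pq by simp
    next
      case 4
      then show ?thesis using rotate dot1[of t "[r, s]"] pq by (simp add: add_mset_commute)
    qed
  qed
  show ?thesis
  proof (rule square_reduction[of y])
    fix p q assume eq: "add_mset y (add_mset y (mset (p @ q))) = mset w"
    then have "mset (p @ q) = {#i, j, k#}" using w by simp
    from all[OF this] show "lam (p @ y # y # q) = 0"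
      using eq w by (simp add: mu.dot_def mu_def D_def)
  qed (use w in simp)
qed

end

section \<open>Spanning the multilinear component\<close>

lemma B_lin_3: "B_lin 3 = {[1, 2, 3], [1, 3, 2], [2, 1, 3], [2, 3, 1], [3, 1, 2]}"
proof -
  have range: "(2 \<le> k \<and> k \<le> 3) = (k = 2 \<or> k = 3)" "(2 \<le> k \<and> k \<le> 2) = (k = 2)"
    "(3 \<le> k \<and> k \<le> 3) = (k = 3)" for k :: nat
    by auto
  have sets: "{e_word 3 k | k. 2 \<le> k \<and> k \<le> 3} = {e_word 3 2, e_word 3 3}"
    "{e_word 2 k | k. 2 \<le> k \<and> k \<le> 2} = {e_word 2 2}"
    "{h_word 3 k | k. 3 \<le> k \<and> k \<le> 3} = {h_word 3 3}"
    unfolding range by auto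
  have 2: "B_lin (Suc (Suc 0)) = (\<lambda>u. 1 # map Suc u) ` {[1]} \<union> {e_word 2 k | k. 2 \<le> k \<and> k \<le> 2}"
    by (simp add: Let_def numeral_2_eq_2)
  have "B_lin (Suc (Suc (Suc 0))) = (\<lambda>u. 1 # map Suc u) ` B_lin (Suc (Suc 0))
     \<union> {e_word 3 k | k. 2 \<le> k \<and> k \<le> 3} \<union> ({f_word 3} \<union> {h_word 3 k | k. 3 \<le> k \<and> k \<le> 3})"
    unfolding B_lin.simps(3)[of "Suc 0"] Let_def by (simp add: numeral_3_eq_3)
  then have 3: "B_lin 3 = (\<lambda>u. 1 # map Suc u) ` ((\<lambda>u. 1 # map Suc u) ` {[1]} \<union> {e_word 2 2})
     \<union> {e_word 3 2, e_word 3 3} \<union> ({f_word 3} \<union> {h_word 3 3})"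
    by (simp only: 2 sets numeral_3_eq_3[symmetric])
  have words: "e_word 2 2 = [2, 1]" "e_word 3 2 = [2, 1, 3]" "e_word 3 3 = [2, 3, 1]"
    "f_word 3 = [3, 1, 2]" "h_word 3 3 = [3, 1, 2]"
    by (simp_all add: e_word_def f_word_def h_word_def letter_run_def upt_conv_Cons)
  show ?thesis unfolding 3 words by auto
qed

lemma B_lin_Suc:
  assumes "3 \<le> d"
  shows "B_lin (Suc d) = (\<lambda>u. 1 # map Suc u) ` B_lin d
     \<union> {e_word (Suc d) k | k. 2 \<le> k \<and> k \<le> Suc d} \<union> {f_word (Suc d)}
     \<union> {h_word (Suc d) k | k. 3 \<le> k \<and> k \<le> Suc d} \<union> (if d = 3 then {[2, 1, 4, 3]} else {})"
proof -
  obtain n where "d = Suc n" using assms by (cases d) auto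
  then show ?thesis using assms by (simp add: Let_def Un_assoc)
qed

lemma letter_run_ends:
  assumes "i \<le> k"
  shows "letter_run i k \<noteq> []" "hd (letter_run i k) = i" "last (letter_run i k) = k"
proof -
  show "letter_run i k \<noteq> []" using assms by (simp add: letter_run_def)
  show "hd (letter_run i k) = i" using assms by (simp add: letter_run_def upt_conv_Cons del: upt_Suc)
  show "last (letter_run i k) = k" using assms by (simp add: letter_run_def)
qed

lemma letter_run_append:
  assumes "i \<le> Suc k" "k \<le> d"
  shows "letter_run i k @ letter_run (k + 1) d = letter_run i d"
  using upt_add_eq_append[OF assms(1), of "d - k"] assms(2) by (simp add: letter_run_def)

lemma mset_removeAll_run: "mset (removeAll i (letter_run a d)) = mset (letter_run a d) - {#i#}"
proof -
  have "removeAll i (letter_run a d) = remove1 i (letter_run a d)"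
    by (intro distinct_remove1_removeAll[symmetric]) (simp add: letter_run_def)
  then show ?thesis by simp
qed

lemma (in nil_char2) three_perms:
  assumes "lam [i, j, k] = 0" "lam [i, k, j] = 0" "lam [j, i, k] = 0" "lam [j, k, i] = 0" "lam [k, i, j] = 0"
  shows "lam [k, j, i] = 0"
  using S3[of "[i]" "[j]" "[k]" "[]" "[]"] assms by simp

text \<open>Induction on \<open>d\<close>: words starting with the first letter are covered by the previous case, so the
  functional is fronted by that letter and has an endpoint form. The three families of new basis
  words are precisely what is needed to make the potentials cancel. For four letters the
  commutation of the right part is not automatic, and the exceptional basis word supplies it.\<close>

theorem span_B_lin:
  fixes lam :: "nat list \<Rightarrow> 'k::field"
  assumes "3 \<le> d" "nil_char2 lam" "\<forall>b \<in> B_lin d. lam b = 0" "mset w = mset [1..<Suc d]"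
  shows "lam w = 0"
  using assms
proof (induction d arbitrary: lam w rule: dec_induct)
  case base
  interpret nil_char2 lam by fact
  have "mset w = {#1, 2, 3#}" using base by (simp add: upt_conv_Cons eval_nat_numeral)
  then show ?case
    using perms3[of w 1 2 3] base(2) three_perms[of 1 2 3] by (auto simp: B_lin_3)
next
  case (step d)
  interpret nil_char2 lam by fact
  define D where "D = mset [1..<Suc (Suc d)]"
  define M where "M = mset [2..<Suc (Suc d)]"
  have "[1..<Suc (Suc d)] = 1 # [2..<Suc (Suc d)]"
    by (simp add: upt_conv_Cons numeral_2_eq_2 del: upt_Suc)
  then have DM: "D = add_mset 1 M" by (simp only: D_def M_def mset.simps)
  have M: "size M = d" "set_mset M = {2..Suc d}"
    by (simp_all add: M_def atLeastLessThanSuc_atLeastAtMost del: upt_Suc mset_upt)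
  have B: "lam b = 0" if "b \<in> B_lin (Suc d)" for b using step.prems(2) that by blast
  note B_Suc = B_lin_Suc[OF step.hyps(1)]
  have front: "lam (1 # q) = 0" if "mset q = M" for q
  proof -
    have "set q = {2..Suc d}" using that M(2) by (metis set_mset_mset)
    then have q: "q = map Suc (map (\<lambda>i. i - 1) q)"
      by (auto simp: map_idI comp_def intro!: map_idI[symmetric])
    have "nil_char2 (\<lambda>w. lam ([1] @ concat (map (\<lambda>i. [Suc i]) w)))"
      by (intro nil_char2.intro S3_char2.intro nil_substitute S3_substitute char2_axioms) simp_all
    then have "nil_char2 (\<lambda>w. lam (1 # map Suc w))"
      by (simp add: concat_map_singleton)
    then have "lam (1 # map Suc (map (\<lambda>i. i - 1) q)) = 0"
    proof (rule step.IH)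
      show "\<forall>b \<in> B_lin d. lam (1 # map Suc b) = 0" using B B_Suc by blast
      have "[2..<Suc (Suc d)] = map Suc [1..<Suc d]"
        by (simp only: map_Suc_upt numeral_2_eq_2 One_nat_def)
      then have "mset q = mset (map Suc [1..<Suc d])" using that by (simp only: M_def)
      then have "image_mset (\<lambda>i. i - 1) (mset q) = image_mset (\<lambda>i. i - 1) (mset (map Suc [1..<Suc d]))"
        by (simp only:)
      then show "mset (map (\<lambda>i. i - 1) q) = mset [1..<Suc d]"
        by (simp only: mset_map image_mset.compositionality) (simp add: comp_def del: upt_Suc)
    qed
    then show ?thesis using q by simp
  qed
  define mu where "mu w = (if mset w = D then lam w else 0)" for w
  have "S3_functional mu" unfolding mu_def by (rule S3_restrict)
  then interpret mu: fronted mu "[1]"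
    using front by (intro fronted.intro S3_char2.intro fronted_axioms.intro char2_axioms)
       (auto simp: mu_def DM)
  have dot: "mu.dot a b = lam (a @ 1 # b)" if "mset (a @ b) = M" for a b
    using that unfolding mu.dot_def by (simp add: mu_def DM)
  have free: "mu.dot a b = mu.dot a b'" if ab: "a \<noteq> []" "mset (a @ b) = M" "mset b = mset b'" for a b b'
  proof -
    have len: "length (a @ b) = d" using ab(2) M(1) by (metis size_mset)
    show ?thesis
    proof (cases "d = 3")
      case False
      then show ?thesis using ab len step.hyps(1) by (intro mu.dot_perm) simp_all
    next
      case True
      have "[2, 1, 3, 4] = e_word (Suc d) 2" using True by (simp add: e_word_def letter_run_def eval_nat_numeral)
      then have "[2, 1, 3, 4] \<in> B_lin (Suc d)" "[2, 1, 4, 3] \<in> B_lin (Suc d)"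
        using True unfolding B_Suc by auto
      then have lam0: "lam [2, 1, 3, 4] = 0" "lam [2, 1, 4, 3] = 0" using B by blast+
      have M3: "M = {#2, 3, 4#}" using True by (simp add: M_def eval_nat_numeral)
      have com: "mu.com [2] [3] [4] [] = 0"
        unfolding mu.com_def using lam0 by (simp add: dot M3 add_mset_commute del: One_nat_def)
      then have com3: "mu.com [3] [2] [4] [] = 0"
        using mu.com_swap_left[of "[3]" "[2]" "[4]" "[]"] by (simp del: One_nat_def)
      have com4: "mu.com [4] [2] [3] [] = 0"
        using com mu.com_swap_left[of "[4]" "[2]" "[3]" "[]"] mu.com_swap_right[of "[2]" "[3]" "[4]" "[]"]
        by (simp del: One_nat_def)
      show ?thesis
      proof (rule adjacent_swaps[where N = "mset b"])
        fix u s t v assume N: "mset (u @ s # t # v) = mset b"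
        then have "length (u @ s # t # v) = length b" by (rule mset_eq_length)
        then have "length a + (length u + length v) = 1" using len True by simp
        moreover have "0 < length a" using ab(1) by simp
        ultimately have "length u = 0" "length v = 0" "length a = 1" by linarith+
        then have uv: "u = []" "v = []" "length a = 1" by simp_all
        then obtain i where i: "a = [i]" by (auto simp: length_Suc_conv)
        have "mset [i, s, t] = {#2, 3, 4#}" using ab(2) N i uv M3 by simp
        then have "mu.com [i] [s] [t] [] = 0"
          using perms3[of "[i, s, t]" 2 3 4] com com3 com4 mu.com_swap_right[of "[i]" "[s]" "[t]" "[]"]
          by (auto simp del: One_nat_def)
        then show "mu.dot a (u @ s # t # v) = mu.dot a (u @ t # s # v)"
          unfolding mu.com_def i uv append_Nil append_Cons by (rule eq_by_sum)
      qed (simp_all only: ab(3))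
    qed
  qed
  obtain F P L where FPL: "\<And>a b. a \<noteq> [] \<Longrightarrow> mset (a @ b) = M \<Longrightarrow>
      mu.dot a b = F (hd a) + P (last a) + (if b = [] then L else 0)"
    using mu.dot_endpoint_form[OF free, of M] M(1) step.hyps(1) by auto
  have val: "lam (a @ 1 # b) = F (hd a) + P (last a) + (if b = [] then L else 0)"
    if "a \<noteq> []" "mset (a @ b) = M" for a b
    using FPL[OF that] unfolding dot[OF that(2)] .
  have e: "F 2 + P k + (if k = Suc d then L else 0) = 0" if k: "2 \<le> k" "k \<le> Suc d" for k
  proof -
    note run = letter_run_ends[OF k(1)]
    have "letter_run 2 k @ letter_run (k + 1) (Suc d) = letter_run 2 (Suc d)"
      using k by (intro letter_run_append) simp_all
    then have "mset (letter_run 2 k @ letter_run (k + 1) (Suc d)) = M"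
      by (simp only: M_def letter_run_def)
    from val[OF run(1) this] have "lam (e_word (Suc d) k) = F 2 + P k + (if k = Suc d then L else 0)"
      using run k by (auto simp: e_word_def letter_run_def[of "Suc k"] simp del: upt_Suc)
    moreover have "e_word (Suc d) k \<in> B_lin (Suc d)" unfolding B_Suc using k by blast
    ultimately show ?thesis using B by metis
  qed
  have f: "F 2 + P (Suc d) = 0"
  proof -
    have "mset (letter_run 2 (d - 1) @ [Suc d, d]) = M"
      using step.hyps(1) by (cases d) (simp_all add: letter_run_def M_def)
    then have "lam ((letter_run 2 (d - 1) @ [Suc d]) @ 1 # [d]) = F 2 + P (Suc d)"
      using val[of "letter_run 2 (d - 1) @ [Suc d]" "[d]"] step.hyps(1) letter_run_ends[of 2 "d - 1"]
      by (simp add: hd_append)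
    moreover have "f_word (Suc d) = (letter_run 2 (d - 1) @ [Suc d]) @ 1 # [d]"
      by (simp add: f_word_def)
    moreover have "f_word (Suc d) \<in> B_lin (Suc d)" unfolding B_Suc by blast
    ultimately show ?thesis using B by metis
  qed
  have h: "F k + P k = 0" if k: "3 \<le> k" "k \<le> Suc d" for k
  proof -
    have "letter_run 1 (Suc d) = 1 # letter_run 2 (Suc d)"
      by (simp add: letter_run_def upt_conv_Cons numeral_2_eq_2 del: upt_Suc)
    then have "h_word (Suc d) k = [k] @ 1 # removeAll k (letter_run 2 (Suc d))"
      using k by (simp add: h_word_def)
    moreover have "mset ([k] @ removeAll k (letter_run 2 (Suc d))) = M"
    proof -
      have "mset (letter_run 2 (Suc d)) = M" by (simp only: M_def letter_run_def)
      then show ?thesis using k M(2) by (simp add: mset_removeAll_run)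
    qed
    moreover have "removeAll k (letter_run 2 (Suc d)) \<noteq> []"
    proof -
      have "2 \<in> set (removeAll k (letter_run 2 (Suc d)))" using k step.hyps(1) by (auto simp: letter_run_def)
      then show ?thesis by force
    qed
    moreover have "h_word (Suc d) k \<in> B_lin (Suc d)" unfolding B_Suc using k by blast
    ultimately show ?thesis
      using val[of "[k]" "removeAll k (letter_run 2 (Suc d))"] B[of "h_word (Suc d) k"] by simp
  qed
  (* The word e with k = Suc d and the word f have the same ends and differ by L alone, so L
     vanishes; then the words e determine P and the words h determine F. *)
  have L: "L = 0" using e[of "Suc d"] f step.hyps(1) by simp
  have P: "P k = F 2" if "2 \<le> k" "k \<le> Suc d" for k
    using eq_by_sum[OF f] eq_by_sum[of "F 2" "P k"] e[OF that] by (cases "k = Suc d") auto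
  have F: "F k = F 2" if "2 \<le> k" "k \<le> Suc d" for k
    using eq_by_sum[OF h[of k]] P[OF that] that by (cases "k = 2") auto
  have "1 \<in># mset w" using step.prems(3) DM D_def by simp
  then obtain a b where w: "w = a @ 1 # b" by (metis in_set_conv_decomp set_mset_mset)
  have ab: "mset (a @ b) = M" using step.prems(3) w DM D_def by simp
  show ?case
  proof (cases "a = []")
    case True
    then show ?thesis using front ab w by simp
  next
    case False
    have "set (a @ b) = {2..Suc d}" using ab M(2) by (metis set_mset_mset)
    then have "hd a \<in> {2..Suc d}" "last a \<in> {2..Suc d}" using False by auto
    then have ends: "F (hd a) = F 2" "P (last a) = F 2"
      using F[of "hd a"] P[of "last a"] by auto
    show ?thesis unfolding w val[OF False ab] ends L by (simp add: add_self)
  qed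
qed

section \<open>Duality with the quotient algebra\<close>

lemma vector_space_fscale: "Vector_Spaces.vector_space (fscale :: 'k::field \<Rightarrow> 'k freealg \<Rightarrow> 'k freealg)"
  by unfold_locales (simp_all add: fscale_add fscale_add_left fscale_fscale fscale_one)

interpretation fs: Vector_Spaces.vector_space "fscale :: 'k::field \<Rightarrow> 'k freealg \<Rightarrow> 'k freealg"
  by (rule vector_space_fscale)

text \<open>A basis of \<open>J\<close> extended by \<open>f\<close>: the coordinate of \<open>f\<close> separates it from \<open>J\<close>.\<close>

lemma separating_functional:
  fixes J :: "'k::field freealg set"
  assumes J: "fs.subspace J" and f: "f \<notin> J"
  obtains l :: "'k freealg \<Rightarrow> 'k" where "\<And>g h. l (g + h) = l g + l h" "\<And>c g. l (fscale c g) = c * l g"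
    "\<And>g. g \<in> J \<Longrightarrow> l g = 0" "l f = 1"
proof -
  obtain B where B: "B \<subseteq> J" "fs.independent B" "J \<subseteq> fs.span B"
    using fs.maximal_independent_subset[of J] by blast
  have span: "fs.span B = J" by (rule fs.span_subspace[OF B(1,3) J])
  then have ind: "fs.independent (insert f B)" using f B(2) by (intro fs.independent_insertI) auto
  define C where "C = fs.extend_basis (insert f B)"
  have C: "insert f B \<subseteq> C" "fs.independent C" "fs.span C = UNIV"
    unfolding C_def using fs.extend_basis_superset[OF ind] fs.independent_extend_basis[OF ind]
      fs.span_extend_basis[OF ind] by auto
  have fB: "f \<notin> B" using f B(1) by blast
  show ?thesis
  proof (rule that[of "\<lambda>g. fs.representation C g f"])
    fix g assume "g \<in> J"
    then have "fs.representation C g = fs.representation B g"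
      using C span by (intro fs.representation_extend) auto
    then show "fs.representation C g f = 0"
      using fs.representation_ne_zero[of B g f] fB by auto
  qed (use C in \<open>simp_all add: fs.representation_add fs.representation_scale fs.representation_basis\<close>)
qed

subsection \<open>Evaluating functionals\<close>

definition ev :: "(nat list \<Rightarrow> 'k::field) \<Rightarrow> 'k freealg \<Rightarrow> 'k" where
  "ev lam f = (\<Sum>w \<in> Poly_Mapping.keys f. Poly_Mapping.lookup f w * lam (letters w))"

lemma ev_superset:
  assumes "finite A" "Poly_Mapping.keys f \<subseteq> A"
  shows "ev lam f = (\<Sum>w \<in> A. Poly_Mapping.lookup f w * lam (letters w))"
  unfolding ev_def using assms by (intro sum.mono_neutral_left) (auto simp: in_keys_iff)

lemma ev_add: "ev lam (f + g) = ev lam f + ev lam g"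
proof -
  let ?A = "Poly_Mapping.keys f \<union> Poly_Mapping.keys g"
  have A: "finite ?A" "Poly_Mapping.keys (f + g) \<subseteq> ?A" using Poly_Mapping.keys_add[of f g] by auto
  show ?thesis
    unfolding ev_superset[OF A] ev_superset[OF A(1) Un_upper1] ev_superset[OF A(1) Un_upper2]
    by (simp add: lookup_add distrib_right sum.distrib)
qed

lemma ev_fscale: "ev lam (fscale c f) = c * ev lam f"
  unfolding ev_superset[OF finite_keys keys_fscale] by (simp add: ev_def sum_distrib_left mult.assoc)

lemma ev_zero: "ev lam 0 = 0"
  by (simp add: ev_def)

lemma ev_sum: "ev lam (sum f A) = (\<Sum>x \<in> A. ev lam (f x))"
  by (induction A rule: infinite_finite_induct) (simp_all add: ev_add ev_zero)

lemma ev_single: "ev lam (Poly_Mapping.single w c) = c * lam (letters w)"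
  by (cases "c = 0") (simp_all add: ev_def)

lemma freealg_expand:
  "f = (\<Sum>w \<in> Poly_Mapping.keys f. Poly_Mapping.single w (Poly_Mapping.lookup f w))"
proof (rule poly_mapping_eqI)
  fix u
  have "Poly_Mapping.lookup (\<Sum>w \<in> Poly_Mapping.keys f. Poly_Mapping.single w (Poly_Mapping.lookup f w)) u
    = (\<Sum>w \<in> Poly_Mapping.keys f. if w = u then Poly_Mapping.lookup f w else 0)"
    by (simp add: lookup_sum lookup_single when_def)
  then show "Poly_Mapping.lookup f u = Poly_Mapping.lookup (\<Sum>w \<in> Poly_Mapping.keys f. Poly_Mapping.single w (Poly_Mapping.lookup f w)) u"
    by (simp add: in_keys_iff)
qed

lemma freealg_induct:
  fixes f :: "'k::field freealg"
  assumes "Q 0" "\<And>w c. w \<in> Poly_Mapping.keys f \<Longrightarrow> Q (Poly_Mapping.single w c)"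
    and "\<And>g h. Q g \<Longrightarrow> Q h \<Longrightarrow> Q (g + h)"
  shows "Q f"
proof -
  have "Q (\<Sum>w \<in> A. Poly_Mapping.single w (Poly_Mapping.lookup f w))"
    if "finite A" "A \<subseteq> Poly_Mapping.keys f" for A
    using that by (induction A rule: finite_induct) (auto intro: assms)
  from this[OF finite_keys order_refl] show ?thesis by (simp only: freealg_expand[symmetric])
qed

lemma free_carrier_induct [consumes 1, case_names zero single add]:
  fixes f :: "'k::field freealg"
  assumes f: "f \<in> free_carrier d" and zero: "Q 0"
    and single: "\<And>w c. letters w \<noteq> [] \<Longrightarrow> Poly_Mapping.single w c \<in> free_carrier d \<Longrightarrow> Q (Poly_Mapping.single w c)"
    and add: "\<And>g h. g \<in> free_carrier d \<Longrightarrow> h \<in> free_carrier d \<Longrightarrow> Q g \<Longrightarrow> Q h \<Longrightarrow> Q (g + h)"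
  shows "Q f"
proof -
  have "f \<in> free_carrier d \<and> Q f"
  proof (induction f rule: freealg_induct)
    case (2 w c)
    then have "letters w \<noteq> []" "Poly_Mapping.single w c \<in> free_carrier d"
      using f by (auto simp: free_carrier_def)
    then show ?case using single by blast
  qed (auto simp: zero free_carrier_zero intro: add free_carrier_add)
  then show ?thesis by blast
qed

text \<open>The homogeneous parts of the cube of a sum.\<close>

definition sym3 :: "'k::field freealg \<Rightarrow> 'k freealg \<Rightarrow> 'k freealg \<Rightarrow> 'k freealg" where
  "sym3 a b c = a * b * c + a * c * b + b * a * c + b * c * a + c * a * b + c * b * a"

definition sym21 :: "'k::field freealg \<Rightarrow> 'k freealg \<Rightarrow> 'k freealg" where
  "sym21 a b = a * a * b + a * b * a + b * a * a"

lemma cube_add: "(a + b) ^ 3 = a ^ 3 + b ^ 3 + sym21 a b + sym21 b a" for a :: "'k::field freealg"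
  by (simp add: sym21_def power3_eq_cube algebra_simps)

lemma sym21_add: "sym21 (a + b) c = sym21 a c + sym21 b c + sym3 a b c" for a :: "'k::field freealg"
  by (simp add: sym21_def sym3_def algebra_simps)

lemma sym21_add_right: "sym21 a (b + c) = sym21 a b + sym21 a c"
  by (simp add: sym21_def algebra_simps)

lemma sym3_add: "sym3 (a + a') b c = sym3 a b c + sym3 a' b c"
    "sym3 a (b + b') c = sym3 a b c + sym3 a b' c" "sym3 a b (c + c') = sym3 a b c + sym3 a b c'"
  by (simp_all add: sym3_def algebra_simps)

lemma sym_zero: "sym3 0 b c = 0" "sym3 a 0 c = 0" "sym3 a b 0 = 0" "sym21 0 b = 0" "sym21 a 0 = 0"
  by (simp_all add: sym3_def sym21_def)

lemmas word_product = mult_single ev_single plus_fword_def distrib_left distrib_right ev_add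

context nil_functional
begin

lemma ev_context_zero:
  assumes "\<And>u v r s. ev lam (Poly_Mapping.single u r * x * Poly_Mapping.single v s) = 0"
  shows "ev lam (p * x * q) = 0"
proof (induction p rule: freealg_induct)
  case (2 u r)
  show ?case
    by (induction q rule: freealg_induct) (simp_all add: assms ev_zero ev_add distrib_left)
qed (simp_all add: ev_zero ev_add distrib_right)

lemma ev_sym3:
  assumes "a \<in> free_carrier d" "b \<in> free_carrier d" "c \<in> free_carrier d"
  shows "ev lam (p * sym3 a b c * q) = 0"
proof (induction a rule: freealg_induct)
  case (2 wa ra)
  show ?case
  proof (induction b rule: freealg_induct)
    case (2 wb rb)
    show ?case
    proof (induction c rule: freealg_induct)
      case (2 wc rc)
      have ne: "letters wa \<noteq> []" "letters wb \<noteq> []" "letters wc \<noteq> []"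
        using assms \<open>wa \<in> _\<close> \<open>wb \<in> _\<close> \<open>wc \<in> _\<close> by (auto simp: free_carrier_def)
      show ?case
      proof (rule ev_context_zero)
        fix u v r s
        have "ev lam (Poly_Mapping.single u r * sym3 (Poly_Mapping.single wa ra) (Poly_Mapping.single wb rb) (Poly_Mapping.single wc rc) * Poly_Mapping.single v s)
          = r * ra * rb * rc * s * 0"
          unfolding S3[OF ne, of "letters u" "letters v", symmetric]
          by (simp add: sym3_def word_product algebra_simps)
        then show "ev lam (Poly_Mapping.single u r * sym3 (Poly_Mapping.single wa ra) (Poly_Mapping.single wb rb) (Poly_Mapping.single wc rc) * Poly_Mapping.single v s) = 0"
          by simp
      qed
    qed (simp_all add: sym3_add sym_zero distrib_left distrib_right ev_add ev_zero)
  qed (simp_all add: sym3_add sym_zero distrib_left distrib_right ev_add ev_zero)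
qed (simp_all add: sym3_add sym_zero distrib_left distrib_right ev_add ev_zero)

lemma ev_sym21:
  assumes "a \<in> free_carrier d" "b \<in> free_carrier d"
  shows "ev lam (p * sym21 a b * q) = 0"
  using assms(1)
proof (induction a rule: free_carrier_induct)
  case (single w r)
  show ?case using assms(2)
  proof (induction b rule: free_carrier_induct)
    case (single v s)
    show ?case
    proof (rule ev_context_zero)
      fix u u' t t'
      have "ev lam (Poly_Mapping.single u t * sym21 (Poly_Mapping.single w r) (Poly_Mapping.single v s) * Poly_Mapping.single u' t')
        = t * r * r * s * t' * 0"
        unfolding quad[OF \<open>letters w \<noteq> []\<close> \<open>letters v \<noteq> []\<close>, of "letters u" "letters u'", symmetric]
        by (simp add: sym21_def word_product algebra_simps)
      then show "ev lam (Poly_Mapping.single u t * sym21 (Poly_Mapping.single w r) (Poly_Mapping.single v s) * Poly_Mapping.single u' t') = 0"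
        by simp
    qed
  qed (simp_all add: sym21_add_right sym_zero distrib_left distrib_right ev_add ev_zero)
next
  case (add g h)
  then show ?case
    using ev_sym3[OF add(1,2) assms(2)] by (simp add: sym21_add distrib_left distrib_right ev_add)
qed (simp add: sym_zero ev_zero)

lemma ev_cube:
  assumes "a \<in> free_carrier d"
  shows "ev lam (p * a ^ 3 * q) = 0"
  using assms
proof (induction a rule: free_carrier_induct)
  case (single w r)
  show ?case
  proof (rule ev_context_zero)
    fix u u' t t'
    have "ev lam (Poly_Mapping.single u t * Poly_Mapping.single w r ^ 3 * Poly_Mapping.single u' t') = t * r * r * r * t' * 0"
      unfolding cube[OF \<open>letters w \<noteq> []\<close>, of "letters u" "letters u'", symmetric]
      by (simp add: power3_eq_cube word_product algebra_simps)
    then show "ev lam (Poly_Mapping.single u t * Poly_Mapping.single w r ^ 3 * Poly_Mapping.single u' t') = 0"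
      by simp
  qed
next
  case (add g h)
  then show ?case
    using ev_sym21[OF add(1,2)] ev_sym21[OF add(2,1)] by (simp add: cube_add distrib_left distrib_right ev_add)
qed (simp add: ev_zero)

text \<open>The elements whose whole two-sided ideal is killed by the functional form an algebra ideal
  that contains all cubes.\<close>

theorem ev_cube_ideal:
  assumes "f \<in> cube_ideal d"
  shows "ev lam f = 0"
proof -
  define J where "J = {f \<in> free_carrier d. \<forall>p q. ev lam (p * f * q) = 0}"
  have "alg_ideal d J"
    unfolding alg_ideal_def
  proof (intro conjI ballI allI)
    show "J \<subseteq> free_carrier d" by (auto simp: J_def)
    show "0 \<in> J" by (simp add: J_def free_carrier_zero ev_zero)
    show "f + g \<in> J" if "f \<in> J" "g \<in> J" for f g
      using that by (simp add: J_def free_carrier_add distrib_left distrib_right ev_add)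
    show "fscale c f \<in> J" if "f \<in> J" for c f
    proof -
      have "p * fscale c f = (p * Poly_Mapping.single 0 c) * f" for p
        by (simp add: fscale_conv mult.assoc)
      then show ?thesis using that by (simp add: J_def free_carrier_scale)
    qed
    show "a * f \<in> J" if "f \<in> J" "a \<in> free_carrier d" for a f
      using that by (simp add: J_def free_carrier_mult flip: mult.assoc)
    show "f * a \<in> J" if "f \<in> J" "a \<in> free_carrier d" for a f
      using that by (simp add: J_def free_carrier_mult mult.assoc)
  qed
  moreover have "(\<lambda>a. a ^ 3) ` free_carrier d \<subseteq> J"
    by (auto simp: J_def ev_cube) (simp add: power3_eq_cube free_carrier_mult)
  ultimately have "cube_ideal d \<subseteq> J"
    unfolding cube_ideal_def by (intro hull_minimal)
  then have "ev lam (1 * f * 1) = 0" using assms unfolding J_def by blast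
  then show ?thesis by simp
qed

end

subsection \<open>Functionals on the quotient\<close>

lemma single_carrier: "w \<noteq> [] \<Longrightarrow> set w \<subseteq> {1..d} \<Longrightarrow> Poly_Mapping.single (Word w) c \<in> free_carrier d"
  by (auto simp: free_carrier_def)

lemma cube_ideal_context:
  fixes x :: "'k::field freealg"
  assumes x: "x \<in> cube_ideal d" and u: "set u \<subseteq> {1..d}" and v: "set v \<subseteq> {1..d}"
  shows "Poly_Mapping.single (Word u) 1 * x * Poly_Mapping.single (Word v) 1 \<in> cube_ideal d"
proof -
  have left: "a * f \<in> cube_ideal d" and right: "f * a \<in> cube_ideal d"
    if "a \<in> free_carrier d" "f \<in> cube_ideal d" for a f :: "'k freealg"
    using alg_ideal_cube_ideal[of d] that unfolding alg_ideal_def by blast+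
  have one: "(Poly_Mapping.single (Word []) 1 :: 'k freealg) = 1" by (simp flip: zero_fword_def)
  have 1: "Poly_Mapping.single (Word u) 1 * x \<in> cube_ideal d"
    using x one left[OF single_carrier[OF _ u] x] by (cases "u = []") simp_all
  show ?thesis
    using 1 one right[OF single_carrier[OF _ v] 1] by (cases "v = []") simp_all
qed

context
  assumes inf: "infinite (UNIV :: 'k::field set)"
begin

text \<open>The cube of \<open>a + t b\<close> is a polynomial in \<open>t\<close>; a scalar different from \<open>0\<close> and \<open>1\<close> separates the
  coefficients of \<open>t\<close> and of its square. This is where the field has to be large.\<close>

lemma sym21_cube_ideal:
  fixes a b :: "'k freealg"
  assumes a: "a \<in> free_carrier d" and b: "b \<in> free_carrier d"
  shows "sym21 a b \<in> cube_ideal d"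
proof -
  have cube: "c ^ 3 \<in> cube_ideal d" if "c \<in> free_carrier d" for c :: "'k freealg"
    unfolding cube_ideal_def using that by (intro hull_inc) blast
  have scale: "fscale t x * y = fscale t (x * y)" "x * fscale t y = fscale t (x * y)" for t and x y :: "'k freealg"
  proof -
    show left: "fscale t x * y = fscale t (x * y)" for x y :: "'k freealg"
      by (simp add: fscale_conv mult.assoc)
    show "x * fscale t y = fscale t (x * y)"
    proof (induction x rule: freealg_induct)
      case (2 w c)
      show ?case
        by (induction y rule: freealg_induct)
          (simp_all add: fscale_zero fscale_add distrib_left, simp_all add: fscale_conv mult_single ac_simps)
    qed (simp_all add: fscale_zero fscale_add distrib_right)
  qed
  have mem: "fscale t (sym21 a b) + fscale (t * t) (sym21 b a) \<in> cube_ideal d" for t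
  proof -
    have "(a + fscale t b) ^ 3 = a ^ 3 + fscale (t * t * t) (b ^ 3) + (fscale t (sym21 a b) + fscale (t * t) (sym21 b a))"
      by (simp add: sym21_def power3_eq_cube distrib_left distrib_right scale fscale_add fscale_fscale
          mult.assoc add.assoc add.commute add.left_commute)
    then have eq: "fscale t (sym21 a b) + fscale (t * t) (sym21 b a)
        = (a + fscale t b) ^ 3 + - (a ^ 3) + - fscale (t * t * t) (b ^ 3)"
      by simp
    show ?thesis
      unfolding eq using a b
      by (intro cube_ideal_add cube_ideal_uminus cube_ideal_scale cube free_carrier_add free_carrier_scale)
  qed
  obtain t :: 'k where t: "t \<noteq> 0" "t \<noteq> 1"
    using ex_new_if_finite[OF inf, of "{0, 1}"] by auto
  have "fscale (t - t * t) (sym21 a b) = (fscale t (sym21 a b) + fscale (t * t) (sym21 b a))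
      + - fscale (t * t) (fscale 1 (sym21 a b) + fscale (1 * 1) (sym21 b a))"
    by (rule poly_mapping_eqI) (simp add: lookup_add lookup_minus algebra_simps)
  then have "fscale (t - t * t) (sym21 a b) \<in> cube_ideal d"
    using mem cube_ideal_add cube_ideal_uminus cube_ideal_scale by metis
  then have "fscale (1 / (t - t * t)) (fscale (t - t * t) (sym21 a b)) \<in> cube_ideal d"
    by (rule cube_ideal_scale)
  moreover have "t - t * t \<noteq> 0" using t by (metis eq_iff_diff_eq_0 mult_cancel_left1)
  ultimately show ?thesis by (simp add: fscale_fscale fscale_one)
qed

lemma sym3_cube_ideal:
  fixes a b c :: "'k freealg"
  assumes "a \<in> free_carrier d" "b \<in> free_carrier d" "c \<in> free_carrier d"
  shows "sym3 a b c \<in> cube_ideal d"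
proof -
  have "sym3 a b c = sym21 (a + b) c + - sym21 a c + - sym21 b c"
    by (simp add: sym21_add)
  then show ?thesis
    using assms by (simp only:) (intro cube_ideal_add cube_ideal_uminus sym21_cube_ideal free_carrier_add)
qed

text \<open>If \<open>f\<close> were not congruent to a combination of \<open>B\<close>, a linear functional would vanish on the ideal
  and on \<open>B\<close> but not on \<open>f\<close>; its values on words form a functional of the kind studied above.\<close>

theorem quotient_duality:
  fixes f :: "'k freealg"
  assumes B: "finite B" "\<And>b. b \<in> B \<Longrightarrow> b \<noteq> [] \<and> set b \<subseteq> {1..d}"
    and f: "f \<in> free_carrier d"
    and zero: "\<And>lam :: nat list \<Rightarrow> 'k. nil_functional lam \<Longrightarrow> \<forall>b \<in> B. lam b = 0 \<Longrightarrow> ev lam f = 0"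
  shows "\<exists>c. f - (\<Sum>b \<in> B. fscale (c b) (Poly_Mapping.single (Word b) 1)) \<in> cube_ideal d"
proof (rule ccontr)
  define comb where "comb c = (\<Sum>b \<in> B. fscale (c b) (Poly_Mapping.single (Word b) 1))" for c :: "nat list \<Rightarrow> 'k"
  define J where "J = {g. \<exists>c. g - comb c \<in> cube_ideal d}"
  assume "\<not> ?thesis"
  then have fJ: "f \<notin> J" by (simp add: J_def comb_def)
  have comb0: "comb (\<lambda>_. 0) = 0"
    unfolding comb_def by (intro sum.neutral ballI poly_mapping_eqI) simp
  have J: "fs.subspace J"
  proof (rule fs.subspaceI)
    have "0 - comb (\<lambda>_. 0) \<in> cube_ideal d" using comb0 cube_ideal_zero by simp
    then show "0 \<in> J" unfolding J_def by blast
  next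
    fix g h assume "g \<in> J" "h \<in> J"
    then obtain c c' where c: "g - comb c \<in> cube_ideal d" "h - comb c' \<in> cube_ideal d"
      by (auto simp: J_def)
    have "comb (\<lambda>b. c b + c' b) = comb c + comb c'"
      by (simp add: comb_def fscale_add_left sum.distrib)
    then have eq: "(g + h) - comb (\<lambda>b. c b + c' b) = (g - comb c) + (h - comb c')"
      by (simp only: add_diff_add)
    have "(g + h) - comb (\<lambda>b. c b + c' b) \<in> cube_ideal d" unfolding eq by (rule cube_ideal_add[OF c])
    then show "g + h \<in> J" unfolding J_def by blast
  next
    fix r g assume "g \<in> J"
    then obtain c where c: "g - comb c \<in> cube_ideal d" by (auto simp: J_def)
    have "fscale r (comb c) = comb (\<lambda>b. r * c b)"
      by (simp add: comb_def fs.scale_sum_right)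
    then have "fscale r g - comb (\<lambda>b. r * c b) = fscale r (g - comb c)"
      by (simp add: fs.scale_right_diff_distrib)
    then have "fscale r g - comb (\<lambda>b. r * c b) \<in> cube_ideal d" using cube_ideal_scale[OF c] by simp
    then show "fscale r g \<in> J" unfolding J_def by blast
  qed
  obtain l :: "'k freealg \<Rightarrow> 'k" where l: "\<And>g h. l (g + h) = l g + l h" "\<And>c g. l (fscale c g) = c * l g"
    "\<And>g. g \<in> J \<Longrightarrow> l g = 0" "l f = 1"
    using separating_functional[OF J fJ] by blast
  have l_ideal: "l g = 0" if "g \<in> cube_ideal d" for g
  proof -
    have "g - comb (\<lambda>_. 0) \<in> cube_ideal d" using that comb0 by simp
    then show ?thesis by (intro l(3)) (auto simp: J_def)
  qed
  define mono where "mono w = (Poly_Mapping.single (Word w) 1 :: 'k freealg)" for w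
  define lam where "lam w = (if w \<noteq> [] \<and> set w \<subseteq> {1..d} then l (mono w) else 0)" for w
  have lam: "lam w = l (mono w)" if "w \<noteq> []" "set w \<subseteq> {1..d}" for w
    using that by (simp add: lam_def)
  have lam0: "lam w = 0" if "\<not> set w \<subseteq> {1..d}" for w
    using that by (simp add: lam_def)
  have mono_mult: "mono u * mono v = mono (u @ v)" for u v
    by (simp add: mono_def mult_single plus_fword_def)
  have mono: "mono w \<in> free_carrier d" if "w \<noteq> []" "set w \<subseteq> {1..d}" for w
    using that by (simp add: mono_def single_carrier)
  have "nil_functional lam"
  proof
    fix u a b c v :: "nat list" assume ne: "a \<noteq> []" "b \<noteq> []" "c \<noteq> []"
    show "lam (u @ a @ b @ c @ v) + lam (u @ a @ c @ b @ v) + lam (u @ b @ a @ c @ v) +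
      lam (u @ b @ c @ a @ v) + lam (u @ c @ a @ b @ v) + lam (u @ c @ b @ a @ v) = 0"
    proof (cases "set (u @ a @ b @ c @ v) \<subseteq> {1..d}")
      case True
      have r: "l (mono u * sym3 (mono a) (mono b) (mono c) * mono v) = 0"
        using True ne unfolding mono_def[of u] mono_def[of v]
        by (intro l_ideal cube_ideal_context sym3_cube_ideal mono) auto
      show ?thesis
        by (rule zero_by[OF r]) (use True ne in \<open>simp add: lam sym3_def distrib_left distrib_right mono_mult l(1)\<close>)
    qed (intro add_zeros lam0; auto)
  next
    fix u a v :: "nat list" assume ne: "a \<noteq> []"
    show "lam (u @ a @ a @ a @ v) = 0"
    proof (cases "set (u @ a @ v) \<subseteq> {1..d}")
      case True
      have "mono a ^ 3 \<in> cube_ideal d"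
        unfolding cube_ideal_def using True ne by (intro hull_inc imageI mono) auto
      then have "l (mono u * mono a ^ 3 * mono v) = 0"
        using True unfolding mono_def[of u] mono_def[of v] by (intro l_ideal cube_ideal_context) auto
      then show ?thesis using True ne by (simp add: lam power3_eq_cube mono_mult)
    qed (intro lam0; auto)
    fix b :: "nat list" assume ne': "b \<noteq> []"
    show "lam (u @ a @ a @ b @ v) + lam (u @ a @ b @ a @ v) + lam (u @ b @ a @ a @ v) = 0"
    proof (cases "set (u @ a @ b @ v) \<subseteq> {1..d}")
      case True
      have r: "l (mono u * sym21 (mono a) (mono b) * mono v) = 0"
        using True ne ne' unfolding mono_def[of u] mono_def[of v]
        by (intro l_ideal cube_ideal_context sym21_cube_ideal mono) auto
      show ?thesis
        by (rule zero_by[OF r]) (use True ne ne' in \<open>simp add: lam sym21_def distrib_left distrib_right mono_mult l(1)\<close>)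
    qed (intro add_zeros lam0; auto)
  qed
  moreover have "lam b = 0" if "b \<in> B" for b
  proof -
    have "comb (\<lambda>b'. if b' = b then 1 else 0) = (\<Sum>b' \<in> B. if b' = b then mono b else 0)"
      unfolding comb_def by (intro sum.cong refl) (auto simp: fscale_one mono_def intro!: poly_mapping_eqI)
    then have "mono b - comb (\<lambda>b'. if b' = b then 1 else 0) = 0" using B(1) that by simp
    then have "mono b \<in> J" unfolding J_def using cube_ideal_zero by (metis (mono_tags, lifting) mem_Collect_eq)
    then show ?thesis by (simp add: lam_def l(3))
  qed
  ultimately have "ev lam f = 0" using zero by blast
  moreover have "l f = ev lam f"
  proof -
    have l0: "l 0 = 0" using l(2)[of 0 0] by (simp add: fscale_zero)
    have lsum: "l (sum g A) = (\<Sum>x \<in> A. l (g x))" for g :: "fword \<Rightarrow> 'k freealg" and A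
      by (induction A rule: infinite_finite_induct) (simp_all add: l0 l(1))
    have "l (Poly_Mapping.single w (Poly_Mapping.lookup f w)) = Poly_Mapping.lookup f w * lam (letters w)"
      if "w \<in> Poly_Mapping.keys f" for w
    proof -
      have "Poly_Mapping.single w (Poly_Mapping.lookup f w) = fscale (Poly_Mapping.lookup f w) (mono (letters w))"
        by (simp add: mono_def fscale_conv mult_single)
      then show ?thesis using that f by (auto simp: l(2) lam_def free_carrier_def)
    qed
    then have "(\<Sum>w \<in> Poly_Mapping.keys f. l (Poly_Mapping.single w (Poly_Mapping.lookup f w))) = ev lam f"
      unfolding ev_def by (intro sum.cong refl)
    then show ?thesis using freealg_expand[of f] lsum by metis
  qed
  ultimately show False using l(4) by simp
qed

end

section \<open>Components and their bases\<close>

text \<open>The multiset of letters prescribed by a multidegree, numbering the letters from \<open>i\<close> on.\<close>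

fun content_from :: "nat \<Rightarrow> nat list \<Rightarrow> nat multiset" where
  "content_from i [] = {#}"
| "content_from i (n # ns) = replicate_mset n i + content_from (Suc i) ns"

abbreviation content :: "nat list \<Rightarrow> nat multiset" where
  "content \<equiv> content_from 1"

lemma count_content_from:
  "count (content_from i ns) j = (if i \<le> j \<and> j < i + length ns then ns ! (j - i) else 0)"
proof (induction ns arbitrary: i j)
  case (Cons n ns)
  show ?case
    by (cases "j = i") (auto simp: Cons.IH nth_Cons')
qed simp

lemma count_mset_list: "count (mset w) j = count_list w j"
  by (induction w) auto

lemma multidegree_iff_content:
  assumes "length ds = d"
  shows "set w \<subseteq> {1..d} \<and> multidegree d (Word w) = ds \<longleftrightarrow> mset w = content ds"
proof
  assume w: "set w \<subseteq> {1..d} \<and> multidegree d (Word w) = ds"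
  show "mset w = content ds"
  proof (rule multiset_eqI)
    fix j
    have "ds ! (j - 1) = count_list w j" if "1 \<le> j" "j < 1 + d"
    proof -
      have "map (count_list w) [1..<Suc d] = ds" using w by (simp add: multidegree_def)
      then have "ds ! (j - 1) = map (count_list w) [1..<Suc d] ! (j - 1)" by simp
      also have "\<dots> = count_list w j" using that by (simp add: nth_append del: upt_Suc)
      finally show ?thesis .
    qed
    moreover have "count_list w j = 0" if "\<not> (1 \<le> j \<and> j < 1 + d)"
      using w that by (auto simp: count_list_0_iff)
    ultimately show "count (mset w) j = count (content ds) j"
      using assms by (simp only: count_mset_list count_content_from) auto
  qed
next
  assume w: "mset w = content ds"
  have count: "count_list w j = (if 1 \<le> j \<and> j < 1 + d then ds ! (j - 1) else 0)" for j
    using count_mset_list[of w j] w assms by (simp only: count_content_from)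
  have "1 \<le> j \<and> j < 1 + d" if "j \<in> set w" for j
    using count[of j] that by (metis count_list_0_iff)
  then have "set w \<subseteq> {1..d}" by (force simp: less_Suc_eq_le)
  moreover have "multidegree d (Word w) = ds"
    by (rule nth_equalityI) (auto simp: multidegree_def count assms nth_append simp del: upt_Suc)
  ultimately show "set w \<subseteq> {1..d} \<and> multidegree d (Word w) = ds" by blast
qed

context
  fixes K :: "'k::field itself"
  assumes inf: "infinite (UNIV :: 'k set)"
begin

lemma component_expand:
  fixes f :: "'k freealg"
  assumes d: "length ds = d" and B: "finite B" "\<And>b. b \<in> B \<Longrightarrow> b \<noteq> [] \<and> mset b = content ds"
    and span: "\<And>(lam :: nat list \<Rightarrow> 'k) w. nil_functional lam \<Longrightarrow> \<forall>b \<in> B. lam b = 0 \<Longrightarrow>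
      mset w = content ds \<Longrightarrow> lam w = 0"
    and f: "f \<in> free_carrier d" "\<forall>w \<in> Poly_Mapping.keys f. multidegree d w = ds"
  shows "\<exists>c. f - (\<Sum>b \<in> B. fscale (c b) (Poly_Mapping.single (Word b) 1)) \<in> cube_ideal d"
proof (rule quotient_duality[OF inf B(1) _ f(1)])
  show "b \<noteq> [] \<and> set b \<subseteq> {1..d}" if "b \<in> B" for b
    using B(2)[OF that] multidegree_iff_content[OF d] by blast
  fix lam :: "nat list \<Rightarrow> 'k" assume lam: "nil_functional lam" "\<forall>b \<in> B. lam b = 0"
  have "lam (letters w) = 0" if w: "w \<in> Poly_Mapping.keys f" for w
  proof -
    have "set (letters w) \<subseteq> {1..d}" "multidegree d (Word (letters w)) = ds"
      using f w by (auto simp: free_carrier_def)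
    then show ?thesis using multidegree_iff_content[OF d] span[OF lam] by blast
  qed
  then show "ev lam f = 0" by (simp add: ev_def)
qed

theorem component_zero:
  assumes d: "length ds = d"
    and span: "\<And>(lam :: nat list \<Rightarrow> 'k) w. nil_functional lam \<Longrightarrow> mset w = content ds \<Longrightarrow> lam w = 0"
  shows "carrier (N3_comp d ds :: ('k, 'k freealg set) module) = {\<zero>\<^bsub>(N3 d :: ('k, 'k freealg set) module)\<^esub>}"
proof -
  have "f \<in> cube_ideal d" if "f \<in> free_carrier d" "\<forall>w \<in> Poly_Mapping.keys f. multidegree d w = ds"
    for f :: "'k freealg"
    using component_expand[OF d, of "{}" f] that span by auto
  then have "cube_ideal d +>\<^bsub>free_alg d\<^esub> f = cube_ideal d +>\<^bsub>free_alg d\<^esub> 0"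
    if "f \<in> free_carrier d" "\<forall>w \<in> Poly_Mapping.keys f. multidegree d w = ds" for f :: "'k freealg"
    using that by (simp add: coset_eq_iff)
  then have "(\<lambda>f :: 'k freealg. cube_ideal d +>\<^bsub>free_alg d\<^esub> f) `
      {f \<in> free_carrier d. \<forall>w \<in> Poly_Mapping.keys f. multidegree d w = ds}
    = {cube_ideal d +>\<^bsub>free_alg d\<^esub> 0}"
  proof (intro Set.equalityI image_subsetI subsetI)
    fix x assume "x \<in> {cube_ideal d +>\<^bsub>free_alg d\<^esub> (0 :: 'k freealg)}"
    then show "x \<in> (\<lambda>f. cube_ideal d +>\<^bsub>free_alg d\<^esub> f) `
      {f \<in> free_carrier d. \<forall>w \<in> Poly_Mapping.keys f. multidegree d w = ds}"
      by (intro image_eqI[of _ _ 0]) (simp_all add: free_carrier_zero)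
  qed simp
  then show ?thesis
    by (simp add: N3_comp_def zero_N3)
qed

text \<open>Spanning is tested by functionals that vanish on \<open>B\<close>, independence by a functional for each
  element of \<open>B\<close> that vanishes on the others.\<close>

theorem basis_criterion:
  assumes d: "length ds = d" and B: "finite B" "\<And>b. b \<in> B \<Longrightarrow> b \<noteq> [] \<and> mset b = content ds"
    and span: "\<And>(lam :: nat list \<Rightarrow> 'k) w. nil_functional lam \<Longrightarrow> \<forall>b \<in> B. lam b = 0 \<Longrightarrow>
      mset w = content ds \<Longrightarrow> lam w = 0"
    and dual: "\<And>b. b \<in> B \<Longrightarrow> \<exists>lam :: nat list \<Rightarrow> 'k. nil_functional lam \<and> lam b \<noteq> 0 \<and>
      (\<forall>b' \<in> B. b' \<noteq> b \<longrightarrow> lam b' = 0)"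
  shows "is_comp_basis TYPE('k) d ds B"
proof -
  let ?coset = "\<lambda>f :: 'k freealg. cube_ideal d +>\<^bsub>free_alg d\<^esub> f"
  let ?V = "N3_comp d ds :: ('k, 'k freealg set) module"
  let ?img = "word_image d :: nat list \<Rightarrow> 'k freealg set"
  define mono where "mono w = (Poly_Mapping.single (Word w) 1 :: 'k freealg)" for w
  define comb where "comb c A = (\<Sum>b \<in> A. fscale (c b) (mono b))" for c :: "nat list \<Rightarrow> 'k" and A
  have img: "?img b = ?coset (mono b)" for b by (simp add: word_image_def mono_def)
  interpret V: vectorspace "class_ring :: 'k ring" ?V by (rule vectorspace_N3_comp)
  have indep: "c b = 0" if A: "A \<subseteq> B" "b \<in> A" "comb c A \<in> cube_ideal d" for c A b
  proof -
    obtain lam :: "nat list \<Rightarrow> 'k" where lam: "nil_functional lam" "lam b \<noteq> 0"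
      "\<forall>b' \<in> B. b' \<noteq> b \<longrightarrow> lam b' = 0" using dual[of b] A(1,2) by blast
    have fin: "finite A" using A(1) B(1) finite_subset by blast
    have "ev lam (comb c A) = (\<Sum>b' \<in> A. c b' * lam b')"
      by (simp add: comb_def mono_def ev_sum ev_fscale ev_single)
    also have "\<dots> = (\<Sum>b' \<in> A. if b' = b then c b * lam b else 0)"
      using lam(3) A(1) by (intro sum.cong refl) auto
    also have "\<dots> = c b * lam b" using fin A(2) by simp
    finally show ?thesis
      using nil_functional.ev_cube_ideal[OF lam(1) A(3)] lam(2) by simp
  qed
  have inj: "inj_on ?img B"
  proof (rule inj_onI, rule ccontr)
    fix u v assume uv: "u \<in> B" "v \<in> B" "?img u = ?img v" "u \<noteq> v"
    have "mono u - mono v \<in> cube_ideal d" using uv(3) by (simp add: img coset_eq_iff)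
    moreover have "comb (\<lambda>b. if b = u then 1 else - 1) {u, v} = mono u - mono v"
      using uv(4) by (simp add: comb_def fscale_one fscale_minus_one)
    ultimately show False using indep[of "{u, v}" u "\<lambda>b. if b = u then 1 else - 1"] uv by simp
  qed
  have mono_deg: "mono b \<in> free_carrier d" "\<forall>w \<in> Poly_Mapping.keys (mono b). multidegree d w = ds"
    if "b \<in> B" for b
  proof -
    have "b \<noteq> []" "set b \<subseteq> {1..d}" "multidegree d (Word b) = ds"
      using B(2)[OF that] multidegree_iff_content[OF d] by blast+
    then show "mono b \<in> free_carrier d" "\<forall>w \<in> Poly_Mapping.keys (mono b). multidegree d w = ds"
      by (simp_all add: mono_def single_carrier)
  qed
  have carrier: "carrier ?V = ?coset ` {f \<in> free_carrier d. \<forall>w \<in> Poly_Mapping.keys f. multidegree d w = ds}"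
    by (simp add: N3_comp_def)
  have img_carrier: "?img ` B \<subseteq> carrier ?V"
    unfolding carrier using mono_deg by (auto simp: img)
  have ops: "add ?V (?coset f) (?coset g) = ?coset (f + g)" "smult ?V c (?coset f) = ?coset (fscale c f)"
    "zero ?V = ?coset 0" for f g c
    by (simp_all add: N3_comp_def coset_add coset_smult zero_N3)
  have lincomb: "V.lincomb a (?img ` A) = ?coset (comb (\<lambda>b. a (?img b)) A)" if "finite A" "A \<subseteq> B" for a A
    using that
  proof (induction A rule: finite_induct)
    case empty
    show ?case by (simp add: comb_def ops(3))
  next
    case (insert b A)
    have sub: "?img ` A \<subseteq> carrier ?V" "?img b \<in> carrier ?V" using insert.prems img_carrier by auto
    have notin: "?img b \<notin> ?img ` A"
      using insert.hyps(2) insert.prems inj by (auto dest: inj_onD)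
    have "V.lincomb a (insert (?img b) (?img ` A)) = add ?V (smult ?V (a (?img b)) (?img b)) (V.lincomb a (?img ` A))"
      unfolding V.lincomb_def using sub notin insert.hyps(1)
      by (subst V.M.finsum_insert) (auto intro!: V.smult_closed)
    also have "\<dots> = ?coset (comb (\<lambda>b. a (?img b)) (insert b A))"
      using insert by (simp add: img ops comb_def)
    finally show ?case by simp
  qed
  have "V.lin_indpt (?img ` B)"
  proof
    assume "V.lin_dep (?img ` B)"
    then obtain A a v where A: "finite A" "A \<subseteq> ?img ` B" "V.lincomb a A = zero ?V" "v \<in> A" "a v \<noteq> 0"
      unfolding V.lin_dep_def by auto
    obtain A' where A': "A' \<subseteq> B" "A = ?img ` A'" using A(2) by (auto simp: subset_image_iff)
    have fin: "finite A'" using A' B(1) finite_subset by blast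
    obtain b where b: "b \<in> A'" "v = ?img b" using A(4) A'(2) by blast
    have "comb (\<lambda>b. a (?img b)) A' \<in> cube_ideal d"
      using A(3) unfolding A'(2) lincomb[OF fin A'(1)] ops(3) coset_eq_iff by simp
    from indep[OF A'(1) b(1) this] show False using A(5) b(2) by simp
  qed
  moreover have "V.span (?img ` B) = carrier ?V"
  proof (intro Set.equalityI subsetI)
    fix x assume "x \<in> V.span (?img ` B)"
    then show "x \<in> carrier ?V" using V.span_closed[OF img_carrier] by blast
  next
    fix x assume "x \<in> carrier ?V"
    then obtain f where f: "f \<in> free_carrier d" "\<forall>w \<in> Poly_Mapping.keys f. multidegree d w = ds" "x = ?coset f"
      unfolding carrier by blast
    have "\<exists>c. f - (\<Sum>b \<in> B. fscale (c b) (Poly_Mapping.single (Word b) 1)) \<in> cube_ideal d"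
    proof (rule component_expand[OF d B(1) _ _ f(1,2)])
      show "b \<noteq> [] \<and> mset b = content ds" if "b \<in> B" for b using B(2)[OF that] .
      show "lam w = 0" if "nil_functional lam" "\<forall>b \<in> B. lam b = 0" "mset w = content ds"
        for lam :: "nat list \<Rightarrow> 'k" and w using span[OF that] .
    qed
    then obtain c where "f - comb c B \<in> cube_ideal d"
      unfolding comb_def mono_def by blast
    then have "x = ?coset (comb c B)" using f(3) by (simp add: coset_eq_iff)
    also have "comb c B = comb (\<lambda>b. c (inv_into B ?img (?img b))) B"
      unfolding comb_def using inj by (intro sum.cong) simp_all
    also have "?coset \<dots> = V.lincomb (\<lambda>v. c (inv_into B ?img v)) (?img ` B)"
      using lincomb[OF B(1), of "\<lambda>v. c (inv_into B ?img v)"] by simp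
    finally show "x \<in> V.span (?img ` B)"
      unfolding V.span_def using B(1) by auto
  qed
  ultimately show ?thesis
    unfolding is_comp_basis_def V.basis_def using inj img_carrier by blast
qed

end

section \<open>Functionals verified by enumeration\<close>

text \<open>In small degrees some functionals are not weights of adjacent pairs. Over the field with two
  elements they are Boolean functions on finitely many words, and the finitely many instances of
  the relations are verified by rewriting.\<close>

fun splits :: "nat list \<Rightarrow> (nat list \<times> nat list) list" where
  "splits [] = [([], [])]"
| "splits (x # w) = ([], x # w) # map (\<lambda>(u, v). (x # u, v)) (splits w)"

lemma splits: "(u, v) \<in> set (splits (u @ v))"
proof (induction u)
  case Nil
  show ?case by (cases v) auto
next
  case (Cons a u)
  then show ?case by (auto intro!: rev_image_eqI[of "(u, v)"])
qed

fun arrangements :: "nat \<Rightarrow> nat list \<Rightarrow> nat list list" where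
  "arrangements 0 xs = [[]]"
| "arrangements (Suc n) xs = concat (map (\<lambda>x. map ((#) x) (arrangements n (remove1 x xs))) (remdups xs))"

lemma arrangements: "mset w = mset xs \<Longrightarrow> w \<in> set (arrangements (length w) xs)"
proof (induction w arbitrary: xs)
  case (Cons x w)
  then have x: "x \<in> set xs" by (metis list.set_intros(1) set_mset_mset)
  have "mset w = mset (remove1 x xs)" by (simp flip: Cons.prems)
  then show ?case using Cons.IH[of "remove1 x xs"] x by auto
qed simp

definition relations_hold :: "(nat list \<Rightarrow> bool) \<Rightarrow> nat list \<Rightarrow> nat list \<Rightarrow> nat list \<Rightarrow> nat list \<Rightarrow> nat list \<Rightarrow> bool" where
  "relations_hold Q u a b c v \<longleftrightarrow>
     (Q (u @ a @ b @ c @ v) \<noteq> Q (u @ a @ c @ b @ v)) = (Q (u @ b @ a @ c @ v) \<noteq>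
        (Q (u @ b @ c @ a @ v) \<noteq> (Q (u @ c @ a @ b @ v) \<noteq> Q (u @ c @ b @ a @ v)))) \<and>
     (a = b \<longrightarrow> (Q (u @ a @ a @ c @ v) \<noteq> Q (u @ a @ c @ a @ v)) = Q (u @ c @ a @ a @ v)) \<and>
     (a = b \<and> b = c \<longrightarrow> \<not> Q (u @ a @ a @ a @ v))"

definition nil_check :: "(nat list \<Rightarrow> bool) \<Rightarrow> nat list \<Rightarrow> bool" where
  "nil_check Q w \<longleftrightarrow> (\<forall>(u, r) \<in> set (splits w). \<forall>(a, r) \<in> set (splits r). a \<noteq> [] \<longrightarrow>
     (\<forall>(b, r) \<in> set (splits r). b \<noteq> [] \<longrightarrow>
       (\<forall>(c, v) \<in> set (splits r). c \<noteq> [] \<longrightarrow> relations_hold Q u a b c v)))"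

text \<open>The parity functionals below arise as solutions of the linear system formed by the relations;
  \<open>phi\<close> belongs to the letters \<open>1, 1, 2, 2, 3\<close>, \<open>psi\<close> to \<open>1, 1, 1, 2, 3\<close> and \<open>eps\<close> to
  \<open>1, 1, 2, 3, 4\<close>.\<close>

definition phi where "phi w = (case dropWhile (\<lambda>x. x \<noteq> (3::nat)) w of [] \<Rightarrow> False | x # q \<Rightarrow> q \<noteq> [] \<and> hd q \<noteq> last q)"

fun odd_pairs :: "(nat \<Rightarrow> nat \<Rightarrow> bool) \<Rightarrow> nat list \<Rightarrow> bool" where
  "odd_pairs R (x # y # w) = (R x y \<noteq> odd_pairs R (y # w))"
| "odd_pairs R _ = False"

definition psi where "psi w = (odd_pairs (\<lambda>x y. x = 1 \<and> y = 1) w \<and> 3 \<notin> set (takeWhile (\<lambda>x. x \<noteq> 2) w))"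

fun odd_across :: "(nat \<Rightarrow> nat \<Rightarrow> bool) \<Rightarrow> nat list \<Rightarrow> bool" where
  "odd_across R (x # y # z # w) = ((y = 1 \<and> R x z) \<noteq> odd_across R (y # z # w))"
| "odd_across R _ = False"

text \<open>\<open>eps\<close> counts the steps of the cycle from 2 to 3 to 4 and back to 2, along the word if the two
  letters 1 are adjacent, and across a single letter 1 otherwise.\<close>

definition cyc :: "nat \<Rightarrow> nat \<Rightarrow> bool" where "cyc x y \<longleftrightarrow> (x = 2 \<and> y = 3) \<or> (x = 3 \<and> y = 4) \<or> (x = 4 \<and> y = 2)"
definition eps where "eps w = (if odd_pairs (\<lambda>x y. x = 1 \<and> y = 1) w then odd_pairs cyc w else odd_across cyc w)"

lemma nil_checkD:
  assumes "nil_check Q (u @ a @ b @ c @ v)" "a \<noteq> []" "b \<noteq> []" "c \<noteq> []"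
  shows "relations_hold Q u a b c v"
proof -
  note 1 = bspec[OF assms(1)[unfolded nil_check_def] splits, unfolded prod.case]
  note 2 = bspec[OF 1 splits, unfolded prod.case]
  note 3 = bspec[OF mp[OF 2 assms(2)] splits, unfolded prod.case]
  note 4 = bspec[OF mp[OF 3 assms(3)] splits, unfolded prod.case]
  show ?thesis by (rule mp[OF 4 assms(4)])
qed

lemma (in char2) nil_check_functional:
  assumes check: "list_all (nil_check Q) (arrangements (length xs) xs)"
  shows "nil_functional (\<lambda>w. if mset w = mset xs then of_bool (Q w) else (0::'k))"
proof (intro nil_functional.intro nil_functional_axioms.intro S3_functional.intro)
  have hold: "relations_hold Q u a b c v" if "mset (u @ a @ b @ c @ v) = mset xs" "a \<noteq> []" "b \<noteq> []" "c \<noteq> []"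
    for u a b c v
  proof -
    have "u @ a @ b @ c @ v \<in> set (arrangements (length xs) xs)"
      using arrangements[OF that(1)] mset_eq_length[OF that(1)] by simp
    then show ?thesis using check that by (intro nil_checkD) (auto simp: list_all_iff)
  qed
  have xor: "of_bool (A \<noteq> B) = of_bool A + (of_bool B :: 'k)" for A B
    by (cases A; cases B) (simp_all add: add_self del: one_add_one)
  fix u a b c v :: "nat list" assume ne: "a \<noteq> []" "b \<noteq> []" "c \<noteq> []"
  show "(if mset (u @ a @ b @ c @ v) = mset xs then of_bool (Q (u @ a @ b @ c @ v)) else (0::'k)) +
    (if mset (u @ a @ c @ b @ v) = mset xs then of_bool (Q (u @ a @ c @ b @ v)) else 0) +
    (if mset (u @ b @ a @ c @ v) = mset xs then of_bool (Q (u @ b @ a @ c @ v)) else 0) +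
    (if mset (u @ b @ c @ a @ v) = mset xs then of_bool (Q (u @ b @ c @ a @ v)) else 0) +
    (if mset (u @ c @ a @ b @ v) = mset xs then of_bool (Q (u @ c @ a @ b @ v)) else 0) +
    (if mset (u @ c @ b @ a @ v) = mset xs then of_bool (Q (u @ c @ b @ a @ v)) else 0) = 0"
  proof (cases "mset (u @ a @ b @ c @ v) = mset xs")
    case True
    have "(of_bool (Q (u @ a @ b @ c @ v) \<noteq> Q (u @ a @ c @ b @ v)) :: 'k) = of_bool (Q (u @ b @ a @ c @ v) \<noteq>
        (Q (u @ b @ c @ a @ v) \<noteq> (Q (u @ c @ a @ b @ v) \<noteq> Q (u @ c @ b @ a @ v))))"
      using hold[OF True ne] unfolding relations_hold_def by simp
    note r = sum_by_eq[OF this[unfolded xor]]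
    have perms: "mset (u @ a @ c @ b @ v) = mset xs" "mset (u @ b @ a @ c @ v) = mset xs"
      "mset (u @ b @ c @ a @ v) = mset xs" "mset (u @ c @ a @ b @ v) = mset xs" "mset (u @ c @ b @ a @ v) = mset xs"
      using True by (simp_all add: ac_simps)
    show ?thesis
      by (rule zero_by[OF r]) (simp only: True perms simp_thms if_True add.assoc)
  qed (simp add: ac_simps)
next
  show "(if mset (u @ a @ a @ a @ v) = mset xs then of_bool (Q (u @ a @ a @ a @ v)) else (0::'k)) = 0"
    if "a \<noteq> []" for u a v
  proof (cases "mset (u @ a @ a @ a @ v) = mset xs")
    case True
    have "u @ a @ a @ a @ v \<in> set (arrangements (length xs) xs)"
      using arrangements[OF True] mset_eq_length[OF True] by simp
    then have "relations_hold Q u a a a v" using check that by (intro nil_checkD) (auto simp: list_all_iff)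
    then show ?thesis by (simp add: relations_hold_def)
  qed simp
  fix u a b v :: "nat list" assume ne: "a \<noteq> []" "b \<noteq> []"
  have xor: "of_bool (A \<noteq> B) = of_bool A + (of_bool B :: 'k)" for A B
    by (cases A; cases B) (simp_all add: add_self del: one_add_one)
  show "(if mset (u @ a @ a @ b @ v) = mset xs then of_bool (Q (u @ a @ a @ b @ v)) else (0::'k)) +
    (if mset (u @ a @ b @ a @ v) = mset xs then of_bool (Q (u @ a @ b @ a @ v)) else 0) +
    (if mset (u @ b @ a @ a @ v) = mset xs then of_bool (Q (u @ b @ a @ a @ v)) else 0) = 0"
  proof (cases "mset (u @ a @ a @ b @ v) = mset xs")
    case True
    have "u @ a @ a @ b @ v \<in> set (arrangements (length xs) xs)"
      using arrangements[OF True] mset_eq_length[OF True] by simp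
    then have "relations_hold Q u a a b v" using check ne by (intro nil_checkD) (auto simp: list_all_iff)
    then have "(of_bool (Q (u @ a @ a @ b @ v) \<noteq> Q (u @ a @ b @ a @ v)) :: 'k) = of_bool (Q (u @ b @ a @ a @ v))"
      unfolding relations_hold_def by simp
    note r = sum_by_eq[OF this[unfolded xor]]
    have perms: "mset (u @ a @ b @ a @ v) = mset xs" "mset (u @ b @ a @ a @ v) = mset xs"
      using True by (simp_all add: ac_simps)
    show ?thesis
      by (rule zero_by[OF r]) (simp only: True perms simp_thms if_True add.assoc)
  qed (simp add: ac_simps)
qed

section \<open>Functionals counting adjacent letters\<close>

lemma esum_map: "esum (\<lambda>i j. g (f i) (f j)) w = esum g (map f w)"
  by (induction "\<lambda>i j. g (f i) (f j)" w rule: esum.induct) auto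

lemma esum_cong:
  assumes "\<And>i j. i \<in> set (butlast w) \<Longrightarrow> j \<in> set (tl w) \<Longrightarrow> g i j = g' i j"
  shows "esum g w = esum g' w"
  using assms
proof (induction g w rule: esum.induct)
  case (3 g i j w)
  have "esum g (j # w) = esum g' (j # w)"
    using 3(2) by (intro 3(1)) (auto dest: list.set_sel(2) split: if_splits)
  then show ?case using 3(2)[of i j] by simp
qed auto

lemma esum_zero': "(\<And>i j. i \<in> set (butlast w) \<Longrightarrow> j \<in> set (tl w) \<Longrightarrow> g i j = 0) \<Longrightarrow> esum g w = 0"
  using esum_cong[of w g "\<lambda>_ _. 0"] esum_zero[of w "\<lambda>_ _. 0"] by simp

lemma esum_add: "esum (\<lambda>i j. g i j + g' i j) w = esum g w + esum g' w"
  by (induction "\<lambda>i j. g i j + g' i j" w rule: esum.induct) (auto simp: ac_simps)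

lemma esum_scale: "esum (\<lambda>i j. c * g i j) w = c * esum g w"
  by (induction "\<lambda>i j. c * g i j" w rule: esum.induct) (auto simp: distrib_left)

definition adjacent :: "nat \<Rightarrow> nat \<Rightarrow> nat \<Rightarrow> nat \<Rightarrow> 'k::field" where
  "adjacent a b i j = (if i = a \<and> j = b then 1 else 0)"

context char2
begin

text \<open>Without repeated letters the square relations are void.\<close>

lemma nil_distinct:
  assumes "\<And>i. count D i \<le> 1"
  shows "nil_functional (\<lambda>w. if mset w = D then esum g (0 # w @ [0]) else (0::'k))"
proof (rule nil_edge)
  fix a w assume aw: "a \<noteq> []" "mset (a @ a @ w) = D"
  then have "2 \<le> count D (hd a)" by (cases a) auto
  with assms[of "hd a"] show "esum g (0 # w @ [0]) = (0::'k)" by simp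
qed

text \<open>Deleting the two copies of \<open>y\<close> leaves no pair that carries weight.\<close>

lemma nil_double:
  assumes D: "count D y = 2" "\<And>i. i \<noteq> y \<Longrightarrow> count D i \<le> 1" and y: "y \<noteq> 0"
    and g: "\<And>i j. i \<noteq> y \<Longrightarrow> j \<noteq> y \<Longrightarrow> g i j = 0"
  shows "nil_functional (\<lambda>w. if mset w = D then esum g (0 # w @ [0]) else (0::'k))"
proof (rule nil_edge)
  fix a w assume aw: "a \<noteq> []" "mset (a @ a @ w) = D"
  then have "2 \<le> count D (hd a)" by (cases a) auto
  with D(2)[of "hd a"] have "hd a = y" by force
  then have "2 + count (mset w) y \<le> count D y" using aw by (cases a) auto
  then have "y \<notin> set w" using D(1) by (simp add: count_eq_zero_iff)
  then show "esum g (0 # w @ [0]) = (0::'k)" using y by (intro esum_zero g) auto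
qed

lemma nil_two_doubles:
  assumes D: "count D y = 2" "count D z = 2" "\<And>i. i \<noteq> y \<Longrightarrow> i \<noteq> z \<Longrightarrow> count D i \<le> 1"
    and yz: "y \<noteq> 0" "z \<noteq> 0"
  shows "nil_functional (\<lambda>w. if mset w = D then esum (adjacent y z) (0 # w @ [0]) else (0::'k))"
proof (rule nil_edge)
  fix a w assume aw: "a \<noteq> []" "mset (a @ a @ w) = D"
  then have "2 \<le> count D (hd a)" by (cases a) auto
  with D(3)[of "hd a"] have "hd a = y \<or> hd a = z" by force
  moreover have "2 + count (mset w) (hd a) \<le> count D (hd a)" using aw by (cases a) auto
  ultimately have "y \<notin> set w \<or> z \<notin> set w" using D(1,2) by (auto simp: count_eq_zero_iff)
  then show "esum (adjacent y z) (0 # w @ [0]) = (0::'k)"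
    using yz by (intro esum_zero) (auto simp: adjacent_def)
qed

lemma esum_adjacent_self:
  assumes "count (mset w) y \<le> 1"
  shows "esum (adjacent y y) w = (0::'k)"
  using assms
proof (induction w rule: induct_list012)
  case (3 i j w)
  have "adjacent y y i j = (0::'k)" using 3(3) by (auto simp: adjacent_def)
  moreover have "esum (adjacent y y) (j # w) = (0::'k)"
  proof (rule 3(2))
    have "count (mset (j # w)) y \<le> count (mset (i # j # w)) y" by simp
    then show "count (mset (j # w)) y \<le> 1" using 3(3) by linarith
  qed
  ultimately show ?case by simp
qed simp_all

lemma nil_triple:
  assumes D: "count D y = 3" "\<And>i. i \<noteq> y \<Longrightarrow> count D i \<le> 1" and y: "y \<noteq> 0"
  shows "nil_functional (\<lambda>w. if mset w = D then esum (adjacent y y) (0 # w @ [0]) else (0::'k))"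
proof (rule nil_edge)
  fix a w assume aw: "a \<noteq> []" "mset (a @ a @ w) = D"
  then have "2 \<le> count D (hd a)" by (cases a) auto
  with D(2)[of "hd a"] have "hd a = y" by force
  then have "2 + count (mset w) y \<le> count D y" using aw by (cases a) auto
  then show "esum (adjacent y y) (0 # w @ [0]) = (0::'k)"
    using D(1) y by (intro esum_adjacent_self) simp
qed

text \<open>The converse of the neighbour form: the two one-sided functions can be prescribed freely. A pair
  entering \<open>y\<close> gets weight \<open>r\<close>, a pair leaving \<open>y\<close> gets weight \<open>s\<close>.\<close>

lemma double_functional:
  fixes r s :: "nat \<Rightarrow> 'k"
  assumes N: "\<And>i. count N i \<le> 1" "y \<notin># N" "0 \<notin># N" and y: "y \<noteq> 0"
  obtains lam where "nil_functional lam"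
    "\<And>p q. mset (p @ q) = N \<Longrightarrow> lam (p @ y # y # q) = r (last (0 # p)) + s (hd (q @ [0]))"
proof -
  define g where "g i j = (if i = y \<and> j = y then 0 else if j = y then r i else if i = y then s j else 0)" for i j
  define lam where "lam w = (if mset w = {#y, y#} + N then esum g (0 # w @ [0]) else 0)" for w
  have nil: "nil_functional lam"
    unfolding lam_def
  proof (rule nil_double)
    show "count ({#y, y#} + N) y = 2" using N(2) by (simp add: count_eq_zero_iff)
  qed (use N(1) y in \<open>auto simp: g_def\<close>)
  show ?thesis
  proof (rule that[OF nil])
    fix p q assume pq: "mset (p @ q) = N"
    have no: "y \<notin> set p" "y \<notin> set q" using pq N(2) by auto
    have "esum g (0 # p) = 0" "esum g (q @ [0]) = 0"
      using no y by (auto intro!: esum_zero simp: g_def)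
    moreover have "last (0 # p) \<noteq> y" "hd (q @ [0]) \<noteq> y"
      using no y by (cases p rule: rev_cases; cases q; auto)+
    ultimately have "esum g ((0 # p) @ [y, y] @ (q @ [0])) = r (last (0 # p)) + s (hd (q @ [0]))"
      unfolding esum_append by (simp add: join_def g_def)
    moreover have "mset (p @ y # y # q) = {#y, y#} + N" using pq by simp
    ultimately show "lam (p @ y # y # q) = r (last (0 # p)) + s (hd (q @ [0]))"
      by (simp add: lam_def)
  qed
qed

end

definition cyclic_sum :: "(nat \<Rightarrow> nat \<Rightarrow> 'k::field) \<Rightarrow> nat list \<Rightarrow> 'k" where
  "cyclic_sum g w = esum g (0 # w @ [0])"

lemma cyclic_sum_add: "cyclic_sum (\<lambda>i j. g i j + g' i j) w = cyclic_sum g w + cyclic_sum g' w"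
  by (simp add: cyclic_sum_def esum_add)

lemma cyclic_sum_scale: "cyclic_sum (\<lambda>i j. c * g i j) w = c * cyclic_sum g w"
  by (simp add: cyclic_sum_def esum_scale)

lemma cyclic_sum_sum:
  "finite A \<Longrightarrow> cyclic_sum (\<lambda>i j. \<Sum>a \<in> A. h a i j) w = (\<Sum>a \<in> A. cyclic_sum (h a) w)"
proof (induction A rule: finite_induct)
  case empty
  show ?case by (simp add: cyclic_sum_def esum_zero)
qed (simp add: cyclic_sum_add)

definition separated :: "'k::field itself \<Rightarrow> nat list set \<Rightarrow> nat list set \<Rightarrow> bool" where
  "separated _ A B \<longleftrightarrow> (\<forall>b \<in> A. \<exists>g :: nat \<Rightarrow> nat \<Rightarrow> 'k. cyclic_sum g b = 1 \<and>
     (\<forall>b' \<in> B. b' \<noteq> b \<longrightarrow> cyclic_sum g b' = 0))"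

text \<open>Block triangular elimination: separating functionals of \<open>B\<close> are corrected by those of \<open>A\<close> so that
  they vanish on \<open>A\<close>.\<close>

lemma separated_Un:
  assumes "finite A" "A \<inter> B = {}"
    and A: "separated TYPE('k::field) A (A \<union> B)" and B: "separated TYPE('k) B B"
  shows "separated TYPE('k) (A \<union> B) (A \<union> B)"
  unfolding separated_def
proof
  fix b assume "b \<in> A \<union> B"
  then consider "b \<in> A" | "b \<in> B" by blast
  then show "\<exists>g :: nat \<Rightarrow> nat \<Rightarrow> 'k. cyclic_sum g b = 1 \<and> (\<forall>b' \<in> A \<union> B. b' \<noteq> b \<longrightarrow> cyclic_sum g b' = 0)"
  proof cases
    case 1
    then show ?thesis using A unfolding separated_def by blast
  next
    case 2
    then obtain g :: "nat \<Rightarrow> nat \<Rightarrow> 'k" where g: "cyclic_sum g b = 1" "\<And>b'. b' \<in> B \<Longrightarrow> b' \<noteq> b \<Longrightarrow> cyclic_sum g b' = 0"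
      using B unfolding separated_def by blast
    obtain h :: "nat list \<Rightarrow> nat \<Rightarrow> nat \<Rightarrow> 'k" where
      h: "\<forall>a \<in> A. cyclic_sum (h a) a = 1 \<and> (\<forall>b' \<in> A \<union> B. b' \<noteq> a \<longrightarrow> cyclic_sum (h a) b' = 0)"
      using bchoice[OF A[unfolded separated_def]] by blast
    define g' where "g' i j = g i j + (\<Sum>a \<in> A. - cyclic_sum g a * h a i j)" for i j
    have g': "cyclic_sum g' w = cyclic_sum g w + (\<Sum>a \<in> A. - cyclic_sum g a * cyclic_sum (h a) w)" for w
      unfolding g'_def cyclic_sum_add cyclic_sum_sum[OF assms(1)] cyclic_sum_scale ..
    have in_A: "(\<Sum>a \<in> A. - cyclic_sum g a * cyclic_sum (h a) w) = - cyclic_sum g w" if w: "w \<in> A" for w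
    proof -
      have "(\<Sum>a \<in> A. - cyclic_sum g a * cyclic_sum (h a) w) = (\<Sum>a \<in> A. if a = w then - cyclic_sum g w else 0)"
        using h w by (intro sum.cong refl) auto
      then show ?thesis using w assms(1) by simp
    qed
    have in_B: "(\<Sum>a \<in> A. - cyclic_sum g a * cyclic_sum (h a) w) = 0" if w: "w \<in> B" for w
    proof (rule sum.neutral, rule ballI)
      fix a assume a: "a \<in> A"
      then have "w \<noteq> a" using w assms(2) by blast
      then show "- cyclic_sum g a * cyclic_sum (h a) w = 0" using h a w by auto
    qed
    have on_A: "cyclic_sum g' w = 0" if "w \<in> A" for w
      by (simp only: g' in_A[OF that] add.right_inverse)
    have on_B: "cyclic_sum g' w = cyclic_sum g w" if "w \<in> B" for w
      by (simp only: g' in_B[OF that] add_0_right)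
    have "cyclic_sum g' b = 1" "\<forall>b' \<in> A \<union> B. b' \<noteq> b \<longrightarrow> cyclic_sum g' b' = 0"
      using 2 g on_A on_B by auto
    then show ?thesis by blast
  qed
qed

text \<open>Weights that realise the endpoint form, with the letter \<open>1\<close> in the role of the separator.\<close>

definition ends_weight :: "(nat \<Rightarrow> 'k::field) \<Rightarrow> (nat \<Rightarrow> 'k) \<Rightarrow> 'k \<Rightarrow> nat \<Rightarrow> nat \<Rightarrow> 'k" where
  "ends_weight F P L i j = (if i = 0 \<and> j \<noteq> 1 then F j else if j = 1 \<and> i \<noteq> 0 then P i
     else if i = 1 \<and> j = 0 then L else 0)"

lemma cyclic_sum_ends:
  assumes "a \<noteq> []" "0 \<notin> set (a @ b)" "1 \<notin> set (a @ b)"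
  shows "cyclic_sum (ends_weight F P L) (a @ 1 # b) = F (hd a) + P (last a) + (if b = [] then L else 0)"
proof -
  have inner: "esum (ends_weight F P L) a = 0" "esum (ends_weight F P L) (b @ [0]) = 0"
    using assms by (auto intro!: esum_zero' simp: ends_weight_def tl_append split: list.splits
        dest: in_set_butlastD list.set_sel(2))
  have "hd a \<in> set a" "last a \<in> set a" using assms(1) by auto
  then have ends: "hd a \<noteq> 1" "last a \<noteq> 0" using assms(2,3) by (metis Un_iff set_append)+
  define t where "t = b @ [0]"
  have t: "t \<noteq> []" "esum (ends_weight F P L) t = 0" "hd t = (if b = [] then 0 else hd b)"
    "hd t \<noteq> 1"
    using inner(2) assms(3) by (cases b; simp add: t_def)+
  have "0 # (a @ 1 # b) @ [0] = [0] @ a @ [1] @ t" by (simp add: t_def)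
  then have "cyclic_sum (ends_weight F P L) (a @ 1 # b) = esum (ends_weight F P L) ([0] @ a @ [1] @ t)"
    unfolding cyclic_sum_def by (simp only:)
  also have "\<dots> = F (hd a) + P (last a) + (if hd t = 0 then L else 0)"
    unfolding esum_append inner t(2) using assms(1) ends t(1,4)
    by (simp add: join_def ends_weight_def)
  also have "hd t = 0 \<longleftrightarrow> b = []" unfolding t(3) using assms(2) by (cases b) auto
  finally show ?thesis .
qed

lemma cyclic_sum_ends_front:
  assumes "q \<noteq> []" "0 \<notin> set q" "1 \<notin> set q"
  shows "cyclic_sum (ends_weight F P L) (1 # q) = 0"
proof -
  have "esum (ends_weight F P L) (q @ [0]) = 0"
    using assms by (auto intro!: esum_zero' simp: ends_weight_def tl_append split: list.splits dest: list.set_sel(2))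
  moreover obtain k q' where "q = k # q'" using assms(1) by (cases q) auto
  ultimately show ?thesis using assms by (simp add: cyclic_sum_def ends_weight_def)
qed

lemma e_word_form:
  assumes "2 \<le> k" "k \<le> d"
  shows "e_word d k = letter_run 2 k @ 1 # letter_run (k + 1) d"
    "mset (letter_run 2 k @ letter_run (k + 1) d) = mset (letter_run 2 d)"
    "letter_run (k + 1) d = [] \<longleftrightarrow> k = d"
proof -
  show "mset (letter_run 2 k @ letter_run (k + 1) d) = mset (letter_run 2 d)"
    using letter_run_append[of 2 k d] assms by simp
  show "letter_run (k + 1) d = [] \<longleftrightarrow> k = d" using assms by (auto simp: letter_run_def)
qed (simp add: e_word_def)

lemma f_word_form:
  assumes "4 \<le> d"
  shows "f_word d = (letter_run 2 (d - 2) @ [d]) @ 1 # [d - 1]"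
    "mset ((letter_run 2 (d - 2) @ [d]) @ [d - 1]) = mset (letter_run 2 d)"
    "hd (letter_run 2 (d - 2) @ [d]) = 2"
proof -
  obtain n where n: "d = Suc (Suc n)" "2 \<le> n" using assms by (cases d; cases "d - 1") auto
  show "mset ((letter_run 2 (d - 2) @ [d]) @ [d - 1]) = mset (letter_run 2 d)"
    using n by (simp add: letter_run_def)
  show "hd (letter_run 2 (d - 2) @ [d]) = 2"
    using letter_run_ends[of 2 "d - 2"] n by (simp add: hd_append)
qed (simp add: f_word_def)

lemma h_word_form:
  assumes "3 \<le> k" "k \<le> d"
  shows "h_word d k = [k] @ 1 # removeAll k (letter_run 2 d)"
    "mset ([k] @ removeAll k (letter_run 2 d)) = mset (letter_run 2 d)"
    "removeAll k (letter_run 2 d) \<noteq> []"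
proof -
  have "letter_run 1 d = 1 # letter_run 2 d"
    using assms by (simp add: letter_run_def upt_conv_Cons numeral_2_eq_2 del: upt_Suc)
  then show "h_word d k = [k] @ 1 # removeAll k (letter_run 2 d)"
    using assms by (simp add: h_word_def)
  show "mset ([k] @ removeAll k (letter_run 2 d)) = mset (letter_run 2 d)"
  proof -
    have "k \<in># mset (letter_run 2 d)" using assms by (auto simp: letter_run_def)
    then show ?thesis by (simp add: mset_removeAll_run)
  qed
  have "2 \<in> set (removeAll k (letter_run 2 d))" using assms by (auto simp: letter_run_def)
  then show "removeAll k (letter_run 2 d) \<noteq> []" by force
qed

section \<open>Independence of the multilinear words\<close>

lemma B_lin_mset: "3 \<le> d \<Longrightarrow> b \<in> B_lin d \<Longrightarrow> mset b = mset (letter_run 1 d)"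
proof (induction d arbitrary: b rule: dec_induct)
  case base
  have "letter_run 1 3 = [1, 2, 3]" by (simp add: letter_run_def upt_conv_Cons)
  then show ?case using base by (auto simp: B_lin_3)
next
  case (step d)
  have run: "letter_run 1 (Suc d) = 1 # letter_run 2 (Suc d)"
    by (simp add: letter_run_def upt_conv_Cons numeral_2_eq_2 del: upt_Suc)
  have shift: "map Suc (letter_run 1 d) = letter_run 2 (Suc d)"
    by (simp only: letter_run_def map_Suc_upt numeral_2_eq_2 One_nat_def)
  have split: "mset (a @ 1 # c) = mset (letter_run 1 (Suc d))" if "mset (a @ c) = mset (letter_run 2 (Suc d))" for a c
    using that unfolding run by simp
  consider u where "u \<in> B_lin d" "b = 1 # map Suc u" | k where "2 \<le> k" "k \<le> Suc d" "b = e_word (Suc d) k"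
    | "b = f_word (Suc d)" | k where "3 \<le> k" "k \<le> Suc d" "b = h_word (Suc d) k" | "d = 3" "b = [2, 1, 4, 3]"
    using step.prems unfolding B_lin_Suc[OF step.hyps(1)] by (auto split: if_splits)
  then show ?case
  proof cases
    case 1
    have "mset (map Suc u) = mset (letter_run 2 (Suc d))"
      using step.IH[OF 1(1)] shift by (metis mset_map)
    then show ?thesis unfolding 1(2) run by simp
  next
    case 2
    show ?thesis unfolding 2(3) e_word_form(1)[OF 2(1,2)] by (rule split[OF e_word_form(2)[OF 2(1,2)]])
  next
    case 3
    have d: "4 \<le> Suc d" using step.hyps(1) by simp
    show ?thesis unfolding 3 f_word_form(1)[OF d] by (rule split[OF f_word_form(2)[OF d]])
  next
    case 4
    show ?thesis unfolding 4(3) h_word_form(1)[OF 4(1,2)] by (rule split[OF h_word_form(2)[OF 4(1,2)]])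
  next
    case 5
    have "letter_run 1 (Suc d) = [1, 2, 3, 4]" using 5(1) by (simp add: letter_run_def upt_conv_Cons)
    then show ?thesis using 5(2) by simp
  qed
qed

lemma finite_B_lin: "finite (B_lin d)"
proof (induction d rule: B_lin.induct)
  case (3 n)
  have "{e_word (Suc (Suc n)) k | k. 2 \<le> k \<and> k \<le> Suc (Suc n)} = e_word (Suc (Suc n)) ` {2..Suc (Suc n)}"
    "{h_word (Suc (Suc n)) k | k. 3 \<le> k \<and> k \<le> Suc (Suc n)} = h_word (Suc (Suc n)) ` {3..Suc (Suc n)}"
    by auto
  then show ?case using 3 by (simp add: Let_def)
qed simp_all

text \<open>Putting a new first letter in front of a word does not change its sum if the new letter takes over
  the role of the border.\<close>

lemma cyclic_sum_lift:
  assumes "u \<noteq> []" "0 \<notin> set u"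
  shows "cyclic_sum (\<lambda>i j. if i = 0 \<or> j = 1 then 0 else g (i - 1) (j - 1)) (1 # map Suc u) = cyclic_sum g u"
proof -
  define g' where "g' i j = (if i = 0 \<or> j = 1 then 0 else g (i - 1) (j - 1))" for i j
  define w where "w = 1 # map Suc u @ [0]"
  have "esum g' w = esum (\<lambda>i j. g (i - 1) (j - 1)) w"
    using assms(2) by (intro esum_cong) (auto simp: g'_def w_def butlast_append split: if_splits)
  also have "\<dots> = esum g (map (\<lambda>i. i - 1) w)" by (rule esum_map)
  also have "map (\<lambda>i. i - 1) w = 0 # u @ [0]" by (simp add: w_def comp_def)
  finally have "esum g' w = esum g (0 # u @ [0])" .
  moreover have "esum g' (0 # w) = esum g' w" by (simp add: w_def g'_def)
  moreover have "0 # (1 # map Suc u) @ [0] = 0 # w" by (simp add: w_def)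
  moreover have "(\<lambda>i j. if i = 0 \<or> j = 1 then 0 else g (i - 1) (j - 1)) = g'"
    by (intro ext) (simp add: g'_def)
  ultimately show ?thesis unfolding cyclic_sum_def by (simp only:)
qed

text \<open>Induction on \<open>d\<close>: lifted weights separate the words that start with the first letter, and weights of
  endpoint type, which vanish on those words, separate the new ones, except for the first word \<open>e\<close> and
  the exceptional word of length four, which form a block of their own.\<close>

theorem (in char2) B_lin_separated: "3 \<le> d \<Longrightarrow> separated TYPE('k) (B_lin d) (B_lin d)"
proof (induction d rule: dec_induct)
  case base
  have "\<exists>g :: nat \<Rightarrow> nat \<Rightarrow> 'k. cyclic_sum g b = 1 \<and> (\<forall>b' \<in> B_lin 3. b' \<noteq> b \<longrightarrow> cyclic_sum g b' = 0)"
    if b: "b \<in> B_lin 3" for b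
  proof -
    consider "b = [1, 2, 3]" | "b = [1, 3, 2]" | "b = [2, 1, 3]" | "b = [2, 3, 1]" | "b = [3, 1, 2]"
      using b unfolding B_lin_3 by blast
    then show ?thesis
    proof cases
      case 1
      then show ?thesis by (intro exI[of _ "\<lambda>i j. adjacent 1 2 i j + adjacent 0 3 i j"])
          (simp add: B_lin_3 cyclic_sum_def adjacent_def add_self del: one_add_one)
    next
      case 2
      then show ?thesis by (intro exI[of _ "\<lambda>i j. adjacent 1 3 i j + adjacent 2 1 i j"])
          (simp add: B_lin_3 cyclic_sum_def adjacent_def add_self del: one_add_one)
    next
      case 3
      then show ?thesis by (intro exI[of _ "adjacent 2 1"]) (simp add: B_lin_3 cyclic_sum_def adjacent_def)
    next
      case 4
      then show ?thesis by (intro exI[of _ "adjacent 1 0"]) (simp add: B_lin_3 cyclic_sum_def adjacent_def)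
    next
      case 5
      then show ?thesis by (intro exI[of _ "adjacent 0 3"]) (simp add: B_lin_3 cyclic_sum_def adjacent_def)
    qed
  qed
  then show ?case by (simp add: separated_def)
next
  case (step d)
  define D where "D = Suc d"
  have D: "4 \<le> D" using step.hyps(1) by (simp add: D_def)
  define front where "front = (\<lambda>u. 1 # map Suc u) ` B_lin d"
  define extra where "extra = {e_word D 2} \<union> (if d = 3 then {[2, 1, 4, 3]} else {})"
  define new where "new = e_word D ` {3..D} \<union> {f_word D} \<union> h_word D ` {3..D}"
  have "{e_word D k | k. 2 \<le> k \<and> k \<le> D} = insert (e_word D 2) (e_word D ` {3..D})"
    using D by (auto simp: image_iff le_eq_less_or_eq[of 2] Suc_le_eq[symmetric])
  moreover have "{h_word D k | k. 3 \<le> k \<and> k \<le> D} = h_word D ` {3..D}" by auto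
  ultimately have B: "B_lin D = new \<union> (extra \<union> front)"
    unfolding D_def B_lin_Suc[OF step.hyps(1)] by (auto simp: new_def extra_def front_def D_def)
  have run: "0 \<notin> set (letter_run 2 D)" "1 \<notin> set (letter_run 2 D)" by (auto simp: letter_run_def)
  have val: "cyclic_sum (ends_weight F P L) (a @ 1 # b) = F (hd a) + P (last a) + (if b = [] then L else 0)"
    if "a \<noteq> []" "mset (a @ b) = mset (letter_run 2 D)" for a b and F P :: "nat \<Rightarrow> 'k" and L
  proof -
    have "set (a @ b) = set (letter_run 2 D)" using that(2) by (metis set_mset_mset)
    then show ?thesis using run that(1) by (intro cyclic_sum_ends) simp_all
  qed
  have e: "cyclic_sum (ends_weight F P L) (e_word D k) = F 2 + P k + (if k = D then L else 0)"
    if "2 \<le> k" "k \<le> D" for F P :: "nat \<Rightarrow> 'k" and L k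
    using val[OF letter_run_ends(1)[OF that(1)] e_word_form(2)[OF that], of F P L] letter_run_ends[OF that(1)]
      e_word_form(3)[OF that] unfolding e_word_form(1)[OF that] by simp
  have f: "cyclic_sum (ends_weight F P L) (f_word D) = F 2 + P D" for F P :: "nat \<Rightarrow> 'k" and L
    using val[OF _ f_word_form(2)[OF D], of F P L] f_word_form(3)[OF D] unfolding f_word_form(1)[OF D] by simp
  have h: "cyclic_sum (ends_weight F P L) (h_word D k) = F k + P k" if "3 \<le> k" "k \<le> D" for F P :: "nat \<Rightarrow> 'k" and L k
    using val[OF _ h_word_form(2)[OF that], of F P L] h_word_form(3)[OF that] unfolding h_word_form(1)[OF that] by simp
  have x: "cyclic_sum (ends_weight F P L) [2, 1, 4, 3] = F 2 + P 2" if "d = 3" for F P :: "nat \<Rightarrow> 'k" and L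
  proof -
    have "mset ([2] @ [4, 3]) = mset (letter_run 2 D)"
      using that by (simp add: D_def letter_run_def upt_conv_Cons add_mset_commute)
    from val[OF _ this, of F P L] show ?thesis by simp
  qed
  have u: "u \<noteq> []" "0 \<notin> set u" if "u \<in> B_lin d" for u
  proof -
    have "mset u = mset (letter_run 1 d)" by (rule B_lin_mset[OF step.hyps(1) that])
    then have "set u = set (letter_run 1 d)" by (metis set_mset_mset)
    then show "u \<noteq> []" "0 \<notin> set u" using step.hyps(1) by (auto simp: letter_run_def)
  qed
  have one: "cyclic_sum (ends_weight F P L) b = 0" if b: "b \<in> front" for F P :: "nat \<Rightarrow> 'k" and L b
  proof -
    obtain v where v: "v \<in> B_lin d" "b = 1 # map Suc v" using b unfolding front_def by blast
    show ?thesis unfolding v(2) using u[OF v(1)] by (intro cyclic_sum_ends_front) auto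
  qed
  have extra: "cyclic_sum (ends_weight F P L) b = F 2 + P 2" if "b \<in> extra" for F P :: "nat \<Rightarrow> 'k" and L b
    using that e[of 2 F P L] x[of F P L] D by (auto simp: extra_def split: if_splits)
  have new_cases: thesis if "b \<in> new" "\<And>k. 3 \<le> k \<Longrightarrow> k \<le> D \<Longrightarrow> b = e_word D k \<Longrightarrow> thesis"
    "b = f_word D \<Longrightarrow> thesis" "\<And>k. 3 \<le> k \<Longrightarrow> k \<le> D \<Longrightarrow> b = h_word D k \<Longrightarrow> thesis" for b thesis
    using that by (auto simp: new_def)
  have zero_outside: "cyclic_sum (ends_weight F P L) b = 0" if "b \<in> extra \<union> front" "F 2 + P 2 = 0"
    for F P :: "nat \<Rightarrow> 'k" and L b
    using that one extra by auto
  define ind where "ind k i = (if i = k then 1 else (0::'k))" for k i :: nat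
  have new_dual: "\<exists>F P L. F 2 + P 2 = 0 \<and> cyclic_sum (ends_weight F P (L :: 'k)) b = 1 \<and>
        (\<forall>b' \<in> new. b' \<noteq> b \<longrightarrow> cyclic_sum (ends_weight F P L) b' = 0)"
    if b_new: "b \<in> new" for b
    proof (rule new_cases[OF b_new])
      fix k assume k: "3 \<le> k" "k \<le> D" and b: "b = e_word D k"
      show ?thesis
      proof (cases "k = D")
        case True
        show ?thesis
          by (rule exI[of _ "\<lambda>_. 0"], rule exI[of _ "\<lambda>_. 0"], rule exI[of _ 1])
            (use True k b in \<open>auto simp: e f h elim!: new_cases\<close>)
      next
        case False
        show ?thesis
          by (rule exI[of _ "ind k"], rule exI[of _ "ind k"], rule exI[of _ 0])
            (use False k b in \<open>auto simp: e f h ind_def add_self elim!: new_cases simp del: one_add_one\<close>)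
      qed
    next
      assume b: "b = f_word D"
      show ?thesis
        by (rule exI[of _ "ind D"], rule exI[of _ "ind D"], rule exI[of _ 1])
          (use D b in \<open>auto simp: e f h ind_def add_self elim!: new_cases simp del: one_add_one\<close>)
    next
      fix k assume k: "3 \<le> k" "k \<le> D" and b: "b = h_word D k"
      show ?thesis
        by (rule exI[of _ "ind k"], rule exI[of _ "\<lambda>_. 0"], rule exI[of _ 0])
          (use k b in \<open>auto simp: e f h ind_def elim!: new_cases\<close>)
    qed
  have sep_new: "separated TYPE('k) new (new \<union> (extra \<union> front))"
    unfolding separated_def
  proof
    fix b assume "b \<in> new"
    then obtain F P L where FPL: "F 2 + P 2 = 0" "cyclic_sum (ends_weight F P (L :: 'k)) b = 1"
        "\<forall>b' \<in> new. b' \<noteq> b \<longrightarrow> cyclic_sum (ends_weight F P L) b' = 0" using new_dual by blast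
    then show "\<exists>g :: nat \<Rightarrow> nat \<Rightarrow> 'k. cyclic_sum g b = 1 \<and>
        (\<forall>b' \<in> new \<union> (extra \<union> front). b' \<noteq> b \<longrightarrow> cyclic_sum g b' = 0)"
      using zero_outside[where F = F and P = P and L = L] by (intro exI[of _ "ends_weight F P L"]) blast
  qed
  have front_front: "separated TYPE('k) front front"
    unfolding separated_def
  proof
    fix b assume "b \<in> front"
    then obtain u where ub: "u \<in> B_lin d" "b = 1 # map Suc u" by (auto simp: front_def)
    then obtain g :: "nat \<Rightarrow> nat \<Rightarrow> 'k" where g: "cyclic_sum g u = 1"
      "\<And>u'. u' \<in> B_lin d \<Longrightarrow> u' \<noteq> u \<Longrightarrow> cyclic_sum g u' = 0"
      using step.IH unfolding separated_def by blast
    show "\<exists>g :: nat \<Rightarrow> nat \<Rightarrow> 'k. cyclic_sum g b = 1 \<and> (\<forall>b' \<in> front. b' \<noteq> b \<longrightarrow> cyclic_sum g b' = 0)"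
    proof (intro exI conjI ballI impI)
      show "cyclic_sum (\<lambda>i j. if i = 0 \<or> j = 1 then 0 else g (i - 1) (j - 1)) b = 1"
        unfolding ub(2) cyclic_sum_lift[OF u[OF ub(1)]] by (rule g)
      fix b' assume "b' \<in> front" "b' \<noteq> b"
      then obtain u' where u': "u' \<in> B_lin d" "b' = 1 # map Suc u'" "u' \<noteq> u" using ub(2) by (auto simp: front_def)
      show "cyclic_sum (\<lambda>i j. if i = 0 \<or> j = 1 then 0 else g (i - 1) (j - 1)) b' = 0"
        unfolding u'(2) cyclic_sum_lift[OF u[OF u'(1)]] by (rule g(2)[OF u'(1,3)])
    qed
  qed
  define E :: "nat \<Rightarrow> nat \<Rightarrow> 'k" where "E = (\<lambda>i j. adjacent 2 3 i j + adjacent 3 4 i j + adjacent 4 2 i j)"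
  define T :: "nat \<Rightarrow> nat \<Rightarrow> 'k" where "T = ends_weight (\<lambda>_. 0) (\<lambda>i. if i = 2 then 1 else 0) 0"
  have sep_extra: "separated TYPE('k) extra (extra \<union> front)"
  proof (cases "d = 3")
    case False
    then show ?thesis
      unfolding separated_def using one extra by (auto simp: extra_def intro!: exI[of _ T] simp: T_def)
  next
    case True
    have e2: "e_word D 2 = [2, 1, 3, 4]"
      using True by (simp add: D_def e_word_def letter_run_def upt_conv_Cons)
    have front3: "front = {[1, 2, 3, 4], [1, 2, 4, 3], [1, 3, 2, 4], [1, 3, 4, 2], [1, 4, 2, 3]}"
      unfolding front_def True B_lin_3 by (simp add: eval_nat_numeral)
    have E: "cyclic_sum E b = 0" if "b \<in> front" for b
      using that by (auto simp: front3 cyclic_sum_def E_def adjacent_def add_self simp del: one_add_one)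
    have E': "cyclic_sum E [2, 1, 3, 4] = 1" "cyclic_sum E [2, 1, 4, 3] = 0"
      by (simp_all add: cyclic_sum_def E_def adjacent_def)
    have T: "cyclic_sum T b = 0" if "b \<in> front" for b using one that by (simp add: T_def)
    have T': "cyclic_sum T [2, 1, 3, 4] = 1" "cyclic_sum T [2, 1, 4, 3] = 1"
      using e[of 2 "\<lambda>_. 0" "\<lambda>i. if i = 2 then 1 else 0" 0] x[OF True, of "\<lambda>_. 0" "\<lambda>i. if i = 2 then 1 else 0" 0] D e2
      by (simp_all add: T_def)
    have ex: "extra = {[2, 1, 3, 4], [2, 1, 4, 3]}" using True e2 by (auto simp: extra_def)
    show ?thesis
      unfolding separated_def ex
    proof (intro ballI)
      fix b :: "nat list" assume "b \<in> {[2, 1, 3, 4], [2, 1, 4, 3]}"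
      then consider "b = [2, 1, 3, 4]" | "b = [2, 1, 4, 3]" by blast
      then show "\<exists>g :: nat \<Rightarrow> nat \<Rightarrow> 'k. cyclic_sum g b = 1 \<and>
          (\<forall>b' \<in> {[2, 1, 3, 4], [2, 1, 4, 3]} \<union> front. b' \<noteq> b \<longrightarrow> cyclic_sum g b' = 0)"
      proof cases
        case 1
        then show ?thesis using E E' by (intro exI[of _ E]) auto
      next
        case 2
        then show ?thesis using E E' T T'
          by (intro exI[of _ "\<lambda>i j. E i j + T i j"]) (auto simp: cyclic_sum_add add_self simp del: one_add_one)
      qed
    qed
  qed
  have hd_front: "hd b = 1" if "b \<in> front" for b using that by (auto simp: front_def)
  have hd_extra: "hd b = 2" if "b \<in> extra" for b
  proof -
    have "hd (e_word D 2) = 2" by (simp add: e_word_def letter_run_def)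
    then show ?thesis using that by (auto simp: extra_def split: if_splits)
  qed
  have "extra \<inter> front = {}" using hd_front hd_extra by force
  then have sep2: "separated TYPE('k) (extra \<union> front) (extra \<union> front)"
    using sep_extra front_front by (intro separated_Un) (simp_all add: extra_def)
  have disjoint: "new \<inter> (extra \<union> front) = {}"
  proof (rule ccontr)
    assume "new \<inter> (extra \<union> front) \<noteq> {}"
    then obtain b where b: "b \<in> new" "b \<in> extra \<union> front" by blast
    obtain F P L where "F 2 + P 2 = 0" "cyclic_sum (ends_weight F P (L :: 'k)) b = 1"
      using new_dual[OF b(1)] by blast
    then show False using zero_outside[OF b(2), of F P L] by simp
  qed
  have "finite new" by (simp add: new_def)
  then show ?case
    unfolding D_def[symmetric] B using separated_Un[OF _ disjoint sep_new sep2] by blast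
qed

section \<open>Components with at most three equal letters\<close>

lemma perms2: "mset w = {#a, b#} \<Longrightarrow> w \<in> {[a, b], [b, a]}"
proof -
  assume w: "mset w = {#a, b#}"
  then have "length w = 2" by (metis size_mset size_add_mset size_empty numeral_2_eq_2)
  then obtain i j where "w = [i, j]" by (auto simp: length_Suc_conv numeral_2_eq_2)
  with w show ?thesis by (auto simp: add_eq_conv_ex)
qed

context nil_char2
begin

lemma span_211:
  assumes "lam [1, 1, 2, 3] = 0" "lam [1, 1, 3, 2] = 0" "lam [2, 1, 1, 3] = 0" "lam [2, 3, 1, 1] = 0"
    "lam [3, 2, 1, 1] = 0" and w: "mset w = {#1, 1, 2, 3#}"
  shows "lam w = 0"
proof (rule square_reduction[of 1])
  have last: "lam [3, 1, 1, 2] = 0"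
    using S3[of "[1, 1]" "[2]" "[3]" "[]" "[]"] assms by simp
  fix p q assume "add_mset 1 (add_mset 1 (mset (p @ q))) = mset w"
  then have "p @ q \<in> {[2, 3], [3, 2]}" using w by (intro perms2) simp
  then show "lam (p @ 1 # 1 # q) = 0"
    using last assms by (auto simp: append_eq_Cons_conv)
qed (simp add: w)

lemma span_21:
  assumes "lam [1, 1, 2] = 0" "lam [2, 1, 1] = 0" and w: "mset w = {#1, 1, 2#}"
  shows "lam w = 0"
proof (rule square_reduction[of 1])
  fix p q assume "add_mset 1 (add_mset 1 (mset (p @ q))) = mset w"
  then have "mset (p @ q) = {#2#}" using w by simp
  then have "p @ q = [2]" by (simp only: mset_single_iff)
  then show "lam (p @ 1 # 1 # q) = 0"
    using assms by (auto simp: append_eq_Cons_conv)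
qed (simp add: w)

lemma span_22:
  assumes "lam [1, 1, 2, 2] = 0" "lam [2, 2, 1, 1] = 0" and w: "mset w = {#1, 1, 2, 2#}"
  shows "lam w = 0"
proof (rule square_reduction[of 1])
  have mid: "lam [2, 1, 1, 2] = 0"
    using quad_letter[of "[1, 1]" "[]" 2 "[]"] assms by simp
  fix p q assume "add_mset 1 (add_mset 1 (mset (p @ q))) = mset w"
  then have "p @ q \<in> {[2, 2], [2, 2]}" using w by (intro perms2) simp
  then show "lam (p @ 1 # 1 # q) = 0"
    using mid assms by (auto simp: append_eq_Cons_conv)
qed (simp add: w)

lemma span_31:
  assumes "lam [1, 1, 2, 1] = 0" and w: "mset w = {#1, 1, 1, 2#}"
  shows "lam w = 0"
proof (rule three_reduction[of 1])
  fix p c q assume c: "c \<noteq> []" "add_mset 1 (add_mset 1 (add_mset 1 (mset (p @ c @ q)))) = mset w"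
  then have "mset (p @ c @ q) = {#2#}" using w by simp
  then have "p @ c @ q = [2]" by (simp only: mset_single_iff)
  then show "lam (p @ 1 # 1 # c @ 1 # q) = 0"
    using assms c(1) by (auto simp: append_eq_Cons_conv)
qed (simp add: w)

lemma span_32:
  assumes base: "lam [1, 1, 2, 2, 1] = 0" and w: "mset w = {#1, 1, 1, 2, 2#}"
  shows "lam w = 0"
proof (rule three_reduction[of 1])
  have 1: "lam [1, 1, 2, 1, 2] = 0"
    using square_swap[of "[1]" "[2]" "[1]" "[2]" "[]" "[]"] base by simp
  have 2: "lam [2, 1, 1, 2, 1] = 0"
    using quad_letter[of "[1, 1]" "[]" 2 "[1]"] base cube_letter[of "[2, 2]" 1 "[]"] by simp
  fix p c q assume c: "c \<noteq> []" "add_mset 1 (add_mset 1 (add_mset 1 (mset (p @ c @ q)))) = mset w"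
  then have "p @ c @ q \<in> {[2, 2], [2, 2]}" using w by (intro perms2) simp
  then have "p @ c @ q = [2, 2]" by simp
  then show "lam (p @ 1 # 1 # c @ 1 # q) = 0"
    using 1 2 base c(1) by (auto simp: append_eq_Cons_conv)
qed (simp add: w)

lemma span_311:
  assumes base: "lam [1, 1, 2, 3, 1] = 0" "lam [1, 1, 3, 2, 1] = 0" and w: "mset w = {#1, 1, 1, 2, 3#}"
  shows "lam w = 0"
proof (rule three_reduction[of 1])
  have 1: "lam [1, 1, i, 1, j] = 0" and 2: "lam [j, 1, 1, i, 1] = 0"
    if ij: "lam [1, 1, i, j, 1] = 0" "lam [1, 1, j, i, 1] = 0" for i j
  proof -
    show "lam [1, 1, i, 1, j] = 0"
      using square_swap[of "[1]" "[i]" "[1]" "[j]" "[]" "[]"] ij by simp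
    have "lam [1, j, i, 1, 1] = 0"
      using quad_letter[of "[j, i]" "[]" 1 "[1]"] cube_letter[of "[j, i]" 1 "[]"] ij by simp
    then have "lam [j, 1, i, 1, 1] = 0"
      using square_perm_left[of "[1]" "[j, 1, i]" "[1, j, i]" "[]"] by (simp add: add_mset_commute)
    then show "lam [j, 1, 1, i, 1] = 0"
      using quad_letter[of "[i]" "[j]" 1 "[1]"] cube_letter[of "[j, i]" 1 "[]"] by simp
  qed
  fix p c q assume c: "c \<noteq> []" "add_mset 1 (add_mset 1 (add_mset 1 (mset (p @ c @ q)))) = mset w"
  then have "p @ c @ q \<in> {[2, 3], [3, 2]}" using w by (intro perms2) simp
  then consider "p @ c @ q = [2, 3]" | "p @ c @ q = [3, 2]" by blast
  then show "lam (p @ 1 # 1 # c @ 1 # q) = 0"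
    using 1[of 2 3] 1[of 3 2] 2[of 2 3] 2[of 3 2] base c(1)
    by cases (auto simp: append_eq_Cons_conv)
qed (simp add: w)

lemma span_221:
  assumes base: "lam [1, 1, 2, 2, 3] = 0" "lam [2, 2, 1, 1, 3] = 0" "lam [3, 1, 1, 2, 2] = 0"
    and w: "mset w = {#1, 1, 2, 2, 3#}"
  shows "lam w = 0"
proof (rule square_reduction[of 1])
  have 1: "lam [1, 1, 2, 3, 2] = 0"
    using square_swap[of "[1]" "[2]" "[3]" "[2]" "[]" "[]"] base by simp
  have 2: "lam [1, 1, 3, 2, 2] = 0"
    using quad_letter[of "[3]" "[1, 1]" 2 "[]"] base 1 by simp
  have 3: "lam [2, 3, 2, 1, 1] = lam [3, 2, 2, 1, 1]"
    using square_perm_left[of "[1]" "[2, 3, 2]" "[3, 2, 2]" "[]"] by (simp add: add_mset_commute)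
  then have 4: "lam [2, 2, 3, 1, 1] = 0"
    using quad_letter[of "[3]" "[]" 2 "[1, 1]"] by simp
  have 5: "lam [3, 2, 2, 1, 1] = 0"
    using S3[of "[1, 1]" "[2, 2]" "[3]" "[]" "[]"] base 2 4 by simp
  have 6: "lam [2, 1, 1, 2, 3] = 0" "lam [2, 1, 1, 3, 2] = 0"
    using quad_letter[of "[1, 1]" "[]" 2 "[3]"] quad_letter[of "[1, 1, 3]" "[]" 2 "[]"] base 2 by simp_all
  have 7: "lam [2, 3, 1, 1, 2] = 0" "lam [3, 2, 1, 1, 2] = 0"
    using quad_letter[of "[3, 1, 1]" "[]" 2 "[]"] quad_letter[of "[1, 1]" "[3]" 2 "[]"] base 4 5 by simp_all
  fix p q assume "add_mset 1 (add_mset 1 (mset (p @ q))) = mset w"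
  then have "p @ q \<in> {[2, 2, 3], [2, 3, 2], [2, 2, 3], [2, 3, 2], [3, 2, 2], [3, 2, 2]}"
    using w by (intro perms3) simp
  then consider "p @ q = [2, 2, 3]" | "p @ q = [2, 3, 2]" | "p @ q = [3, 2, 2]" by blast
  then show "lam (p @ 1 # 1 # q) = 0"
    using 1 2 3 4 5 6 7 base by cases (auto simp: append_eq_Cons_conv)
qed (simp add: w)

end

lemma content_ones: "content_from i (replicate n 1) = mset [i..<i + n]"
  by (induction n arbitrary: i) (simp_all add: upt_conv_Cons del: upt_Suc)

lemma count_upt: "count (mset [i..<j]) k \<le> 1"
  by (metis count_mset_0_iff distinct_count_atmost_1 distinct_upt le_numeral_extra(4) zero_le_one)

lemma replicate_mset_2: "replicate_mset 2 x = {#x, x#}"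
  by (simp add: eval_nat_numeral)

context
  fixes K :: "'k::field itself"
  assumes inf: "infinite (UNIV :: 'k set)" and two: "(1::'k) + 1 = 0"
begin

interpretation char2 "TYPE('k)" by standard (rule two)

lemma nil_char2I: "nil_functional (lam :: nat list \<Rightarrow> 'k) \<Longrightarrow> nil_char2 lam"
  by (intro nil_char2.intro S3_char2.intro char2_axioms) (simp_all add: nil_functional_def)

lemma cyclic_dual:
  assumes nil: "nil_functional (\<lambda>w. if mset w = D then esum g (0 # w @ [0]) else (0::'k))"
    and B: "\<And>b. b \<in> B \<Longrightarrow> mset b = D" "b \<in> B"
    and sep: "cyclic_sum g b = 1" "\<And>b'. b' \<in> B \<Longrightarrow> b' \<noteq> b \<Longrightarrow> cyclic_sum g b' = 0"
  shows "\<exists>lam :: nat list \<Rightarrow> 'k. nil_functional lam \<and> lam b \<noteq> 0 \<and> (\<forall>b' \<in> B. b' \<noteq> b \<longrightarrow> lam b' = 0)"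
  using assms by (intro exI[of _ "\<lambda>w. if mset w = D then esum g (0 # w @ [0]) else 0"])
    (auto simp: cyclic_sum_def)

text \<open>The form of the criterion in which all separating functionals are weights of adjacent pairs.\<close>

lemma basis_by_cyclic_sums:
  assumes d: "length ds = d" and B: "finite B" "\<And>b. b \<in> B \<Longrightarrow> b \<noteq> [] \<and> mset b = content ds"
    and span: "\<And>(lam :: nat list \<Rightarrow> 'k) w. nil_char2 lam \<Longrightarrow> \<forall>b \<in> B. lam b = 0 \<Longrightarrow>
      mset w = content ds \<Longrightarrow> lam w = 0"
    and nil: "\<And>g. g \<in> G \<Longrightarrow> nil_functional (\<lambda>w. if mset w = content ds then esum g (0 # w @ [0]) else (0::'k))"
    and sep: "\<And>b. b \<in> B \<Longrightarrow> \<exists>g \<in> G. cyclic_sum g b = 1 \<and> (\<forall>b' \<in> B. b' \<noteq> b \<longrightarrow> cyclic_sum g b' = 0)"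
  shows "is_comp_basis TYPE('k) d ds B"
proof (rule basis_criterion[OF inf d B(1)])
  show "b \<noteq> [] \<and> mset b = content ds" if "b \<in> B" for b using B(2)[OF that] .
  show "lam w = 0" if "nil_functional lam" "\<forall>b \<in> B. lam b = 0" "mset w = content ds"
    for lam :: "nat list \<Rightarrow> 'k" and w using span[OF nil_char2I] that by blast
  fix b assume b: "b \<in> B"
  then obtain g where g: "g \<in> G" "cyclic_sum g b = 1" "\<forall>b' \<in> B. b' \<noteq> b \<longrightarrow> cyclic_sum g b' = 0"
    using sep by blast
  show "\<exists>lam :: nat list \<Rightarrow> 'k. nil_functional lam \<and> lam b \<noteq> 0 \<and> (\<forall>b' \<in> B. b' \<noteq> b \<longrightarrow> lam b' = 0)"
    using B(2) g b by (intro cyclic_dual[OF nil[OF g(1)]]) auto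
qed

lemma zero_basis:
  assumes "length ds = d" "\<And>(lam :: nat list \<Rightarrow> 'k) w. nil_char2 lam \<Longrightarrow> mset w = content ds \<Longrightarrow> lam w = 0"
  shows "is_comp_basis TYPE('k) d ds {}"
  using assms by (intro basis_by_cyclic_sums[where G = "{}"]) auto

theorem multilinear_basis:
  assumes "4 \<le> d"
  shows "is_comp_basis TYPE('k) d (replicate d 1) (B_lin d)"
proof (rule basis_by_cyclic_sums[where G = UNIV])
  have content: "content (replicate d 1) = mset [1..<Suc d]" using content_ones[of 1 d] by simp
  show "b \<noteq> [] \<and> mset b = content (replicate d 1)" if "b \<in> B_lin d" for b
  proof -
    have "mset b = mset [1..<Suc d]" using B_lin_mset[OF _ that] assms by (simp add: letter_run_def del: upt_Suc mset_upt)
    then show ?thesis using assms content by auto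
  qed
  show "lam w = 0" if "nil_char2 lam" "\<forall>b \<in> B_lin d. lam b = 0" "mset w = content (replicate d 1)"
    for lam :: "nat list \<Rightarrow> 'k" and w
    using span_B_lin[of d lam w] that assms content by simp
  show "nil_functional (\<lambda>w. if mset w = content (replicate d 1) then esum g (0 # w @ [0]) else (0::'k))" for g
    unfolding content by (rule nil_distinct) (rule count_upt)
  show "\<exists>g \<in> UNIV. cyclic_sum g b = (1::'k) \<and> (\<forall>b' \<in> B_lin d. b' \<noteq> b \<longrightarrow> cyclic_sum g b' = 0)" if "b \<in> B_lin d" for b
    using B_lin_separated[of d] assms that unfolding separated_def by auto
qed (simp_all add: finite_B_lin)

text \<open>The numbers of pairs \<open>1 2\<close> and \<open>2 1\<close> distinguish the two orders of the squares.\<close>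

theorem two_squares_basis:
  assumes "4 \<le> d"
  shows "is_comp_basis TYPE('k) d (2 # 2 # replicate (d - 2) 1)
    {[1, 1, 2, 2] @ letter_run 3 d, [2, 2, 1, 1] @ letter_run 3 d}"
proof (rule basis_by_cyclic_sums[where G = "{adjacent 1 2, adjacent 2 1}"])
  define N where "N = mset (letter_run 3 d)"
  have "3 + (d - 2) = Suc d" using assms by linarith
  then have "content_from 3 (replicate (d - 2) 1) = N"
    unfolding content_ones N_def letter_run_def by (simp only:)
  moreover have "Suc 1 = 2" "Suc 2 = 3" by simp_all
  ultimately have content: "content (2 # 2 # replicate (d - 2) 1) = {#1, 1, 2, 2#} + N"
    by (simp only: content_from.simps replicate_mset_2) simp
  have N: "size N = d - 2" "set_mset N = {3..d}" "\<And>i. count N i \<le> 1"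
    using count_upt assms by (simp_all add: N_def letter_run_def atLeastLessThanSuc_atLeastAtMost del: upt_Suc mset_upt)
  show "length (2 # 2 # replicate (d - 2) 1) = d" using assms by simp
  show "b \<noteq> [] \<and> mset b = content (2 # 2 # replicate (d - 2) 1)"
    if "b \<in> {[1, 1, 2, 2] @ letter_run 3 d, [2, 2, 1, 1] @ letter_run 3 d}" for b
    using that unfolding content N_def by (auto simp: add_mset_commute)
  show "lam w = 0" if "nil_char2 lam"
      "\<forall>b \<in> {[1, 1, 2, 2] @ letter_run 3 d, [2, 2, 1, 1] @ letter_run 3 d}. lam b = 0"
      "mset w = content (2 # 2 # replicate (d - 2) 1)" for lam :: "nat list \<Rightarrow> 'k" and w
    using that N assms unfolding content
    by (intro nil_char2.span_two_twos[of lam N 2 "letter_run 3 d" 1 w]) (auto simp: N_def)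
  have doubles: "count ({#1, 1, 2, 2#} + N) 1 = 2" "count ({#1, 1, 2, 2#} + N) 2 = 2"
    "\<And>i. i \<noteq> 1 \<Longrightarrow> i \<noteq> 2 \<Longrightarrow> count ({#1, 1, 2, 2#} + N) i \<le> 1"
    using N(2,3) by (auto simp: count_eq_zero_iff)
  show "nil_functional (\<lambda>w. if mset w = content (2 # 2 # replicate (d - 2) 1) then esum g (0 # w @ [0]) else (0::'k))"
    if "g \<in> {adjacent 1 2, adjacent 2 1}" for g
    using that nil_two_doubles[OF doubles] nil_two_doubles[OF doubles(2,1) doubles(3)] unfolding content
    by (auto simp del: One_nat_def)
  have run: "letter_run 3 d = 3 # letter_run 4 d" using assms by (simp add: letter_run_def upt_conv_Cons del: upt_Suc)
  have rest: "esum (adjacent a b) (3 # letter_run 4 d @ [0]) = (0::'k)" if "{a, b} = {1, 2}" for a b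
    using that by (intro esum_zero) (auto simp: adjacent_def letter_run_def doubleton_eq_iff)
  have vals: "cyclic_sum (adjacent 1 2) ([1, 1, 2, 2] @ letter_run 3 d) = (1::'k)"
    "cyclic_sum (adjacent 1 2) ([2, 2, 1, 1] @ letter_run 3 d) = (0::'k)"
    "cyclic_sum (adjacent 2 1) ([1, 1, 2, 2] @ letter_run 3 d) = (0::'k)"
    "cyclic_sum (adjacent 2 1) ([2, 2, 1, 1] @ letter_run 3 d) = (1::'k)"
    using rest[of 1 2] rest[of 2 1] unfolding run cyclic_sum_def by (auto simp: adjacent_def)
  show "\<exists>g \<in> {adjacent 1 2, adjacent 2 1}. cyclic_sum g b = (1::'k) \<and>
      (\<forall>b' \<in> {[1, 1, 2, 2] @ letter_run 3 d, [2, 2, 1, 1] @ letter_run 3 d}. b' \<noteq> b \<longrightarrow> cyclic_sum g b' = 0)"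
    if "b \<in> {[1, 1, 2, 2] @ letter_run 3 d, [2, 2, 1, 1] @ letter_run 3 d}" for b
    using that vals by auto
qed simp

text \<open>The parity of the number of adjacent pairs of the repeated letter is a nonzero functional.\<close>

theorem cube_basis:
  assumes "4 \<le> d"
  shows "is_comp_basis TYPE('k) d (3 # replicate (d - 1) 1) {[1, 1] @ letter_run 2 d @ [1]}"
proof (rule basis_by_cyclic_sums[where G = "{adjacent 1 1}"])
  define N where "N = mset (letter_run 2 d)"
  have "content_from 2 (replicate (d - 1) 1) = N"
    unfolding content_ones N_def letter_run_def using assms by (simp del: upt_Suc mset_upt)
  then have content: "content (3 # replicate (d - 1) 1) = {#1, 1, 1#} + N"
    by (simp add: numeral_2_eq_2 numeral_3_eq_3)
  have N: "size N = d - 1" "set_mset N = {2..d}" "\<And>i. count N i \<le> 1"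
    using count_upt assms by (simp_all add: N_def letter_run_def atLeastLessThanSuc_atLeastAtMost del: upt_Suc mset_upt)
  show "length (3 # replicate (d - 1) 1) = d" using assms by simp
  show "b \<noteq> [] \<and> mset b = content (3 # replicate (d - 1) 1)" if "b \<in> {[1, 1] @ letter_run 2 d @ [1]}" for b
    using that unfolding content N_def by auto
  show "lam w = 0" if "nil_char2 lam" "\<forall>b \<in> {[1, 1] @ letter_run 2 d @ [1]}. lam b = 0"
      "mset w = content (3 # replicate (d - 1) 1)" for lam :: "nat list \<Rightarrow> 'k" and w
    using that N assms unfolding content
    by (intro nil_char2.span_three_ones[of lam N 1 "letter_run 2 d" w]) (auto simp: N_def)
  show "nil_functional (\<lambda>w. if mset w = content (3 # replicate (d - 1) 1) then esum g (0 # w @ [0]) else (0::'k))"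
    if "g \<in> {adjacent 1 1}" for g
  proof -
    have "count ({#1, 1, 1#} + N) 1 = 3" "\<And>i. i \<noteq> 1 \<Longrightarrow> count ({#1, 1, 1#} + N) i \<le> 1"
      using N(2,3) by (auto simp: count_eq_zero_iff)
    moreover have "g = adjacent 1 1" using that by simp
    ultimately show ?thesis unfolding content by (simp only:) (rule nil_triple; simp del: One_nat_def)
  qed
  have "esum (adjacent 1 1) (1 # letter_run 2 d @ [1, 0]) = (0::'k)"
  proof -
    have run: "letter_run 2 d \<noteq> []" "1 \<notin> set (letter_run 2 d)" using assms by (auto simp: letter_run_def)
    then obtain r where r: "letter_run 2 d = 2 # r" "1 \<notin> set r"
      using letter_run_ends(2)[of 2 d] assms by (cases "letter_run 2 d") auto
    have "count (mset (2 # r @ [1, 0])) 1 \<le> 1" using r(2) by (simp add: count_eq_zero_iff)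
    from esum_adjacent_self[OF this] show ?thesis unfolding r(1) by (simp add: adjacent_def)
  qed
  then show "\<exists>g \<in> {adjacent 1 1}. cyclic_sum g b = (1::'k) \<and>
      (\<forall>b' \<in> {[1, 1] @ letter_run 2 d @ [1]}. b' \<noteq> b \<longrightarrow> cyclic_sum g b' = 0)"
    if "b \<in> {[1, 1] @ letter_run 2 d @ [1]}" for b
    using that by (simp add: cyclic_sum_def adjacent_def)
qed simp

end

lemma nil_check_eps: "list_all (nil_check eps) (arrangements (length [1, 1, 2, 3, 4]) [1, 1, 2, 3, 4])"
  by code_simp

lemma eps_values:
  "\<not> eps [1, 1, 2, 3, 4]" "\<not> eps [1, 1, 3, 2, 4]" "\<not> eps [1, 1, 4, 2, 3]"
  "\<not> eps [3, 4, 2, 1, 1]" "\<not> eps [2, 4, 3, 1, 1]" "\<not> eps [2, 3, 4, 1, 1]"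
  "eps [2, 1, 1, 3, 4]" "\<not> eps [3, 1, 1, 2, 4]"
  by code_simp+

lemma a_word_form:
  assumes "2 \<le> i" "i \<le> d"
  shows "a_word d i = [] @ 1 # 1 # i # removeAll i (letter_run 2 d)"
    "mset ([] @ i # removeAll i (letter_run 2 d)) = mset (letter_run 2 d)"
proof -
  have "i \<in># mset (letter_run 2 d)" using assms by (auto simp: letter_run_def)
  then show "mset ([] @ i # removeAll i (letter_run 2 d)) = mset (letter_run 2 d)"
    by (simp add: mset_removeAll_run)
qed (simp add: a_word_def)

lemma b_word_form:
  assumes "2 \<le> i" "i \<le> d"
  shows "b_word d i = (removeAll i (letter_run 2 d) @ [i]) @ 1 # 1 # []"
    "mset ((removeAll i (letter_run 2 d) @ [i]) @ []) = mset (letter_run 2 d)"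
  using a_word_form(2)[OF assms] by (simp_all add: b_word_def)

lemma c_word_form:
  assumes "2 \<le> i" "i \<le> d" "2 \<le> j" "j \<le> d" "i \<noteq> j"
  shows "c_word d i j = [i] @ 1 # 1 # j # removeAll i (removeAll j (letter_run 2 d))"
    "mset ([i] @ j # removeAll i (removeAll j (letter_run 2 d))) = mset (letter_run 2 d)"
proof -
  have rem: "mset (removeAll i (removeAll j (letter_run 2 d))) = mset (letter_run 2 d) - {#j#} - {#i#}"
  proof -
    have "removeAll i (removeAll j (letter_run 2 d)) = remove1 i (removeAll j (letter_run 2 d))"
      by (intro distinct_remove1_removeAll[symmetric] distinct_removeAll) (simp add: letter_run_def)
    then show ?thesis by (simp add: mset_removeAll_run)
  qed
  have "j \<in># mset (letter_run 2 d)" "i \<in># mset (letter_run 2 d) - {#j#}"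
    using assms by (auto simp: letter_run_def in_diff_count)
  then show "mset ([i] @ j # removeAll i (removeAll j (letter_run 2 d))) = mset (letter_run 2 d)"
    by (simp only: append_Cons append_Nil mset.simps rem add_mset_commute[of i j] insert_DiffM)
qed (simp add: c_word_def)

context
  fixes K :: "'k::field itself"
  assumes inf: "infinite (UNIV :: 'k set)" and two: "(1::'k) + 1 = 0"
begin

interpretation char2 "TYPE('k)" by standard (rule two)

lemma letter_run_2: "size (mset (letter_run 2 d)) = d - 1" "set_mset (mset (letter_run 2 d)) = {2..d}"
  "count (mset (letter_run 2 d)) i \<le> 1"
proof -
  show "count (mset (letter_run 2 d)) i \<le> 1" unfolding letter_run_def by (rule count_upt)
qed (auto simp: letter_run_def)

lemma content_double:
  assumes "1 \<le> d"
  shows "content (2 # replicate (d - 1) 1) = {#1, 1#} + mset (letter_run 2 d)"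
proof -
  have "content_from 2 (replicate (d - 1) 1) = mset (letter_run 2 d)"
    unfolding content_ones letter_run_def using assms by (simp del: upt_Suc mset_upt)
  then show ?thesis by (simp add: numeral_2_eq_2)
qed

lemma double_words_functional:
  fixes r s :: "nat \<Rightarrow> 'k"
  obtains lam where "nil_functional lam"
    "\<And>i. 2 \<le> i \<Longrightarrow> i \<le> d \<Longrightarrow> lam (a_word d i) = r 0 + s i"
    "\<And>i. 2 \<le> i \<Longrightarrow> i \<le> d \<Longrightarrow> lam (b_word d i) = r i + s 0"
    "\<And>i j. 2 \<le> i \<Longrightarrow> i \<le> d \<Longrightarrow> 2 \<le> j \<Longrightarrow> j \<le> d \<Longrightarrow> i \<noteq> j \<Longrightarrow> lam (c_word d i j) = r i + s j"
proof -
  obtain lam where lam: "nil_functional lam"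
    "\<And>p q. mset (p @ q) = mset (letter_run 2 d) \<Longrightarrow> lam (p @ 1 # 1 # q) = r (last (0 # p)) + s (hd (q @ [0]))"
    using double_functional[of "mset (letter_run 2 d)" 1 r s] letter_run_2 by auto
  show ?thesis
  proof (rule that[OF lam(1)])
    show "lam (a_word d i) = r 0 + s i" if "2 \<le> i" "i \<le> d" for i
      using lam(2)[OF a_word_form(2)[OF that]] unfolding a_word_form(1)[OF that] by simp
    show "lam (b_word d i) = r i + s 0" if "2 \<le> i" "i \<le> d" for i
      using lam(2)[OF b_word_form(2)[OF that]] unfolding b_word_form(1)[OF that] by simp
    show "lam (c_word d i j) = r i + s j" if "2 \<le> i" "i \<le> d" "2 \<le> j" "j \<le> d" "i \<noteq> j" for i j
      using lam(2)[OF c_word_form(2)[OF that]] unfolding c_word_form(1)[OF that] by simp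
  qed
qed

lemma double_words_mset:
  assumes "2 \<le> d"
  shows "2 \<le> i \<Longrightarrow> i \<le> d \<Longrightarrow> a_word d i \<noteq> [] \<and> mset (a_word d i) = content (2 # replicate (d - 1) 1)"
    "2 \<le> i \<Longrightarrow> i \<le> d \<Longrightarrow> b_word d i \<noteq> [] \<and> mset (b_word d i) = content (2 # replicate (d - 1) 1)"
    "2 \<le> i \<Longrightarrow> i \<le> d \<Longrightarrow> 2 \<le> j \<Longrightarrow> j \<le> d \<Longrightarrow> i \<noteq> j \<Longrightarrow>
      c_word d i j \<noteq> [] \<and> mset (c_word d i j) = content (2 # replicate (d - 1) 1)"
proof -
  have c: "content (2 # replicate (d - 1) 1) = {#1, 1#} + mset (letter_run 2 d)"
    using assms by (intro content_double) simp
  show "a_word d i \<noteq> [] \<and> mset (a_word d i) = content (2 # replicate (d - 1) 1)" if "2 \<le> i" "i \<le> d"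
    using a_word_form(2)[OF that] unfolding a_word_form(1)[OF that] c by simp
  show "b_word d i \<noteq> [] \<and> mset (b_word d i) = content (2 # replicate (d - 1) 1)" if "2 \<le> i" "i \<le> d"
    using b_word_form(2)[OF that] unfolding b_word_form(1)[OF that] c by simp
  show "c_word d i j \<noteq> [] \<and> mset (c_word d i j) = content (2 # replicate (d - 1) 1)"
    if "2 \<le> i" "i \<le> d" "2 \<le> j" "j \<le> d" "i \<noteq> j"
    using c_word_form(2)[OF that] unfolding c_word_form(1)[OF that] c by (simp add: add_mset_commute)
qed

text \<open>Every choice of one-sided functions \<open>r\<close> and \<open>s\<close> defines a functional; its values on the listed words
  are \<open>r 0 + s i\<close>, \<open>r i + s 0\<close> and \<open>r 2 + s 3\<close>, so each word is isolated by a suitable choice.\<close>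

theorem double_basis:
  assumes d: "5 \<le> d"
  shows "is_comp_basis TYPE('k) d (2 # replicate (d - 1) 1)
    (a_word d ` {2..d} \<union> b_word d ` {2..d} \<union> {c_word d 2 3})"
proof (rule basis_criterion[OF inf])
  let ?B = "a_word d ` {2..d} \<union> b_word d ` {2..d} \<union> {c_word d 2 3}"
  show "length (2 # replicate (d - 1) 1) = d" using d by simp
  show "finite ?B" by simp
  show "b \<noteq> [] \<and> mset b = content (2 # replicate (d - 1) 1)" if "b \<in> ?B" for b
    using that d double_words_mset[of d] by auto
  show "lam w = 0" if lam: "nil_functional lam" "\<forall>b \<in> ?B. lam b = 0" "mset w = content (2 # replicate (d - 1) 1)"
    for lam :: "nat list \<Rightarrow> 'k" and w
  proof (rule nil_char2.span_one_double[OF nil_char2I[OF inf two lam(1)]])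
    show "0 \<notin># mset (letter_run 2 d)" "4 \<le> size (mset (letter_run 2 d))"
      using letter_run_2[of d] d by auto
    show "\<exists>q. mset (i # q) = mset (letter_run 2 d) \<and> lam (1 # 1 # i # q) = 0" if "i \<in># mset (letter_run 2 d)" for i
    proof -
      have i: "2 \<le> i" "i \<le> d" using that letter_run_2(2)[of d] by auto
      then have "lam (a_word d i) = 0" using lam(2) by auto
      then show ?thesis using a_word_form[OF i] by (intro exI[of _ "removeAll i (letter_run 2 d)"]) simp
    qed
    show "\<exists>q. mset (i # q) = mset (letter_run 2 d) \<and> lam (q @ [i, 1, 1]) = 0" if "i \<in># mset (letter_run 2 d)" for i
    proof -
      have i: "2 \<le> i" "i \<le> d" using that letter_run_2(2)[of d] by auto
      then have "lam (b_word d i) = 0" using lam(2) by auto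
      then show ?thesis using b_word_form[OF i] by (intro exI[of _ "removeAll i (letter_run 2 d)"]) simp
    qed
    show "mset (2 # 3 # removeAll 2 (removeAll 3 (letter_run 2 d))) = mset (letter_run 2 d)"
      using c_word_form(2)[of 2 d 3] d by simp
    show "lam (2 # 1 # 1 # 3 # removeAll 2 (removeAll 3 (letter_run 2 d))) = 0"
      using lam(2) c_word_form(1)[of 2 d 3] d by simp
    show "mset w = {#1, 1#} + mset (letter_run 2 d)" using lam(3) content_double[of d] d by simp
  qed
  fix b assume "b \<in> ?B"
  then consider i where "i \<in> {2..d}" "b = a_word d i" | i where "i \<in> {2..d}" "b = b_word d i" | "b = c_word d 2 3" by blast
  then have "\<exists>r s :: nat \<Rightarrow> 'k. \<forall>lam. (\<forall>i \<in> {2..d}. lam (a_word d i) = r 0 + s i \<and> lam (b_word d i) = r i + s 0)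
      \<and> lam (c_word d 2 3) = r 2 + s 3 \<longrightarrow> lam b \<noteq> 0 \<and> (\<forall>b' \<in> ?B. b' \<noteq> b \<longrightarrow> lam b' = 0)"
  proof cases
    case (1 i)
    show ?thesis
    proof (cases "i = 3")
      case True
      show ?thesis
        by (rule exI[of _ "\<lambda>i. if i = 0 then 0 else 1"], rule exI[of _ "\<lambda>j. if j = 0 \<or> j = 3 then 1 else 0"])
          (use 1 True in \<open>auto simp: add_self simp del: one_add_one\<close>)
    next
      case False
      show ?thesis
        by (rule exI[of _ "\<lambda>_. 0"], rule exI[of _ "\<lambda>j. if j = i then 1 else 0"]) (use 1 False in auto)
    qed
  next
    case (2 i)
    show ?thesis
    proof (cases "i = 2")
      case True
      show ?thesis
        by (rule exI[of _ "\<lambda>i. if i = 0 \<or> i = 2 then 1 else 0"], rule exI[of _ "\<lambda>j. if j = 0 then 0 else 1"])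
          (use 2 True in \<open>auto simp: add_self simp del: one_add_one\<close>)
    next
      case False
      show ?thesis
        by (rule exI[of _ "\<lambda>j. if j = i then 1 else 0"], rule exI[of _ "\<lambda>_. 0"]) (use 2 False in auto)
    qed
  next
    case 3
    show ?thesis
      by (rule exI[of _ "\<lambda>i. if i = 0 then 1 else 0"], rule exI[of _ "\<lambda>j. if j = 0 then 0 else 1"])
        (use 3 in \<open>auto simp: add_self simp del: one_add_one\<close>)
  qed
  then obtain r s :: "nat \<Rightarrow> 'k" where rs: "\<And>lam. (\<forall>i \<in> {2..d}. lam (a_word d i) = r 0 + s i \<and> lam (b_word d i) = r i + s 0)
      \<and> lam (c_word d 2 3) = r 2 + s 3 \<Longrightarrow> lam b \<noteq> 0 \<and> (\<forall>b' \<in> ?B. b' \<noteq> b \<longrightarrow> lam b' = 0)" by blast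
  obtain lam where lam: "nil_functional lam"
    "\<And>i. 2 \<le> i \<Longrightarrow> i \<le> d \<Longrightarrow> lam (a_word d i) = r 0 + s i"
    "\<And>i. 2 \<le> i \<Longrightarrow> i \<le> d \<Longrightarrow> lam (b_word d i) = r i + s 0"
    "\<And>i j. 2 \<le> i \<Longrightarrow> i \<le> d \<Longrightarrow> 2 \<le> j \<Longrightarrow> j \<le> d \<Longrightarrow> i \<noteq> j \<Longrightarrow> lam (c_word d i j) = r i + s j"
    using double_words_functional[of d r s] by blast
  have vals: "(\<forall>i \<in> {2..d}. lam (a_word d i) = r 0 + s i \<and> lam (b_word d i) = r i + s 0)
      \<and> lam (c_word d 2 3) = r 2 + s 3"
  proof (intro conjI ballI)
    fix i assume "i \<in> {2..d}"
    then have i: "2 \<le> i" "i \<le> d" by simp_all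
    show "lam (a_word d i) = r 0 + s i" by (rule lam(2)[OF i])
    show "lam (b_word d i) = r i + s 0" by (rule lam(3)[OF i])
  next
    show "lam (c_word d 2 3) = r 2 + s 3" by (rule lam(4)) (use d in simp_all)
  qed
  show "\<exists>lam :: nat list \<Rightarrow> 'k. nil_functional lam \<and> lam b \<noteq> 0 \<and> (\<forall>b' \<in> ?B. b' \<noteq> b \<longrightarrow> lam b' = 0)"
    by (rule exI[of _ lam], rule conjI[OF lam(1) rs[OF vals]])
qed

text \<open>With three further letters there is one more functional, \<open>eps\<close>, which tells the two words with an
  interior square apart; it is added to those coming from one-sided functions.\<close>

theorem double_basis_4:
  "is_comp_basis TYPE('k) 4 [2, 1, 1, 1]
    (a_word 4 ` {2..4} \<union> b_word 4 ` {2..4} \<union> {c_word 4 2 3, c_word 4 3 2})"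
proof (rule basis_criterion[OF inf])
  let ?B = "a_word 4 ` {2..4} \<union> b_word 4 ` {2..4} \<union> {c_word 4 2 3, c_word 4 3 2}"
  have ds: "[2, 1, 1, 1] = 2 # replicate (4 - 1) (1 :: nat)" by (simp add: numeral_3_eq_3)
  have set: "{2..4} = {2, 3, 4 :: nat}" by auto
  have words: "a_word 4 2 = [1, 1, 2, 3, 4]" "a_word 4 3 = [1, 1, 3, 2, 4]" "a_word 4 4 = [1, 1, 4, 2, 3]"
    "b_word 4 2 = [3, 4, 2, 1, 1]" "b_word 4 3 = [2, 4, 3, 1, 1]" "b_word 4 4 = [2, 3, 4, 1, 1]"
    "c_word 4 2 3 = [2, 1, 1, 3, 4]" "c_word 4 3 2 = [3, 1, 1, 2, 4]"
    by (simp_all add: a_word_def b_word_def c_word_def letter_run_def upt_conv_Cons)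
  have content: "content [2, 1, 1, 1] = {#1, 1, 2, 3, 4#}" by (simp add: eval_nat_numeral)
  show "length [2, 1, 1, 1 :: nat] = 4" by simp
  show "finite ?B" by simp
  show "b \<noteq> [] \<and> mset b = content [2, 1, 1, 1]" if "b \<in> ?B" for b
    using that unfolding content set image_insert image_empty words by (auto simp: add_mset_commute)
  show "lam w = 0" if lam: "nil_functional lam" "\<forall>b \<in> ?B. lam b = 0" "mset w = content [2, 1, 1, 1]"
    for lam :: "nat list \<Rightarrow> 'k" and w
    using lam(2,3) unfolding content set image_insert image_empty words
    by (intro nil_char2.span_one_double_small[OF nil_char2I[OF inf two lam(1)], of 1 2 3 4 w]) simp_all
  define lam0 :: "nat list \<Rightarrow> 'k" where
    "lam0 = (\<lambda>w. if mset w = mset [1, 1, 2, 3, 4] then of_bool (eps w) else 0)"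
  have nil0: "nil_functional lam0"
    unfolding lam0_def by (rule nil_check_functional[OF nil_check_eps])
  have val0: "lam0 (a_word 4 2) = 0" "lam0 (a_word 4 3) = 0" "lam0 (a_word 4 4) = 0"
    "lam0 (b_word 4 2) = 0" "lam0 (b_word 4 3) = 0" "lam0 (b_word 4 4) = 0"
    "lam0 (c_word 4 2 3) = 1" "lam0 (c_word 4 3 2) = 0"
    unfolding words lam0_def by (simp_all add: eps_values add_mset_commute del: One_nat_def)
  have functional: "\<exists>lam. nil_functional lam \<and>
      lam (a_word 4 2) = r 0 + s 2 \<and> lam (a_word 4 3) = r 0 + s 3 \<and> lam (a_word 4 4) = r 0 + s 4 \<and>
      lam (b_word 4 2) = r 2 + s 0 \<and> lam (b_word 4 3) = r 3 + s 0 \<and> lam (b_word 4 4) = r 4 + s 0 \<and>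
      lam (c_word 4 2 3) = r 2 + s 3 + of_bool t \<and> lam (c_word 4 3 2) = r 3 + s 2" for r s :: "nat \<Rightarrow> 'k" and t
  proof -
    obtain lam where lam: "nil_functional lam"
      "\<And>i. 2 \<le> i \<Longrightarrow> i \<le> 4 \<Longrightarrow> lam (a_word 4 i) = r 0 + s i"
      "\<And>i. 2 \<le> i \<Longrightarrow> i \<le> 4 \<Longrightarrow> lam (b_word 4 i) = r i + s 0"
      "\<And>i j. 2 \<le> i \<Longrightarrow> i \<le> 4 \<Longrightarrow> 2 \<le> j \<Longrightarrow> j \<le> 4 \<Longrightarrow> i \<noteq> j \<Longrightarrow> lam (c_word 4 i j) = r i + s j"
      using double_words_functional[of 4 r s] by blast
    show ?thesis
    proof (cases t)
      case True
      then show ?thesis using lam val0 by (intro exI[of _ "\<lambda>w. lam w + lam0 w"] conjI nil_add nil0) simp_all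
    next
      case False
      then show ?thesis using lam by (intro exI[of _ lam] conjI) simp_all
    qed
  qed
  fix b assume "b \<in> ?B"
  then consider "b = a_word 4 2" | "b = a_word 4 3" | "b = a_word 4 4" | "b = b_word 4 2" | "b = b_word 4 3"
    | "b = b_word 4 4" | "b = c_word 4 2 3" | "b = c_word 4 3 2" unfolding set by blast
  then show "\<exists>lam :: nat list \<Rightarrow> 'k. nil_functional lam \<and> lam b \<noteq> 0 \<and> (\<forall>b' \<in> ?B. b' \<noteq> b \<longrightarrow> lam b' = 0)"
  proof cases
    case 1
    show ?thesis unfolding set 1
      using functional[of "\<lambda>i. if i = 0 then 0 else 1" "\<lambda>j. if j = 0 \<or> j = 2 then 1 else 0" True]
      by (elim exE, rule_tac x = lam in exI) (auto simp: add_self simp del: one_add_one)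
  next
    case 2
    show ?thesis unfolding set 2
      using functional[of "\<lambda>i. 0" "\<lambda>j. if j = 3 then 1 else 0" True]
      by (elim exE, rule_tac x = lam in exI) (auto simp: add_self simp del: one_add_one)
  next
    case 3
    show ?thesis unfolding set 3
      using functional[of "\<lambda>i. 0" "\<lambda>j. if j = 4 then 1 else 0" False]
      by (elim exE, rule_tac x = lam in exI) (auto simp: add_self simp del: one_add_one)
  next
    case 4
    show ?thesis unfolding set 4
      using functional[of "\<lambda>i. if i = 2 then 1 else 0" "\<lambda>j. 0" True]
      by (elim exE, rule_tac x = lam in exI) (auto simp: add_self simp del: one_add_one)
  next
    case 5
    show ?thesis unfolding set 5
      using functional[of "\<lambda>i. if i = 0 \<or> i = 3 then 1 else 0" "\<lambda>j. if j = 0 then 0 else 1" True]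
      by (elim exE, rule_tac x = lam in exI) (auto simp: add_self simp del: one_add_one)
  next
    case 6
    show ?thesis unfolding set 6
      using functional[of "\<lambda>i. if i = 4 then 1 else 0" "\<lambda>j. 0" False]
      by (elim exE, rule_tac x = lam in exI) (auto simp: add_self simp del: one_add_one)
  next
    case 7
    show ?thesis unfolding set 7
      using functional[of "\<lambda>i. 0" "\<lambda>j. 0" True]
      by (elim exE, rule_tac x = lam in exI) (auto simp: add_self simp del: one_add_one)
  next
    case 8
    show ?thesis unfolding set 8
      using functional[of "\<lambda>i. if i = 0 then 1 else 0" "\<lambda>j. if j = 0 then 0 else 1" True]
      by (elim exE, rule_tac x = lam in exI) (auto simp: add_self simp del: one_add_one)
  qed
qed

end

section \<open>Small degrees and vanishing components\<close>

lemma content_from_below: "j < i \<Longrightarrow> j \<notin># content_from i ns"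
  by (simp add: not_in_iff count_content_from)

lemma mset_singleton: "mset w = {#a#} \<Longrightarrow> w = [a]"
  by (simp only: mset_single_iff)

context nil_char2
begin

lemma span_111:
  assumes zero: "lam [1, 2, 3] = 0" "lam [1, 3, 2] = 0" "lam [2, 1, 3] = 0" "lam [2, 3, 1] = 0" "lam [3, 1, 2] = 0"
    and w: "mset w = {#1, 2, 3#}"
  shows "lam w = 0"
proof -
  have "lam [3, 2, 1] = 0" using S3[of "[1]" "[2]" "[3]" "[]" "[]"] zero by simp
  then show ?thesis using perms3[OF w] zero by auto
qed

lemma high_power_zero:
  assumes "4 \<le> n" "mset w = content (n # ds)"
  shows "lam w = 0"
proof (rule four_letters[of _ 1])
  have "count (content (n # ds)) 1 = n" by (simp only: count_content_from) simp
  then show "4 \<le> count (mset w) 1" using assms by simp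
qed

lemma cube_and_square_zero:
  assumes "2 \<le> m" "1 \<le> n" and w: "mset w = content (3 # m # n # ds)"
  shows "lam w = 0"
proof (rule span_three_two[of "content_from 2 (m # n # ds)" 1 2 3])
  show "{#2, 2, 3#} \<subseteq># content_from 2 (m # n # ds)"
  proof (rule mset_subset_eqI)
    fix j :: nat
    have "j = 2 \<or> j = 3 \<or> (j \<noteq> 2 \<and> j \<noteq> 3)" by blast
    then show "count {#2, 2, 3#} j \<le> count (content_from 2 (m # n # ds)) j"
      using assms(1,2) by (elim disjE) (simp_all add: count_content_from del: content_from.simps)
  qed
  show "mset w = {#1, 1, 1#} + content_from 2 (m # n # ds)"
    unfolding w by (simp add: numeral_3_eq_3 numeral_2_eq_2)
qed (simp_all add: content_from_below del: content_from.simps)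

lemma two_cubes_zero:
  assumes w: "mset w = content [3, 3]"
  shows "lam w = 0"
proof (rule span_three_two[of "{#2, 2, 2#}" 1 2 2])
  show "mset w = {#1, 1, 1#} + {#2, 2, 2#}" unfolding w by (simp add: eval_nat_numeral)
qed simp_all

lemma cube_zero:
  assumes w: "mset w = content [3]"
  shows "lam w = 0"
proof -
  have "mset w = replicate_mset 3 1" using w by simp
  then have "set w \<subseteq> {1}" "length w = 3"
    by (metis set_mset_mset set_mset_replicate_mset_subset subset_singleton_iff,
        metis size_mset size_replicate_mset)
  then have "w = replicate 3 1" by (metis replicate_eqI singletonD subsetD)
  then show ?thesis using cube_letter[of "[]" 1 "[]"] by (simp add: numeral_3_eq_3)
qed

lemma three_squares_zero:
  assumes w: "mset w = content (2 # 2 # 2 # ds)"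
  shows "lam w = 0"
proof (rule span_three_squares[of "content_from 4 ds" 2 3 w 1])
  have "Suc 3 = 4" "Suc 2 = 3" "Suc 1 = 2" by simp_all
  then show "mset w = {#1, 1, 2, 2, 3, 3#} + content_from 4 ds"
    unfolding w content_from.simps by (simp only: replicate_mset_2) simp
qed (simp_all add: content_from_below)

end

text \<open>Pairs of a word and a functional dual to it; the functionals satisfy all relations and the pairing
  is the identity matrix.\<close>

definition certified :: "nat list \<Rightarrow> (nat list \<times> (nat list \<Rightarrow> bool)) list \<Rightarrow> bool" where
  "certified xs cs \<longleftrightarrow> list_all (\<lambda>(b, Q). list_all (nil_check Q) (arrangements (length xs) xs) \<and>
     list_all (\<lambda>(b', _). Q b' \<longleftrightarrow> b' = b) cs) cs"

definition edge_parity :: "(nat \<times> nat) list \<Rightarrow> nat list \<Rightarrow> bool" where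
  "edge_parity E w = odd_pairs (\<lambda>x y. List.member E (x, y)) (0 # w @ [0])"

lemma certified_1:
  "certified [1] [([1], edge_parity [(0, 1)])]"
  by code_simp

lemma certified_2:
  "certified [1, 1] [([1, 1], edge_parity [(0, 1)])]"
  by code_simp

lemma certified_11:
  "certified [1, 2] [([1, 2], edge_parity [(1, 2)]), ([2, 1], edge_parity [(2, 1)])]"
  by code_simp

lemma certified_21:
  "certified [1, 1, 2] [([1, 1, 2], edge_parity [(1, 2)]), ([2, 1, 1], edge_parity [(2, 1)])]"
  by code_simp

lemma certified_22:
  "certified [1, 1, 2, 2] [([1, 1, 2, 2], edge_parity [(1, 2)]), ([2, 2, 1, 1], edge_parity [(2, 1)])]"
  by code_simp

lemma certified_31:
  "certified [1, 1, 1, 2] [([1, 1, 2, 1], edge_parity [(1, 1)])]"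
  by code_simp

lemma certified_32:
  "certified [1, 1, 1, 2, 2] [([1, 1, 2, 2, 1], edge_parity [(1, 1)])]"
  by code_simp

lemma certified_111:
  "certified [1, 2, 3] [([1, 2, 3], edge_parity [(1, 2), (0, 3)]), ([1, 3, 2], edge_parity [(1, 3), (2, 1)]),
    ([2, 1, 3], edge_parity [(2, 1)]), ([2, 3, 1], edge_parity [(1, 0)]), ([3, 1, 2], edge_parity [(0, 3)])]"
  by code_simp

lemma certified_211:
  "certified [1, 1, 2, 3] [([1, 1, 2, 3], edge_parity [(1, 2)]), ([1, 1, 3, 2], edge_parity [(0, 1), (1, 2)]),
    ([2, 1, 1, 3], edge_parity [(2, 1), (1, 0), (3, 1)]), ([2, 3, 1, 1], edge_parity [(3, 1)]),
    ([3, 2, 1, 1], edge_parity [(1, 0), (3, 1)])]"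
  by code_simp

lemma certified_221:
  "certified [1, 1, 2, 2, 3] [([1, 1, 2, 2, 3], \<lambda>w. edge_parity [(1, 2)] w \<noteq> phi w),
    ([2, 2, 1, 1, 3], edge_parity [(2, 1)]), ([3, 1, 1, 2, 2], phi)]"
  by code_simp

lemma certified_311:
  "certified [1, 1, 1, 2, 3] [([1, 1, 2, 3, 1], psi),
    ([1, 1, 3, 2, 1], \<lambda>w. edge_parity [(1, 1)] w \<noteq> psi w)]"
  by code_simp

context
  fixes K :: "'k::field itself"
  assumes inf: "infinite (UNIV :: 'k set)" and two: "(1::'k) + 1 = 0"
begin

interpretation char2 "TYPE('k)" by standard (rule two)

lemma certified_basis:
  assumes cert: "certified xs cs" and B: "B = fst ` set cs" "\<forall>b \<in> B. b \<noteq> [] \<and> mset b = mset xs"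
    and content: "content ds = mset xs" and d: "length ds = d"
    and span: "\<And>(lam :: nat list \<Rightarrow> 'k) w. nil_char2 lam \<Longrightarrow> \<forall>b \<in> B. lam b = 0 \<Longrightarrow>
      mset w = mset xs \<Longrightarrow> lam w = 0"
  shows "is_comp_basis TYPE('k) d ds B"
proof (rule basis_criterion[OF inf d])
  show "finite B" by (simp add: B(1))
  show "b \<noteq> [] \<and> mset b = content ds" if "b \<in> B" for b using B(2) that content by simp
  show "lam w = 0" if "nil_functional lam" "\<forall>b \<in> B. lam b = 0" "mset w = content ds"
    for lam :: "nat list \<Rightarrow> 'k" and w using span[OF nil_char2I[OF inf two]] that content by simp
  fix b assume b: "b \<in> B"
  then obtain Q where Q: "(b, Q) \<in> set cs" using B(1) by auto
  then have check: "list_all (nil_check Q) (arrangements (length xs) xs)" "\<forall>b' \<in> B. Q b' \<longleftrightarrow> b' = b"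
    using cert B(1) by (force simp: certified_def list_all_iff)+
  show "\<exists>lam :: nat list \<Rightarrow> 'k. nil_functional lam \<and> lam b \<noteq> 0 \<and> (\<forall>b' \<in> B. b' \<noteq> b \<longrightarrow> lam b' = 0)"
    by (intro exI[of _ "\<lambda>w. if mset w = mset xs then of_bool (Q w) else 0"] conjI nil_check_functional check(1))
      (use check(2) B(2) b in auto)
qed

theorem small_basis:
  assumes d: "1 \<le> d" "d \<le> 3" and ds: "ordered_multidegree d ds"
  shows "is_comp_basis TYPE('k) d ds (B_small ds)"
proof -
  have len: "length ds = d" using ds by (simp add: ordered_multidegree_def)
  have zero: "is_comp_basis TYPE('k) d ds (B_small ds)"
    if "B_small ds = {}" "\<And>(lam :: nat list \<Rightarrow> 'k) w. nil_char2 lam \<Longrightarrow> mset w = content ds \<Longrightarrow> lam w = 0"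
    unfolding that(1) by (rule zero_basis[OF inf two len]) (rule that(2))
  have basis: "is_comp_basis TYPE('k) d ds (B_small ds)"
    if "certified xs cs" "B_small ds = fst ` set cs" "\<forall>b \<in> fst ` set cs. b \<noteq> [] \<and> mset b = mset xs"
      "content ds = mset xs" "\<And>(lam :: nat list \<Rightarrow> 'k) w. nil_char2 lam \<Longrightarrow> \<forall>b \<in> fst ` set cs. lam b = 0 \<Longrightarrow>
        mset w = mset xs \<Longrightarrow> lam w = 0" for xs cs
    unfolding that(2) by (rule certified_basis[OF that(1) refl that(3,4) len]) (rule that(5))
  have sorted: "\<exists>a. ds = [a] \<and> 1 \<le> a" if "d = 1"
    using ds that by (auto simp: ordered_multidegree_def length_Suc_conv)
  have sorted2: "\<exists>a b. ds = [a, b] \<and> b \<le> a \<and> 1 \<le> b" if "d = 2"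
    using ds that by (auto simp: ordered_multidegree_def length_Suc_conv numeral_2_eq_2)
  have sorted3: "\<exists>a b c. ds = [a, b, c] \<and> b \<le> a \<and> c \<le> b \<and> 1 \<le> c" if "d = 3"
    using ds that by (auto simp: ordered_multidegree_def length_Suc_conv numeral_3_eq_3)
  have high: "is_comp_basis TYPE('k) d ds (B_small ds)" if "4 \<le> a" "ds = a # r" for a r
  proof -
    have "B_small ds = {}" using that by (simp add: B_small_def)
    then show ?thesis by (rule zero) (rule nil_char2.high_power_zero, assumption, rule that(1), simp only: that(2))
  qed
  have deg_1: "is_comp_basis TYPE('k) d ds (B_small ds)" if "ds = [1]"
    by (rule basis[OF certified_1])
        (simp add: that B_small_def, simp, simp add: that, drule mset_singleton[of _ 1, OF trans], simp, simp)
  have deg_2: "is_comp_basis TYPE('k) d ds (B_small ds)" if "ds = [2]"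
    by (rule basis[OF certified_2])
        (simp add: that B_small_def, simp, simp add: that eval_nat_numeral, drule perms2[of _ 1 1, OF trans], simp, simp)
  have deg_3: "is_comp_basis TYPE('k) d ds (B_small ds)" if "ds = [3]"
    by (rule zero) (simp add: that B_small_def, rule nil_char2.cube_zero, simp_all only: that)
  have deg_11: "is_comp_basis TYPE('k) d ds (B_small ds)" if "ds = [1, 1]"
    by (rule basis[OF certified_11])
        (simp add: that B_small_def, simp add: add_mset_commute, simp add: that eval_nat_numeral,
        drule perms2[of _ 1 2, OF trans], simp, auto)
  have deg_21: "is_comp_basis TYPE('k) d ds (B_small ds)" if "ds = [2, 1]"
    by (rule basis[OF certified_21])
        (simp add: that B_small_def, simp add: add_mset_commute, simp add: that eval_nat_numeral add_mset_commute,
        rule nil_char2.span_21, simp_all)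
  have deg_22: "is_comp_basis TYPE('k) d ds (B_small ds)" if "ds = [2, 2]"
    by (rule basis[OF certified_22])
        (simp add: that B_small_def, simp add: add_mset_commute, simp add: that eval_nat_numeral add_mset_commute,
        rule nil_char2.span_22, simp_all)
  have deg_31: "is_comp_basis TYPE('k) d ds (B_small ds)" if "ds = [3, 1]"
    by (rule basis[OF certified_31])
        (simp add: that B_small_def, simp add: add_mset_commute, simp add: that eval_nat_numeral add_mset_commute,
        rule nil_char2.span_31, simp_all)
  have deg_32: "is_comp_basis TYPE('k) d ds (B_small ds)" if "ds = [3, 2]"
    by (rule basis[OF certified_32])
        (simp add: that B_small_def, simp add: add_mset_commute, simp add: that eval_nat_numeral add_mset_commute,
        rule nil_char2.span_32, simp_all)
  have deg_33: "is_comp_basis TYPE('k) d ds (B_small ds)" if "ds = [3, 3]"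
    by (rule zero) (simp add: that B_small_def, rule nil_char2.two_cubes_zero, simp_all only: that)
  have deg_111: "is_comp_basis TYPE('k) d ds (B_small ds)" if "ds = [1, 1, 1]"
    by (rule basis[OF certified_111])
        (simp add: that B_small_def, simp add: add_mset_commute, simp add: that eval_nat_numeral add_mset_commute,
        rule nil_char2.span_111, simp_all)
  have deg_211: "is_comp_basis TYPE('k) d ds (B_small ds)" if "ds = [2, 1, 1]"
    by (rule basis[OF certified_211])
        (simp add: that B_small_def, simp add: add_mset_commute, simp add: that eval_nat_numeral add_mset_commute,
        rule nil_char2.span_211, simp_all)
  have deg_221: "is_comp_basis TYPE('k) d ds (B_small ds)" if "ds = [2, 2, 1]"
    by (rule basis[OF certified_221])
        (simp add: that B_small_def, simp add: add_mset_commute, simp add: that eval_nat_numeral add_mset_commute,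
        rule nil_char2.span_221, simp_all)
  have deg_222: "is_comp_basis TYPE('k) d ds (B_small ds)" if "ds = [2, 2, 2]"
    by (rule zero) (simp add: that B_small_def, rule nil_char2.three_squares_zero, simp_all only: that)
  have deg_311: "is_comp_basis TYPE('k) d ds (B_small ds)" if "ds = [3, 1, 1]"
    by (rule basis[OF certified_311])
        (simp add: that B_small_def, simp add: add_mset_commute, simp add: that eval_nat_numeral add_mset_commute,
        rule nil_char2.span_311, simp_all)
  have cube_square: "is_comp_basis TYPE('k) d ds (B_small ds)" if "2 \<le> b" "1 \<le> c" "ds = [3, b, c]" for b c
  proof -
    have "B_small ds = {}" using that by (simp add: B_small_def)
    then show ?thesis
      by (rule zero) (rule nil_char2.cube_and_square_zero, assumption, rule that(1), rule that(2), simp only: that(3))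
  qed
  have "d = 1 \<or> d = 2 \<or> d = 3" using d by linarith
  then show ?thesis
  proof (elim disjE)
    assume "d = 1"
    then obtain a where a: "ds = [a]" "1 \<le> a" using sorted by blast
    then have "a = 1 \<or> a = 2 \<or> a = 3 \<or> 4 \<le> a" by linarith
    then have "ds = [1] \<or> ds = [2] \<or> ds = [3] \<or> 4 \<le> a" using a(1) by (elim disjE) simp_all
    then show ?thesis using deg_1 deg_2 deg_3 high[OF _ a(1)] by blast
  next
    assume "d = 2"
    then obtain a b where ab: "ds = [a, b]" "b \<le> a" "1 \<le> b" using sorted2 by blast
    then have "a = 1 \<or> a = 2 \<or> a = 3 \<or> 4 \<le> a" by linarith
    then show ?thesis
    proof (elim disjE)
      assume "a = 1"
      then have "b = 1" using ab by linarith
      then show ?thesis using ab(1) \<open>a = 1\<close> by (intro deg_11) simp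
    next
      assume "a = 2"
      then have "b = 1 \<or> b = 2" using ab by linarith
      then have "ds = [2, 1] \<or> ds = [2, 2]" using ab(1) \<open>a = 2\<close> by (elim disjE) simp_all
      then show ?thesis using deg_21 deg_22 by blast
    next
      assume "a = 3"
      then have "b = 1 \<or> b = 2 \<or> b = 3" using ab by linarith
      then have "ds = [3, 1] \<or> ds = [3, 2] \<or> ds = [3, 3]" using ab(1) \<open>a = 3\<close> by (elim disjE) simp_all
      then show ?thesis using deg_31 deg_32 deg_33 by blast
    qed (rule high[OF _ ab(1)])
  next
    assume "d = 3"
    then obtain a b c where abc: "ds = [a, b, c]" "b \<le> a" "c \<le> b" "1 \<le> c" using sorted3 by blast
    then have "a = 1 \<or> a = 2 \<or> a = 3 \<or> 4 \<le> a" by linarith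
    then show ?thesis
    proof (elim disjE)
      assume "a = 1"
      then have "b = 1" "c = 1" using abc by linarith+
      then show ?thesis using abc(1) \<open>a = 1\<close> by (intro deg_111) simp
    next
      assume "a = 2"
      then have "b = 1 \<or> b = 2" "c = 1 \<or> c = 2" using abc by linarith+
      then have "ds = [2, 1, 1] \<or> ds = [2, 2, 1] \<or> ds = [2, 2, 2]" using abc \<open>a = 2\<close> by (elim disjE) simp_all
      then show ?thesis using deg_211 deg_221 deg_222 by blast
    next
      assume a: "a = 3"
      show ?thesis
      proof (cases "b = 1")
        case True
        then have "c = 1" using abc by linarith
        then show ?thesis using abc(1) a True by (intro deg_311) simp
      next
        case False
        then have "2 \<le> b" using abc by linarith
        then show ?thesis by (rule cube_square[OF _ abc(4)]) (simp add: abc(1) a)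
      qed
    qed (rule high[OF _ abc(1)])
  qed
qed

text \<open>A decreasing multidegree outside the list begins with an entry at least four, with a three
  followed by an entry at least two, or with three twos.\<close>

theorem remaining_zero:
  assumes d: "4 \<le> d" and ds: "ordered_multidegree d ds"
    and other: "ds \<notin> {replicate d 1, 2 # replicate (d - 1) 1, 2 # 2 # replicate (d - 2) 1, 3 # replicate (d - 1) 1}"
  shows "carrier (N3_comp d ds :: ('k, 'k freealg set) module) = {\<zero>\<^bsub>(N3 d :: ('k, 'k freealg set) module)\<^esub>}"
proof -
  have len: "length ds = d" using ds by (simp add: ordered_multidegree_def)
  obtain m ds1 where 1: "ds = m # ds1" using len d by (cases ds) simp_all
  obtain n ds2 where 2: "ds1 = n # ds2" using len d 1 by (cases ds1) simp_all
  obtain k r where 3: "ds2 = k # r" using len d 1 2 by (cases ds2) simp_all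
  have r: "ds = m # n # k # r" using 1 2 3 by simp
  have le: "n \<le> m" "k \<le> n" "1 \<le> k" "\<forall>x \<in> set r. x \<le> k \<and> 1 \<le> x"
    using ds by (auto simp: r ordered_multidegree_def)
  have ones: "k # r = replicate (d - 2) 1" if "k = 1"
    using le(4) that len r by (intro replicate_eqI) force+
  have rep: "1 # replicate (d - 2) 1 = replicate (d - 1) (1::nat)" "1 # replicate (d - 1) 1 = replicate d (1::nat)"
    using d by (simp_all flip: replicate_Suc add: Suc_diff_Suc numeral_2_eq_2)
  have n1: "\<not> (n = 1 \<and> m \<le> 3)"
  proof
    assume nm: "n = 1 \<and> m \<le> 3"
    then have "k = 1" using le by linarith
    then have "n # k # r = replicate (d - 1) 1" using ones rep(1) nm by simp
    moreover have "m = 1 \<or> m = 2 \<or> m = 3" using nm le by linarith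
    ultimately show False using other rep(2) by (auto simp: r)
  qed
  have k1: "\<not> (m = 2 \<and> n = 2 \<and> k = 1)" using ones other by (auto simp: r)
  have shape: "4 \<le> m \<or> m = 3 \<and> 2 \<le> n \<or> m = 2 \<and> n = 2 \<and> k = 2"
  proof (cases "4 \<le> m \<or> m = 3 \<and> 2 \<le> n")
    case False
    then have "n \<noteq> 1" using n1 by auto
    then have n: "2 \<le> n" using le by linarith
    then have "m \<noteq> 3" "m < 4" using False by auto
    then have mn: "m = 2" "n = 2" using n le by linarith+
    then have "k \<noteq> 1" using k1 by simp
    then have "k = 2" using mn le by linarith
    then show ?thesis using mn by simp
  qed blast
  have vanish: "lam w = 0" if lam: "nil_char2 lam" and w: "mset w = content ds" for lam :: "nat list \<Rightarrow> 'k" and w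
    using shape
  proof (elim disjE conjE)
    assume "4 \<le> m"
    then show ?thesis by (rule nil_char2.high_power_zero[OF lam]) (simp only: w r)
  next
    assume "m = 3" "2 \<le> n"
    then show ?thesis by (intro nil_char2.cube_and_square_zero[OF lam _ le(3)]) (simp_all only: w r)
  next
    assume "m = 2" "n = 2" "k = 2"
    then show ?thesis by (intro nil_char2.three_squares_zero[OF lam]) (simp only: w r)
  qed
  show ?thesis by (rule component_zero[OF inf len]) (rule vanish[OF nil_char2I[OF inf two]])
qed

end

theorem theorem2:
  fixes d :: nat
  assumes "infinite (UNIV :: 'k::field set)"
    and "CHAR('k) = 2"
    and "1 \<le> d"
  shows "(d \<le> 3 \<longrightarrow>
           (\<forall>\<Delta>. ordered_multidegree d \<Delta> \<longrightarrow> is_comp_basis TYPE('k) d \<Delta> (B_small \<Delta>)))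
    \<and> (4 \<le> d \<longrightarrow> is_comp_basis TYPE('k) d (replicate d 1) (B_lin d))
    \<and> (d = 4 \<longrightarrow> is_comp_basis TYPE('k) d [2, 1, 1, 1]
           (a_word d ` {2..4} \<union> b_word d ` {2..4} \<union> {c_word d 2 3, c_word d 3 2}))
    \<and> (5 \<le> d \<longrightarrow> is_comp_basis TYPE('k) d (2 # replicate (d - 1) 1)
           (a_word d ` {2..d} \<union> b_word d ` {2..d} \<union> {c_word d 2 3}))
    \<and> (4 \<le> d \<longrightarrow> is_comp_basis TYPE('k) d (2 # 2 # replicate (d - 2) 1)
           {[1, 1, 2, 2] @ letter_run 3 d, [2, 2, 1, 1] @ letter_run 3 d})
    \<and> (4 \<le> d \<longrightarrow> is_comp_basis TYPE('k) d (3 # replicate (d - 1) 1)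
           {[1, 1] @ letter_run 2 d @ [1]})
    \<and> (4 \<le> d \<longrightarrow>
           (\<forall>\<Delta>. ordered_multidegree d \<Delta> \<and>
                \<Delta> \<notin> {replicate d 1, 2 # replicate (d - 1) 1, 2 # 2 # replicate (d - 2) 1,
                      3 # replicate (d - 1) 1}
              \<longrightarrow> carrier (N3_comp d \<Delta> :: ('k, 'k freealg set) module) =
                  {\<zero>\<^bsub>(N3 d :: ('k, 'k freealg set) module)\<^esub>}))"
proof -
  note inf = assms(1)
  have "(of_nat 2 :: 'k) = 0" using of_nat_CHAR[where 'a = 'k] assms(2) by simp
  then have two: "(1::'k) + 1 = 0" by simp
  show ?thesis
  proof (intro conjI impI allI, goal_cases)
    case (1 ds)
    then show ?case by (rule small_basis[OF inf two assms(3)])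
  next
    case 2
    then show ?case by (rule multilinear_basis[OF inf two])
  next
    case 3
    show ?case unfolding 3 by (rule double_basis_4[OF inf two])
  next
    case 4
    then show ?case by (rule double_basis[OF inf two])
  next
    case 5
    then show ?case by (rule two_squares_basis[OF inf two])
  next
    case 6
    then show ?case by (rule cube_basis[OF inf two])
  next
    case (7 ds)
    then show ?case
      by (intro remaining_zero[OF inf two]) (assumption | erule conjunct1 | erule conjunct2)+
  qed
qed

end
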